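(* Let $\Omega\subseteq\mathbb{R}^n$ be open and bounded, and let $F\colon\mathcal{S}^n\times\Omega\to\mathbb{R}$. Suppose there exists a positive lower semicontinuous function $\lambda\colon\Omega\to(0,\infty)$ such that $$F(Y,x)-F(X,x)\ge\lambda(x)\operatorname{tr}(Y-X)$$ for all $x\in\Omega$ and all $X,Y\in\mathcal{S}^n$ with $X\le Y$. Suppose further that for every compact $K\subseteq\Omega$ there is a modulus of continuity $\omega$ such that $$|F(X,x)-F(X,y)|\le\omega\big((\|X\|+1)|x-y|\big)$$ whenever $X\in\mathcal{S}^n$ and $x,y\in K$. Then the comparison principle holds for the equation $F(\mathcal{H}w,x)=0$ in $\Omega$.
   Context: $\mathcal{S}^n$ is the space of real symmetric $n\times n$ matrices with its usual partial order ($X\le Y$ iff $Y-X$ is positive semidefinite); $\|X\|=\sqrt{\operatorname{tr}(X^2)}$; $\mathcal{H}w$ is the Hessian matrix of $w$. A modulus of continuity is a nondecreasing function $\omega\colon[0,\infty)\to[0,\infty)$ with $\omega(0)=0=\lim_{r\to0^+}\omega(r)$. Viscosity solutions: $v\in USC(\overline\Omega)$ is a viscosity subsolution of $F(\mathcal{H}w,x)=0$ in $\Omega$ if, whenever $x_0\in\Omega$ and $\phi$ is a $C^2$ function near $x_0$ with $\phi(x_0)=v(x_0)$ and $\phi\ge v$ near $x_0$, then $F(\mathcal{H}\phi(x_0),x_0)\ge0$. $u\in LSC(\overline\Omega)$ is a viscosity supersolution if, whenever $\phi$ is $C^2$ near $x_0\in\Omega$ with $\phi(x_0)=u(x_0)$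 and $\phi\le u$ near $x_0$, then $F(\mathcal{H}\phi(x_0),x_0)\le0$. ($USC$, $LSC$: real-valued upper/lower semicontinuous functions.) The comparison principle holds for the equation in $\Omega$ if: whenever $v\in USC(\overline\Omega)$ is a viscosity subsolution and $u\in LSC(\overline\Omega)$ is a viscosity supersolution in $\Omega$ with $v\le u$ on $\partial\Omega$, then $v\le u$ in $\Omega$. *)

theory Defs
  imports "HOL-Analysis.Analysis"
begin

section \<open>Symmetric matrices\<close>

definition sym_matrices :: "(real^'n^'n) set" where
  "sym_matrices = {X. transpose X = X}"

definition psd :: "real^'n^'n \<Rightarrow> bool" where
  "psd X \<longleftrightarrow> X \<in> sym_matrices \<and> (\<forall>z. 0 \<le> z \<bullet> (X *v z))"

text \<open>The library's \<open>\<le>\<close> on \<^typ>\<open>real^'n^'n\<close> is the componentwise order, hence a separate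
  relation for the order of symmetric matrices.\<close>

definition sym_le :: "real^'n^'n \<Rightarrow> real^'n^'n \<Rightarrow> bool" where
  "sym_le X Y \<longleftrightarrow> psd (Y - X)"

definition sym_norm :: "real^'n^'n \<Rightarrow> real" where
  "sym_norm X = sqrt (trace (X ** X))"

section \<open>Hessians and \<open>C\<^sup>2\<close> functions\<close>

definition partial_deriv :: "'n \<Rightarrow> (real^'n \<Rightarrow> real) \<Rightarrow> real^'n \<Rightarrow> real" where
  "partial_deriv i f x = frechet_derivative f (at x) (axis i 1)"

definition hessian :: "(real^'n \<Rightarrow> real) \<Rightarrow> real^'n \<Rightarrow> real^'n^'n" where
  "hessian f x = (\<chi> i j. partial_deriv i (partial_deriv j f) x)"

text \<open>Differentiability is required explicitly, because \<^const>\<open>frechet_derivative\<close> is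
  unspecified where no derivative exists.\<close>

definition C2_near :: "(real^'n \<Rightarrow> real) \<Rightarrow> real^'n \<Rightarrow> bool" where
  "C2_near f x0 \<longleftrightarrow> (\<exists>U. open U \<and> x0 \<in> U \<and>
     (\<forall>x\<in>U. f differentiable (at x)) \<and>
     (\<forall>i. \<forall>x\<in>U. partial_deriv i f differentiable (at x)) \<and>
     (\<forall>i j. continuous_on U (partial_deriv i (partial_deriv j f))))"

section \<open>Semicontinuity and moduli of continuity\<close>

definition usc_on :: "'a::topological_space set \<Rightarrow> ('a \<Rightarrow> real) \<Rightarrow> bool" where
  "usc_on S f \<longleftrightarrow> (\<forall>x\<in>S. \<forall>a. f x < a \<longrightarrow> (\<forall>\<^sub>F y in at x within S. f y < a))"

definition lsc_on :: "'a::topological_space set \<Rightarrow> ('a \<Rightarrow> real) \<Rightarrow> bool" where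
  "lsc_on S f \<longleftrightarrow> (\<forall>x\<in>S. \<forall>a. a < f x \<longrightarrow> (\<forall>\<^sub>F y in at x within S. a < f y))"

definition modulus_of_continuity :: "(real \<Rightarrow> real) \<Rightarrow> bool" where
  "modulus_of_continuity \<omega> \<longleftrightarrow>
     (\<forall>r\<ge>0. 0 \<le> \<omega> r) \<and> mono_on {0..} \<omega> \<and> \<omega> 0 = 0 \<and> (\<omega> \<longlongrightarrow> 0) (at_right 0)"

section \<open>Viscosity solutions\<close>

text \<open>Functions on \<open>closure \<Omega>\<close> are represented by total functions whose values elsewhere are
  irrelevant; likewise \<^term>\<open>F X x\<close> only matters for symmetric \<^term>\<open>X\<close> and \<open>x \<in> \<Omega>\<close>.\<close>

definition viscosity_subsolution ::
  "(real^'n^'n \<Rightarrow> real^'n \<Rightarrow> real) \<Rightarrow> (real^'n) set \<Rightarrow> (real^'n \<Rightarrow> real) \<Rightarrow> bool" where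
  "viscosity_subsolution F \<Omega> v \<longleftrightarrow> usc_on (closure \<Omega>) v \<and>
     (\<forall>x0\<in>\<Omega>. \<forall>\<phi>. C2_near \<phi> x0 \<and> \<phi> x0 = v x0 \<and> (\<forall>\<^sub>F x in nhds x0. v x \<le> \<phi> x)
        \<longrightarrow> 0 \<le> F (hessian \<phi> x0) x0)"

definition viscosity_supersolution ::
  "(real^'n^'n \<Rightarrow> real^'n \<Rightarrow> real) \<Rightarrow> (real^'n) set \<Rightarrow> (real^'n \<Rightarrow> real) \<Rightarrow> bool" where
  "viscosity_supersolution F \<Omega> u \<longleftrightarrow> lsc_on (closure \<Omega>) u \<and>
     (\<forall>x0\<in>\<Omega>. \<forall>\<phi>. C2_near \<phi> x0 \<and> \<phi> x0 = u x0 \<and> (\<forall>\<^sub>F x in nhds x0. \<phi> x \<le> u x)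
        \<longrightarrow> F (hessian \<phi> x0) x0 \<le> 0)"

definition comparison_principle ::
  "(real^'n^'n \<Rightarrow> real^'n \<Rightarrow> real) \<Rightarrow> (real^'n) set \<Rightarrow> bool" where
  "comparison_principle F \<Omega> \<longleftrightarrow>
     (\<forall>v u. viscosity_subsolution F \<Omega> v \<and> viscosity_supersolution F \<Omega> u \<and>
        (\<forall>x\<in>frontier \<Omega>. v x \<le> u x) \<longrightarrow> (\<forall>x\<in>\<Omega>. v x \<le> u x))"

end

theory Submission
  imports Defs "HOL-Complex_Analysis.Great_Picard"
begin

text \<open>
  Suppose that \<open>v - u\<close> has a positive maximum. After adding a small multiple of \<open>|x|\<^sup>2\<close> to \<open>v\<close>, replace
  \<open>v\<close> and \<open>u\<close> by their sup- and inf-convolutions \<open>f\<close>, \<open>g\<close> with parameter \<open>K\<close>. Near a maximum of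
  \<open>f - g\<close> one finds points where \<open>f\<close> and \<open>g\<close> are touched by quadratic functions with, up to a small
  error, the same Hessian \<open>X\<close>, and \<open>- K \<le> X \<le> K\<close>. Transferring the contact to \<open>v\<close> along the
  matrix \<open>1 - X / (2 K)\<close> improves the Hessian to \<open>X - X\<^sup>2 / (2 K)\<close>, so ellipticity gains a multiple
  of \<open>\<parallel>X\<parallel>\<^sup>2 / K\<close>. As \<open>K |z1 - z2|\<^sup>2 \<rightarrow> 0\<close> for the contact points \<open>z1\<close>, \<open>z2\<close>, this gain beats the
  modulus of continuity evaluated at \<open>(\<parallel>X\<parallel> + 1) |z1 - z2|\<close>.

  Second order expansions are obtained without the theorems of Rademacher and Alexandrov. The second
  difference quotient of a convex function at scale \<open>2 s\<close> is an average of those at scale \<open>s\<close>, so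
  the integral of a bounded strictly convex function of it increases along dyadic scales and stays
  bounded. Hence almost everywhere the Jensen gaps tend to 0, and at a point where the function
  is trapped between two paraboloids every blow-up limit has vanishing third differences, that is, it is
  a quadratic form. Since perturbations at a single small scale suffice for touching, subsequential
  limits are enough.
\<close>

section \<open>Second differences along dyadic scales\<close>

text \<open>The obstacle is a mismatch of orders. Penalisation makes
  \<open>K * (norm (z1 - z2))\<^sup>2\<close> small, but the modulus is evaluated at a multiple of
  \<open>norm X * norm (z1 - z2)\<close>, and \<open>norm X\<close> is only known to be of order
  \<open>K\<close>; the product \<open>K * norm (z1 - z2)\<close> need not be small. The gain
  repairs this through Young's inequality: a term \<open>norm X * norm (z1 - z2)\<close> is at most
  a small part of the gain plus a multiple of \<open>K * (norm (z1 - z2))\<^sup>2\<close>.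

  Two requirements follow. The modulus has to be replaced by one of at most linear growth, which is
  done by subdividing segments; hence all contact points must first be brought into one ball inside
  the domain. And the gain must be extracted from the convolution: moving the evaluation point of
  the sup-convolution by a linear image of the displacement, and not by the displacement itself,
  leaves a free matrix. It is used for only one of the two functions.\<close>

definition second_diff :: "('a::real_vector \<Rightarrow> real) \<Rightarrow> 'a \<Rightarrow> 'a \<Rightarrow> real" where
  "second_diff f x e = f (x + 2 *\<^sub>R e) - 2 * f (x + e) + f x"

text \<open>The midpoint defect in Jensen's inequality for \<open>1 / (1 + a)\<close>. On
  nonnegative arguments this function is strictly convex, so a vanishing defect forces
  \<open>a = b\<close>.\<close>

definition jensen_gap :: "real \<Rightarrow> real \<Rightarrow> real" where
  "jensen_gap a b = (1 / (1 + a) + 1 / (1 + b)) / 2 - 1 / (1 + (a + b) / 2)"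

lemma jensen_gap_eq:
  assumes "0 \<le> a" "0 \<le> b"
  shows "jensen_gap a b = (a - b)\<^sup>2 / (2 * (1 + a) * (1 + b) * (2 + a + b))"
proof -
  have "1 + a \<noteq> 0" "1 + b \<noteq> 0" "2 + a + b \<noteq> 0"
    using assms by auto
  moreover have "1 / (1 + (a + b) / 2) = 2 / (2 + a + b)"
    using assms by (simp add: field_simps)
  ultimately show ?thesis
    unfolding jensen_gap_def by (simp add: divide_simps) (simp add: algebra_simps power2_eq_square)
qed

lemma jensen_gap_nonneg: "0 \<le> a \<Longrightarrow> 0 \<le> b \<Longrightarrow> 0 \<le> jensen_gap a b"
  by (simp add: jensen_gap_eq)

text \<open>The weights 1/4, 1/2, 1/4 arise by averaging twice: Jensen for \<open>a, b\<close> and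
  for \<open>b, c\<close>, then for the two midpoints. Only the defect of the pair
  \<open>a, b\<close> is kept, with the weight 1/2 that it has in the outer average.\<close>

lemma jensen_gap_weighted:
  assumes "0 \<le> a" "0 \<le> b" "0 \<le> c"
  shows "1 / (1 + (a + 2 * b + c) / 4) + jensen_gap a b / 2
    \<le> (1 / (1 + a) + 2 * (1 / (1 + b)) + 1 / (1 + c)) / 4"
proof -
  have mid: "((a + b) / 2 + (b + c) / 2) / 2 = (a + 2 * b + c) / 4"
    by (simp add: field_simps)
  have gaps: "0 \<le> jensen_gap b c" "0 \<le> jensen_gap ((a + b) / 2) ((b + c) / 2)"
    using assms by (auto intro!: jensen_gap_nonneg)
  have aux: "Z + ((A + B) / 2 - X) / 2 \<le> (A + 2 * B + C) / 4"
    if "0 \<le> (B + C) / 2 - Y" "0 \<le> (X + Y) / 2 - Z" for A B C X Y Z :: real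
    using that by (simp add: field_simps)
  show ?thesis
    using gaps unfolding jensen_gap_def mid by (rule aux)
qed

text \<open>With \<open>T\<close> the translation by \<open>e /\<^sub>R 2 ^ Suc k\<close> this is
  the factorisation \<open>(T^2 - 1)^2 = (T - 1)^2 * (1 + 2 * T + T^2)\<close>; the powers of 4 turn
  differences into difference quotients.\<close>

lemma second_diff_refine:
  "4 ^ k * second_diff f x (e /\<^sub>R 2 ^ k)
    = (4 ^ Suc k * second_diff f x (e /\<^sub>R 2 ^ Suc k)
       + 2 * (4 ^ Suc k * second_diff f (x + e /\<^sub>R 2 ^ Suc k) (e /\<^sub>R 2 ^ Suc k))
       + 4 ^ Suc k * second_diff f (x + 2 *\<^sub>R (e /\<^sub>R 2 ^ Suc k)) (e /\<^sub>R 2 ^ Suc k)) / 4"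
proof -
  define s where "s = e /\<^sub>R 2 ^ Suc k"
  have "e /\<^sub>R 2 ^ k = 2 *\<^sub>R s"
    by (simp add: s_def)
  then show ?thesis
    unfolding s_def[symmetric] second_diff_def
    by (simp add: algebra_simps scaleR_2)
qed

section \<open>Monotone energy and almost everywhere convergence\<close>

lemma nn_integral_lborel_translate:
  fixes f :: "'a::euclidean_space \<Rightarrow> ennreal"
  assumes "f \<in> borel_measurable borel"
  shows "(\<integral>\<^sup>+x. f (x + t) \<partial>lborel) = (\<integral>\<^sup>+x. f x \<partial>lborel)"
proof -
  have "lborel = distr lborel borel (\<lambda>x. t + x)"
    using lborel_affine[of 1 t] by (simp add: density_1)
  then have "(\<integral>\<^sup>+x. f x \<partial>lborel) = (\<integral>\<^sup>+x. f x \<partial>distr lborel borel (\<lambda>x. t + x))"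
    by simp
  also have "\<dots> = (\<integral>\<^sup>+x. f (t + x) \<partial>lborel)"
    using assms by (subst nn_integral_distr) auto
  finally show ?thesis
    by (simp add: add.commute)
qed

lemma AE_tendsto_0_of_summable_integrals:
  fixes f :: "nat \<Rightarrow> 'a \<Rightarrow> real"
  assumes meas: "\<And>k. f k \<in> borel_measurable M" and nn: "\<And>k x. 0 \<le> f k x"
    and bound: "\<And>n. (\<Sum>k<n. \<integral>\<^sup>+x. f k x \<partial>M) \<le> B" and "B < \<infinity>"
  shows "AE x in M. (\<lambda>k. f k x) \<longlonglongrightarrow> 0"
proof -
  have "(\<integral>\<^sup>+x. (\<Sum>k. ennreal (f k x)) \<partial>M) = (\<Sum>k. \<integral>\<^sup>+x. f k x \<partial>M)"
    using meas by (intro nn_integral_suminf) auto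
  also have "\<dots> \<le> B"
    by (intro suminf_le_const bound) auto
  finally have "(\<integral>\<^sup>+x. (\<Sum>k. ennreal (f k x)) \<partial>M) \<noteq> \<infinity>"
    using \<open>B < \<infinity>\<close> by (auto simp: top_unique)
  then have "AE x in M. (\<Sum>k. ennreal (f k x)) \<noteq> \<infinity>"
    using meas by (intro nn_integral_PInf_AE) auto
  then show ?thesis
    by eventually_elim (auto intro!: summable_LIMSEQ_zero summable_suminf_not_top nn)
qed

text \<open>The balls grow with \<open>k\<close> so that the translates occurring in the averages stay inside the next
  ball; boundedness of the energy needs no bound on the second differences because
  \<open>1 / (1 + a) \<le> 1\<close>.\<close>

lemma dyadic_energy_bound:
  fixes c :: "'a::euclidean_space \<Rightarrow> real"
  assumes cont: "continuous_on UNIV c" and conv: "\<And>x e. 0 \<le> second_diff c x e"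
  defines "a \<equiv> \<lambda>e k x. 4 ^ k * second_diff c x (e /\<^sub>R 2 ^ k)"
  shows "\<exists>B<\<infinity>. \<forall>n. (\<Sum>k<n. \<integral>\<^sup>+x. jensen_gap (a e (Suc k) x) (a e (Suc k) (x + e /\<^sub>R 2 ^ Suc k))
            * indicator (ball 0 R) x \<partial>lborel) \<le> B"
proof -
  define s where "s k = e /\<^sub>R 2 ^ k" for k :: nat
  define \<rho> where "\<rho> k = R + 2 * norm e * (1 - 1 / 2 ^ k)" for k :: nat
  define \<phi> where "\<phi> k x = 1 / (1 + a e k x)" for k x
  define G where "G k x = jensen_gap (a e (Suc k) x) (a e (Suc k) (x + s (Suc k)))" for k x
  have a_cont: "continuous_on UNIV (a e k)" for k
    unfolding a_def second_diff_def
    by (intro continuous_intros continuous_on_compose2[OF cont]) auto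
  have a_nn: "0 \<le> a e k x" for k x
    by (simp add: a_def conv)
  have [measurable]: "a e k \<in> borel_measurable borel" for k
    by (intro borel_measurable_continuous_onI a_cont)
  have [measurable]: "\<phi> k \<in> borel_measurable borel" "G k \<in> borel_measurable borel" for k
    unfolding \<phi>_def G_def jensen_gap_def by measurable
  have [measurable]: "ball (0::'a) r \<in> sets borel" for r
    by simp
  have \<phi>_nn: "0 \<le> \<phi> k x" and \<phi>_le: "\<phi> k x \<le> 1" for k x
    using a_nn[of k x] by (auto simp: \<phi>_def)
  have G_nn: "0 \<le> G k x" for k x
    by (simp add: G_def jensen_gap_nonneg a_nn)
  define E where "E k = (\<integral>\<^sup>+x. ennreal (\<phi> k x * indicator (ball 0 (\<rho> k)) x) \<partial>lborel)" for k
  have \<rho>_mono: "R \<le> \<rho> k" for k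
    by (simp add: \<rho>_def)
  have ind: "indicator (ball 0 (\<rho> k)) x \<le> (indicator (ball 0 (\<rho> (Suc k))) (x + t *\<^sub>R s (Suc k)) :: real)"
    if "0 \<le> t" "t \<le> 2" for k x t
  proof -
    have "norm (t *\<^sub>R s (Suc k)) \<le> 2 * norm e / 2 ^ Suc k"
      using that by (simp add: s_def divide_simps mult.commute[of t] mult_left_mono)
    also have "\<dots> = \<rho> (Suc k) - \<rho> k"
      by (simp add: \<rho>_def field_simps)
    finally have "norm (x + t *\<^sub>R s (Suc k)) < \<rho> (Suc k)" if "norm x < \<rho> k"
      using that norm_triangle_ineq[of x "t *\<^sub>R s (Suc k)"] by linarith
    then show ?thesis
      by (auto simp: indicator_def)
  qed
  \<comment> \<open>By translation invariance the three shifted integrals all equal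
    \<open>E (Suc k)\<close>, and their weights add up to 1. The inequality then telescopes: the
    gaps of all scales are paid for by the last energy.\<close>
  have step: "E k + (\<integral>\<^sup>+x. ennreal (G k x / 2 * indicator (ball 0 R) x) \<partial>lborel) \<le> E (Suc k)" for k
  proof -
    let ?h = "\<lambda>x. \<phi> (Suc k) x * indicator (ball 0 (\<rho> (Suc k))) x"
    let ?s = "s (Suc k)"
    have refine: "a e k x = (a e (Suc k) x + 2 * a e (Suc k) (x + ?s) + a e (Suc k) (x + 2 *\<^sub>R ?s)) / 4" for x
      unfolding a_def s_def by (rule second_diff_refine)
    have pt: "\<phi> k x * indicator (ball 0 (\<rho> k)) x + G k x / 2 * indicator (ball 0 R) x
        \<le> ?h x / 4 + ?h (x + ?s) / 2 + ?h (x + 2 *\<^sub>R ?s) / 4" (is "?l \<le> ?r") for x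
    proof -
      have "?l \<le> (\<phi> k x + G k x / 2) * indicator (ball 0 (\<rho> k)) x"
        using \<rho>_mono[of k] G_nn[of k x] by (auto simp: indicator_def)
      also have "\<phi> k x + G k x / 2
          \<le> (\<phi> (Suc k) x + 2 * \<phi> (Suc k) (x + ?s) + \<phi> (Suc k) (x + 2 *\<^sub>R ?s)) / 4"
        using jensen_gap_weighted[OF a_nn[of "Suc k" x] a_nn[of "Suc k" "x + ?s"] a_nn[of "Suc k" "x + 2 *\<^sub>R ?s"]]
        unfolding \<phi>_def G_def refine .
      also have "(\<phi> (Suc k) x + 2 * \<phi> (Suc k) (x + ?s) + \<phi> (Suc k) (x + 2 *\<^sub>R ?s)) / 4
            * indicator (ball 0 (\<rho> k)) x
          = \<phi> (Suc k) x * indicator (ball 0 (\<rho> k)) x / 4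
            + \<phi> (Suc k) (x + ?s) * indicator (ball 0 (\<rho> k)) x / 2
            + \<phi> (Suc k) (x + 2 *\<^sub>R ?s) * indicator (ball 0 (\<rho> k)) x / 4"
        by (simp add: field_simps)
      also have "\<dots> \<le> ?r"
        using ind[of 0 k x] ind[of 1 k x] ind[of 2 k x] \<phi>_nn
        by (intro add_mono divide_right_mono mult_left_mono) auto
      finally show ?thesis
        by (simp add: mult_right_mono)
    qed
    have "E k + (\<integral>\<^sup>+x. ennreal (G k x / 2 * indicator (ball 0 R) x) \<partial>lborel)
        = (\<integral>\<^sup>+x. ennreal (\<phi> k x * indicator (ball 0 (\<rho> k)) x + G k x / 2 * indicator (ball 0 R) x) \<partial>lborel)"
      unfolding E_def using \<phi>_nn G_nn
      by (subst nn_integral_add[symmetric]) (auto simp: ennreal_plus)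
    also have "\<dots> \<le> (\<integral>\<^sup>+x. ennreal (?h x / 4 + ?h (x + ?s) / 2 + ?h (x + 2 *\<^sub>R ?s) / 4) \<partial>lborel)"
      by (intro nn_integral_mono ennreal_leI pt)
    also have "\<dots> = (\<integral>\<^sup>+x. ennreal (1/4) * ennreal (?h x) \<partial>lborel)
          + (\<integral>\<^sup>+x. ennreal (1/2) * ennreal (?h (x + ?s)) \<partial>lborel)
          + (\<integral>\<^sup>+x. ennreal (1/4) * ennreal (?h (x + 2 *\<^sub>R ?s)) \<partial>lborel)"
    proof -
      have "ennreal (A / 4 + B / 2 + C / 4) = ennreal (1/4) * ennreal A + ennreal (1/2) * ennreal B
          + ennreal (1/4) * ennreal C" if "0 \<le> A" "0 \<le> B" "0 \<le> C" for A B C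
        using that ennreal_mult[of "1/4" A] ennreal_mult[of "1/2" B] ennreal_mult[of "1/4" C]
        by (simp add: ennreal_plus)
      then have "ennreal (?h x / 4 + ?h (x + ?s) / 2 + ?h (x + 2 *\<^sub>R ?s) / 4)
          = ennreal (1/4) * ennreal (?h x) + ennreal (1/2) * ennreal (?h (x + ?s))
          + ennreal (1/4) * ennreal (?h (x + 2 *\<^sub>R ?s))" for x
        using \<phi>_nn by simp
      then show ?thesis
        by (simp only:) (subst nn_integral_add, measurable)+
    qed
    also have "\<dots> = ennreal (1/4) * E (Suc k) + ennreal (1/2) * E (Suc k) + ennreal (1/4) * E (Suc k)"
      unfolding E_def
      using nn_integral_lborel_translate[of "\<lambda>x. ennreal (?h x)" ?s]
        nn_integral_lborel_translate[of "\<lambda>x. ennreal (?h x)" "2 *\<^sub>R ?s"]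
      by (simp add: nn_integral_cmult)
    also have "\<dots> = E (Suc k)"
    proof -
      have "ennreal (1/4) + ennreal (1/2) + ennreal (1/4) = 1"
        by (subst ennreal_plus[symmetric], simp, simp)+ simp
      then show ?thesis
        by (simp only: distrib_right[symmetric] mult_1_left)
    qed
    finally show ?thesis .
  qed
  have E_le: "E n \<le> emeasure lborel (ball (0::'a) (R + 2 * norm e))" for n
  proof -
    have "\<rho> n \<le> R + 2 * norm e"
      by (simp add: \<rho>_def mult_left_le)
    then have "ennreal (\<phi> n x * indicator (ball 0 (\<rho> n)) x) \<le> indicator (ball 0 (R + 2 * norm e)) x" for x
      using \<phi>_le[of n x] by (auto simp: indicator_def)
    then have "E n \<le> (\<integral>\<^sup>+x. indicator (ball 0 (R + 2 * norm e)) x \<partial>(lborel::'a measure))"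
      unfolding E_def by (intro nn_integral_mono) auto
    then show ?thesis
      by simp
  qed
  have "(\<Sum>k<n. \<integral>\<^sup>+x. ennreal (G k x / 2 * indicator (ball 0 R) x) \<partial>lborel) \<le> E n" for n
  proof (induction n)
    case (Suc n)
    then show ?case
      using step[of n] by (auto intro: order_trans add_right_mono)
  qed simp
  then have "(\<Sum>k<n. \<integral>\<^sup>+x. ennreal (G k x / 2 * indicator (ball 0 R) x) \<partial>lborel)
      \<le> emeasure lborel (ball (0::'a) (R + 2 * norm e))" for n
    using E_le order_trans by blast
  moreover have "(\<Sum>k<n. \<integral>\<^sup>+x. ennreal (G k x * indicator (ball 0 R) x) \<partial>lborel)
      = 2 * (\<Sum>k<n. \<integral>\<^sup>+x. ennreal (G k x / 2 * indicator (ball 0 R) x) \<partial>lborel)" for n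
  proof -
    have "ennreal (G k x * indicator (ball 0 R) x) = 2 * ennreal (G k x / 2 * indicator (ball 0 R) x)" for k x
      using G_nn[of k x] by (subst ennreal_numeral[symmetric], subst ennreal_mult[symmetric]) auto
    then show ?thesis
      by (simp add: nn_integral_cmult sum_distrib_left)
  qed
  ultimately have "(\<Sum>k<n. \<integral>\<^sup>+x. ennreal (G k x * indicator (ball 0 R) x) \<partial>lborel)
      \<le> 2 * emeasure lborel (ball (0::'a) (R + 2 * norm e))" for n
    by (simp add: mult_left_mono)
  moreover have "2 * emeasure lborel (ball (0::'a) (R + 2 * norm e)) < \<infinity>"
    using emeasure_lborel_ball_finite[of "0::'a" "R + 2 * norm e"]
    by (simp add: ennreal_mult_less_top)
  ultimately show ?thesis
    unfolding G_def s_def by blast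
qed

text \<open>\<open>b\<close> is a base point in blow-up coordinates, so the centre moves by
  \<open>b\<close> divided by the scale. Such a shift has length at most \<open>norm b\<close>;
  enlarging the ball by \<open>norm b\<close> therefore gives a bound on the translated integrals
  that serves all scales.\<close>

lemma AE_jensen_gap_tendsto_0:
  fixes c :: "'a::euclidean_space \<Rightarrow> real"
  assumes cont: "continuous_on UNIV c" and conv: "\<And>x e. 0 \<le> second_diff c x e"
  shows "AE x in lborel. (\<lambda>k. jensen_gap
      (4 ^ Suc k * second_diff c (x + b /\<^sub>R 2 ^ Suc k) (e /\<^sub>R 2 ^ Suc k))
      (4 ^ Suc k * second_diff c (x + b /\<^sub>R 2 ^ Suc k + e /\<^sub>R 2 ^ Suc k) (e /\<^sub>R 2 ^ Suc k))) \<longlonglongrightarrow> 0"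
proof -
  define G where "G k x = jensen_gap (4 ^ Suc k * second_diff c x (e /\<^sub>R 2 ^ Suc k))
      (4 ^ Suc k * second_diff c (x + e /\<^sub>R 2 ^ Suc k) (e /\<^sub>R 2 ^ Suc k))" for k x
  define t where "t k = b /\<^sub>R 2 ^ Suc k" for k :: nat
  have "continuous_on UNIV (\<lambda>x. second_diff c x v)" for v
    unfolding second_diff_def by (intro continuous_intros continuous_on_compose2[OF cont]) auto
  then have [measurable]: "(\<lambda>x. second_diff c x v) \<in> borel_measurable borel" for v
    by (intro borel_measurable_continuous_onI)
  have [measurable]: "G k \<in> borel_measurable borel" for k
    unfolding G_def jensen_gap_def by measurable
  have [measurable]: "ball (0::'a) r \<in> sets borel" for r
    by simp
  have G_nn: "0 \<le> G k x" for k x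
    by (simp add: G_def jensen_gap_nonneg conv)
  have "AE x in lborel. (\<lambda>k. G k (x + t k) * indicator (ball 0 (real N)) x) \<longlonglongrightarrow> 0" for N
  proof -
    obtain B where B: "B < \<infinity>"
      "\<And>n. (\<Sum>k<n. \<integral>\<^sup>+x. G k x * indicator (ball 0 (N + norm b)) x \<partial>lborel) \<le> B"
      using dyadic_energy_bound[OF cont conv, of e "N + norm b"] unfolding G_def by blast
    have "(\<integral>\<^sup>+x. G k (x + t k) * indicator (ball 0 (real N)) x \<partial>lborel)
        \<le> (\<integral>\<^sup>+x. G k x * indicator (ball 0 (N + norm b)) x \<partial>lborel)" for k
    proof -
      have "norm (t k) \<le> norm b"
        by (simp add: t_def divide_simps) (metis mult_left_mono mult.right_neutral norm_ge_zero
            one_le_power one_le_numeral power_Suc)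
      then have "indicator (ball 0 (real N)) x \<le> (indicator (ball 0 (N + norm b)) (x + t k) :: real)" for x
        using norm_triangle_ineq[of x "t k"] by (auto simp: indicator_def)
      then have "(\<integral>\<^sup>+x. G k (x + t k) * indicator (ball 0 (real N)) x \<partial>lborel)
          \<le> (\<integral>\<^sup>+x. ennreal (G k (x + t k) * indicator (ball 0 (N + norm b)) (x + t k)) \<partial>lborel)"
        using G_nn by (intro nn_integral_mono ennreal_leI mult_left_mono) auto
      also have "\<dots> = (\<integral>\<^sup>+x. ennreal (G k x * indicator (ball 0 (N + norm b)) x) \<partial>lborel)"
        by (rule nn_integral_lborel_translate[of "\<lambda>x. ennreal (G k x * indicator (ball 0 (N + norm b)) x)"])
           measurable
      finally show ?thesis .
    qed
    then have sum_le: "(\<Sum>k<n. \<integral>\<^sup>+x. G k (x + t k) * indicator (ball 0 (real N)) x \<partial>lborel) \<le> B" for n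
      by (rule order_trans[OF sum_mono B(2)])
    show ?thesis
    proof (rule AE_tendsto_0_of_summable_integrals[rotated 2])
      show "(\<lambda>x. G k (x + t k) * indicator (ball 0 (real N)) x) \<in> borel_measurable lborel" for k
        by measurable
    qed (use G_nn B(1) sum_le in auto)
  qed
  then have "AE x in lborel. \<forall>N. (\<lambda>k. G k (x + t k) * indicator (ball 0 (real N)) x) \<longlonglongrightarrow> 0"
    by (simp add: AE_all_countable)
  then have "AE x in lborel. (\<lambda>k. G k (x + t k)) \<longlonglongrightarrow> 0"
  proof eventually_elim
    case (elim x)
    obtain N :: nat where "norm x < N"
      using reals_Archimedean2 by blast
    then show ?case
      using elim[THEN spec, of N] by simp
  qed
  then show ?thesis
    unfolding G_def t_def .
qed

section \<open>Blow-up limits of convex functions\<close>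

text \<open>Arzela-Ascoli on the balls of integer radius, followed by a diagonal choice. The
  normalisation at 0 and the Lipschitz bound together supply the uniform bounds.\<close>

lemma locally_equi_lipschitz_convergent_subsequence:
  fixes F :: "nat \<Rightarrow> 'a::euclidean_space \<Rightarrow> real"
  assumes lip: "\<And>\<rho>. 0 < \<rho> \<Longrightarrow> \<exists>L. \<forall>n. \<forall>x\<in>cball 0 \<rho>. \<forall>y\<in>cball 0 \<rho>. \<bar>F n x - F n y\<bar> \<le> L * norm (x - y)"
    and F0: "\<And>n. F n 0 = 0"
  obtains r g where "strict_mono (r :: nat \<Rightarrow> nat)"
    "\<And>\<rho>. uniform_limit (cball 0 \<rho>) (\<lambda>n. F (r n)) g sequentially"
proof -
  have ex: "\<exists>k. strict_mono (k :: nat \<Rightarrow> nat) \<and> uniformly_convergent_on (cball 0 (real i)) (r \<circ> k)"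
    if "range r \<subseteq> range F" for i and r :: "nat \<Rightarrow> 'a \<Rightarrow> real"
  proof -
    obtain L where L: "\<forall>n. \<forall>x\<in>cball 0 (real i + 1). \<forall>y\<in>cball 0 (real i + 1). \<bar>F n x - F n y\<bar> \<le> L * norm (x - y)"
      using lip[of "real i + 1"] by force
    have Lr: "\<bar>r n x - r n y\<bar> \<le> L * norm (x - y)" if "x \<in> cball 0 (real i)" "y \<in> cball 0 (real i)" for n x y
    proof -
      obtain m where "r n = F m"
        using \<open>range r \<subseteq> range F\<close> by blast
      then show ?thesis
        using L that by simp
    qed
    have r0: "r n 0 = 0" for n
      using \<open>range r \<subseteq> range F\<close> F0 by (metis imageE rangeI subset_iff)
    obtain g k where "strict_mono (k :: nat \<Rightarrow> nat)"
      and k: "\<And>e. 0 < e \<Longrightarrow> \<exists>N. \<forall>n x. n \<ge> N \<and> x \<in> cball 0 (real i) \<longrightarrow> norm (r (k n) x - g x) < e"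
    proof (rule Arzela_Ascoli[of "cball 0 (real i)" r "\<bar>L\<bar> * real i"])
      show "norm (r n x) \<le> \<bar>L\<bar> * real i" if "x \<in> cball 0 (real i)" for n x
      proof -
        have "\<bar>r n x\<bar> \<le> L * norm x"
          using Lr[of x 0 n] that r0 by simp
        also have "\<dots> \<le> \<bar>L\<bar> * real i"
          using that by (intro mult_mono) auto
        finally show ?thesis
          by simp
      qed
      show "\<exists>d>0. \<forall>n y. y \<in> cball 0 (real i) \<and> norm (x - y) < d \<longrightarrow> norm (r n x - r n y) < e"
        if "x \<in> cball 0 (real i)" "0 < e" for x e
      proof (intro exI conjI allI impI)
        show "0 < e / (\<bar>L\<bar> + 1)"
          using that by simp
        fix n y
        assume y: "y \<in> cball 0 (real i) \<and> norm (x - y) < e / (\<bar>L\<bar> + 1)"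
        then have "\<bar>r n x - r n y\<bar> \<le> L * norm (x - y)"
          using Lr that by blast
        also have "\<dots> \<le> (\<bar>L\<bar> + 1) * norm (x - y)"
          by (intro mult_right_mono) auto
        also have "\<dots> < e"
          using y by (simp add: field_simps)
        finally show "norm (r n x - r n y) < e"
          by simp
      qed
    qed auto
    then have "uniform_limit (cball 0 (real i)) (r \<circ> k) g sequentially"
      unfolding uniform_limit_sequentially_iff dist_norm comp_def by blast
    with \<open>strict_mono k\<close> show ?thesis
      by (auto simp: uniformly_convergent_on_def)
  qed
  obtain k :: "nat \<Rightarrow> nat" where k: "strict_mono k"
    "\<And>i. uniformly_convergent_on (cball 0 (real i)) (F \<circ> (id \<circ> k))"
  proof (rule subsequence_diagonalization_lemma
      [where r = id and P = "\<lambda>i r. uniformly_convergent_on (cball 0 (real i)) (F \<circ> r)"])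
    show "\<exists>k. strict_mono (k :: nat \<Rightarrow> nat) \<and> uniformly_convergent_on (cball 0 (real i)) (F \<circ> (r \<circ> k))"
      for i and r :: "nat \<Rightarrow> nat"
      using ex[of "F \<circ> r" i] by (auto simp: comp_assoc)
    show "uniformly_convergent_on (cball 0 (real i)) (F \<circ> (r \<circ> k2))"
      if conv: "uniformly_convergent_on (cball 0 (real i)) (F \<circ> (r \<circ> k1))"
        and "\<And>j. N \<le> j \<Longrightarrow> \<exists>j'\<ge>j. k2 j = k1 j'" for i N k1 k2 and r :: "nat \<Rightarrow> nat"
    proof -
      obtain g where g: "uniform_limit (cball 0 (real i)) (F \<circ> (r \<circ> k1)) g sequentially"
        using conv unfolding uniformly_convergent_on_def by blast
      have "uniform_limit (cball 0 (real i)) (F \<circ> (r \<circ> k2)) g sequentially"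
        unfolding uniform_limit_sequentially_iff
      proof (intro allI impI)
        fix e :: real assume "0 < e"
        then obtain M where M: "\<And>n x. n \<ge> M \<Longrightarrow> x \<in> cball 0 (real i) \<Longrightarrow> dist ((F \<circ> (r \<circ> k1)) n x) (g x) < e"
          using g unfolding uniform_limit_sequentially_iff by blast
        have "dist ((F \<circ> (r \<circ> k2)) n x) (g x) < e" if n: "n \<ge> max M N" "x \<in> cball 0 (real i)" for n x
        proof -
          obtain j' where "j' \<ge> n" "k2 n = k1 j'"
            using \<open>\<And>j. N \<le> j \<Longrightarrow> \<exists>j'\<ge>j. k2 j = k1 j'\<close>[of n] n by auto
          then show ?thesis
            using M[of j' x] n by auto
        qed
        then show "\<exists>M. \<forall>n\<ge>M. \<forall>x\<in>cball 0 (real i). dist ((F \<circ> (r \<circ> k2)) n x) (g x) < e"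
          by blast
      qed
      then show ?thesis
        by (auto simp: uniformly_convergent_on_def)
    qed
  qed (use that in blast)
  \<comment> \<open>Pointwise limits do not depend on the ball, so the uniform limits on the
    different balls are one function.\<close>
  define g where "g x = lim (\<lambda>n. F (k n) x)" for x
  have "uniform_limit (cball 0 (real i)) (\<lambda>n. F (k n)) g sequentially" for i
    using k(2)[of i] unfolding uniformly_convergent_uniform_limit_iff g_def by (simp add: comp_def)
  then have "uniform_limit (cball 0 \<rho>) (\<lambda>n. F (k n)) g sequentially" for \<rho>
  proof -
    obtain i :: nat where "\<rho> \<le> i"
      using real_arch_simple by blast
    then show ?thesis
      using \<open>\<And>i. uniform_limit (cball 0 (real i)) (\<lambda>n. F (k n)) g sequentially\<close>
      by (meson subset_cball uniform_limit_on_subset)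
  qed
  then show ?thesis
    using that k(1) by blast
qed

text \<open>On the ray from \<open>x\<close> through \<open>y\<close> take \<open>z\<close> at
  distance \<open>\<rho>\<close> from \<open>x\<close>. It lies in the ball of radius
  \<open>2 * \<rho>\<close>, so \<open>f z\<close> is at most \<open>4 * K * \<rho>\<^sup>2\<close>;
  convexity spreads the increase from \<open>f x \<ge> 0\<close> over the length
  \<open>\<rho>\<close>.\<close>

lemma convex_quadratic_bound_imp_lipschitz:
  fixes f :: "'a::real_normed_vector \<Rightarrow> real"
  assumes conv: "convex_on UNIV f" and nn: "\<And>h. 0 \<le> f h" and upper: "\<And>h. f h \<le> K * (norm h)\<^sup>2"
    and "0 < \<rho>" "norm x \<le> \<rho>" "norm y \<le> \<rho>"
  shows "\<bar>f x - f y\<bar> \<le> 4 * K * \<rho> * norm (x - y)"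
proof -
  have "f y - f x \<le> 4 * K * \<rho> * norm (x - y)" if "norm x \<le> \<rho>" "norm y \<le> \<rho>" for x y
  proof (cases "x = y")
    case False
    define t where "t = norm (y - x)"
    define z where "z = x + (\<rho> / t) *\<^sub>R (y - x)"
    have "0 < t"
      using False by (simp add: t_def)
    have "0 \<le> K * \<rho>\<^sup>2"
      using order_trans[OF nn upper, of "(\<rho> / t) *\<^sub>R (y - x)"] \<open>0 < t\<close> \<open>0 < \<rho>\<close>
      by (simp add: t_def[symmetric])
    then have "0 \<le> K"
      using \<open>0 < \<rho>\<close> by (simp add: zero_le_mult_iff)
    have "norm z \<le> 2 * \<rho>"
      using norm_triangle_ineq[of x "(\<rho> / t) *\<^sub>R (y - x)"] that \<open>0 < t\<close> \<open>0 < \<rho>\<close>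
      by (simp add: z_def t_def[symmetric])
    then have fz: "f z \<le> K * (2 * \<rho>)\<^sup>2"
      using \<open>0 \<le> K\<close> by (intro order_trans[OF upper] mult_left_mono power_mono) auto
    have "f y - f x \<le> t / \<rho> * (K * (2 * \<rho>)\<^sup>2)"
    proof (cases "t \<le> \<rho>")
      case True
      have "y = (1 - t / \<rho>) *\<^sub>R x + (t / \<rho>) *\<^sub>R z"
        using \<open>0 < t\<close> \<open>0 < \<rho>\<close> by (simp add: z_def algebra_simps)
      then have "f y \<le> (1 - t / \<rho>) * f x + t / \<rho> * f z"
        using convex_onD[OF conv, of "t / \<rho>" x z] True \<open>0 < t\<close> \<open>0 < \<rho>\<close> by simp
      also have "\<dots> \<le> f x + t / \<rho> * (K * (2 * \<rho>)\<^sup>2)"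
        using nn[of x] fz \<open>0 < t\<close> \<open>0 < \<rho>\<close>
        by (intro add_mono mult_left_mono) (auto simp: mult_le_cancel_right1 mult_left_le_one_le algebra_simps)
      finally show ?thesis
        by simp
    next
      case False
      have "f y \<le> 1 * (K * (2 * \<rho>)\<^sup>2)"
        using that \<open>0 < \<rho>\<close> \<open>0 \<le> K\<close> unfolding mult_1_left
        by (intro order_trans[OF upper] mult_left_mono power_mono) auto
      also have "\<dots> \<le> t / \<rho> * (K * (2 * \<rho>)\<^sup>2)"
        using False \<open>0 < \<rho>\<close> \<open>0 \<le> K\<close> by (intro mult_right_mono) (auto simp: field_simps)
      finally show ?thesis
        using nn[of x] by simp
    qed
    also have "\<dots> = 4 * K * \<rho> * norm (x - y)"
      using \<open>0 < \<rho>\<close> by (simp add: t_def norm_minus_commute power2_eq_square field_simps)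
    finally show ?thesis .
  qed auto
  from this[of x y] this[of y x] show ?thesis
    using assms by (simp add: norm_minus_commute abs_le_iff)
qed

text \<open>The second difference in direction \<open>v\<close> centred at \<open>u\<close> is constant along \<open>v\<close>, hence
  homogeneous of degree two in \<open>v\<close>; dilating \<open>v\<close> makes its dependence on \<open>u\<close> negligible.\<close>

lemma third_difference_0_imp_parallelogram:
  fixes g :: "'a::real_normed_vector \<Rightarrow> real"
  assumes nn: "\<And>h. 0 \<le> g h" and upper: "\<And>h. g h \<le> K * (norm h)\<^sup>2"
    and lip: "\<And>\<rho> x y. 0 < \<rho> \<Longrightarrow> norm x \<le> \<rho> \<Longrightarrow> norm y \<le> \<rho> \<Longrightarrow> \<bar>g x - g y\<bar> \<le> L * \<rho> * norm (x - y)"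
    and third: "\<And>b e. second_diff g b e = second_diff g (b + e) e"
  shows "g (u + v) + g (u - v) = 2 * g u + 2 * g v"
proof -
  define \<psi> where "\<psi> u v = g (u + v) + g (u - v) - 2 * g u" for u v
  have g0: "g 0 = 0"
    using nn[of 0] upper[of 0] by simp
  have \<psi>_shift: "\<psi> (u + v) v = \<psi> u v" for u v
    using third[of "u - v" v] by (simp add: second_diff_def \<psi>_def scaleR_2 algebra_simps)
  \<comment> \<open>\<open>\<psi> u (2 *\<^sub>R v)\<close> is the sum of
    \<open>\<psi> (u + v) v\<close>, \<open>2 * \<psi> u v\<close> and
    \<open>\<psi> (u - v) v\<close>, and by \<open>\<psi>_shift\<close> all these values
    agree.\<close>
  have \<psi>_double: "\<psi> u (2 *\<^sub>R v) = 4 * \<psi> u v" for u v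
    using \<psi>_shift[of u v] \<psi>_shift[of "u - v" v] by (simp add: \<psi>_def scaleR_2 algebra_simps)
  have \<psi>_pow: "\<psi> u (2 ^ m *\<^sub>R v) = 4 ^ m * \<psi> u v" for m u v
  proof (induction m)
    case (Suc m)
    then show ?case
      using \<psi>_double[of u "2 ^ m *\<^sub>R v"] by simp
  qed simp
  have \<psi>_indep: "\<psi> u v = \<psi> 0 v" for u v
  proof -
    define C where "C = 2 * \<bar>L\<bar> * (norm u + norm v + 1) * norm u + 2 * g u"
    have "\<bar>\<psi> u v - \<psi> 0 v\<bar> \<le> C * (1/2) ^ m" for m
    proof -
      define w where "w = 2 ^ m *\<^sub>R v"
      define \<rho> where "\<rho> = norm u + norm w + 1"
      have "0 < \<rho>"
        by (simp add: \<rho>_def add_nonneg_pos)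
      have w: "norm w = 2 ^ m * norm v" "(1::real) \<le> 2 ^ m"
        by (simp_all add: w_def)
      have "\<rho> \<le> 2 ^ m * (norm u + norm v + 1)"
        using mult_right_mono[OF w(2), of "norm u + 1"] by (simp add: \<rho>_def w(1) algebra_simps)
      have "\<bar>g (u + w) - g w\<bar> \<le> L * \<rho> * norm u" "\<bar>g (u - w) - g (- w)\<bar> \<le> L * \<rho> * norm u"
        using lip[of \<rho> "u + w" w] lip[of \<rho> "u - w" "- w"] \<open>0 < \<rho>\<close> norm_triangle_ineq[of u w] norm_triangle_ineq4[of u w]
        by (simp_all add: \<rho>_def)
      then have "\<bar>\<psi> u w - \<psi> 0 w\<bar> \<le> 2 * (L * \<rho> * norm u) + 2 * g u"
        using nn[of u] by (simp add: \<psi>_def g0)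
      also have "\<dots> \<le> 2 * (\<bar>L\<bar> * (2 ^ m * (norm u + norm v + 1)) * norm u) + 2 ^ m * (2 * g u)"
      proof (rule add_mono)
        show "2 * (L * \<rho> * norm u) \<le> 2 * (\<bar>L\<bar> * (2 ^ m * (norm u + norm v + 1)) * norm u)"
          using \<open>\<rho> \<le> _\<close> \<open>0 < \<rho>\<close> by (intro mult_left_mono mult_right_mono mult_mono) auto
        show "2 * g u \<le> 2 ^ m * (2 * g u)"
          using nn[of u] mult_right_mono[OF w(2), of "2 * g u"] by simp
      qed
      also have "\<dots> = 2 ^ m * C"
        by (simp add: C_def algebra_simps)
      also have "\<psi> u w - \<psi> 0 w = 4 ^ m * (\<psi> u v - \<psi> 0 v)"
        by (simp add: w_def \<psi>_pow algebra_simps)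
      finally have "2 ^ m * (2 ^ m * \<bar>\<psi> u v - \<psi> 0 v\<bar>) \<le> 2 ^ m * C"
        by (simp add: abs_mult power_mult_distrib[symmetric] flip: mult.assoc)
      then show ?thesis
        by (simp add: power_one_over field_simps)
    qed
    moreover have "(\<lambda>m. C * (1/2) ^ m) \<longlonglongrightarrow> C * 0"
      by (intro tendsto_intros LIMSEQ_power_zero) auto
    ultimately have "\<bar>\<psi> u v - \<psi> 0 v\<bar> \<le> C * 0"
      by (intro LIMSEQ_le_const) auto
    then show ?thesis
      by simp
  qed
  \<comment> \<open>The odd part \<open>\<tau>\<close> doubles with its argument but has a quadratic
    bound; halving the argument repeatedly forces it to vanish.\<close>
  have even: "g (- v) = g v" for v
  proof -
    define \<tau> where "\<tau> v = g v - g (- v)" for v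
    have "g (2 *\<^sub>R v) = 3 * g v + g (- v)" for v
      using \<psi>_indep[of v v] by (simp add: \<psi>_def g0 scaleR_2)
    from this[of "- _"] this have \<tau>_double: "\<tau> (2 *\<^sub>R v) = 2 * \<tau> v" for v
      by (simp add: \<tau>_def)
    have \<tau>_half: "\<tau> v = 2 ^ m * \<tau> ((1/2) ^ m *\<^sub>R v)" for m
    proof (induction m)
      case (Suc m)
      then show ?case
        using \<tau>_double[of "(1/2) ^ Suc m *\<^sub>R v"] by simp
    qed simp
    have "\<bar>\<tau> v\<bar> \<le> K * (norm v)\<^sup>2 * (1/2) ^ m" for m
    proof -
      let ?w = "(1/2) ^ m *\<^sub>R v"
      have "\<bar>\<tau> ?w\<bar> \<le> K * (norm ?w)\<^sup>2"
        using nn[of ?w] nn[of "- ?w"] upper[of ?w] upper[of "- ?w"] by (simp add: \<tau>_def)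
      then have "2 ^ m * \<bar>\<tau> ?w\<bar> \<le> 2 ^ m * (K * (norm ?w)\<^sup>2)"
        by simp
      also have "\<dots> = K * (norm v)\<^sup>2 * (1/2) ^ m"
        by (simp add: power_mult_distrib power_one_over power2_eq_square field_simps)
      finally show ?thesis
        unfolding \<tau>_half[of m] by (simp add: abs_mult)
    qed
    moreover have "(\<lambda>m. K * (norm v)\<^sup>2 * (1/2) ^ m) \<longlonglongrightarrow> K * (norm v)\<^sup>2 * 0"
      by (intro tendsto_intros LIMSEQ_power_zero) auto
    ultimately have "\<bar>\<tau> v\<bar> \<le> K * (norm v)\<^sup>2 * 0"
      by (intro LIMSEQ_le_const) auto
    then show ?thesis
      by (simp add: \<tau>_def)
  qed
  show ?thesis
    using \<psi>_indep[of u v] by (simp add: \<psi>_def g0 even)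
qed

text \<open>Cauchy's functional equation. Subtracting the linear function leaves an additive
  \<open>D\<close> that vanishes at the integers and is therefore bounded on the whole line;
  \<open>D (n * t) = n * D t\<close> then leaves only 0.\<close>

lemma additive_locally_bounded_imp_linear:
  fixes \<xi> :: "real \<Rightarrow> real"
  assumes add: "\<And>s t. \<xi> (s + t) = \<xi> s + \<xi> t" and bound: "\<And>t. 0 \<le> t \<Longrightarrow> t \<le> 1 \<Longrightarrow> \<bar>\<xi> t\<bar> \<le> C"
  shows "\<xi> t = t * \<xi> 1"
proof -
  define D where "D t = \<xi> t - t * \<xi> 1" for t
  have D_add: "D (s + t) = D s + D t" for s t
    by (simp add: D_def add algebra_simps)
  have D1: "D 1 = 0" and D0: "D 0 = 0"
    using add[of 0 0] by (simp_all add: D_def)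
  have D_neg: "D (- t) = - D t" for t
    using D_add[of t "- t"] D0 by simp
  have D_nat: "D (real n * t) = real n * D t" for n t
    by (induction n) (simp_all add: D0 D_add algebra_simps)
  have D_int: "D (of_int i) = 0" for i
  proof (cases i)
    case (nonneg n)
    then show ?thesis
      using D_nat[of n 1] D1 by simp
  next
    case (neg n)
    then show ?thesis
      using D_nat[of "Suc n" 1] D1 D_neg[of "real (Suc n)"] by simp
  qed
  have D_bound: "\<bar>D t\<bar> \<le> C + \<bar>\<xi> 1\<bar>" for t
  proof -
    have "D t = D (of_int \<lfloor>t\<rfloor>) + D (frac t)"
      using D_add[of "of_int \<lfloor>t\<rfloor>" "frac t"] by (simp add: frac_def)
    then have "D t = \<xi> (frac t) - frac t * \<xi> 1"
      by (simp add: D_int) (simp add: D_def)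
    also have "\<bar>\<dots>\<bar> \<le> \<bar>\<xi> (frac t)\<bar> + frac t * \<bar>\<xi> 1\<bar>"
      using frac_ge_0[of t] by (metis abs_mult abs_of_nonneg abs_triangle_ineq4)
    also have "\<dots> \<le> C + 1 * \<bar>\<xi> 1\<bar>"
      using frac_ge_0[of t] frac_lt_1[of t] bound[of "frac t"]
      by (intro add_mono mult_right_mono) (auto intro: less_imp_le)
    finally show ?thesis
      by simp
  qed
  have "\<bar>D t\<bar> \<le> (C + \<bar>\<xi> 1\<bar>) / real (Suc n)" for n
    using D_bound[of "real (Suc n) * t"] unfolding D_nat
    by (simp add: abs_mult pos_le_divide_eq mult.commute del: of_nat_Suc)
  moreover have "(\<lambda>n. (C + \<bar>\<xi> 1\<bar>) / real (Suc n)) \<longlonglongrightarrow> 0"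
    using LIMSEQ_Suc[OF lim_const_over_n] by blast
  ultimately have "\<bar>D t\<bar> \<le> 0"
    by (intro LIMSEQ_le_const) auto
  then show ?thesis
    by (simp add: D_def)
qed

text \<open>The argument of Jordan and von Neumann: the parallelogram law makes the polarisation
  \<open>B\<close> additive, and the two bounds on \<open>g\<close> make it homogeneous.\<close>

lemma parallelogram_imp_quadratic_form:
  fixes g :: "real^'n \<Rightarrow> real"
  assumes nn: "\<And>h. 0 \<le> g h" and upper: "\<And>h. g h \<le> K * (norm h)\<^sup>2"
    and par: "\<And>u v. g (u + v) + g (u - v) = 2 * g u + 2 * g v"
  shows "\<exists>A. transpose A = A \<and> (\<forall>h. g h = h \<bullet> (A *v h) / 2)"
proof -
  define B where "B u v = g (u + v) - g (u - v)" for u v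
  have g0: "g 0 = 0"
    using nn[of 0] upper[of 0] by simp
  have even: "g (- v) = g v" for v
    using par[of 0 v] by (simp add: g0)
  have B_sym: "B u v = B v u" for u v
    using even[of "u - v"] by (simp add: B_def add.commute)
  have B0: "B 0 v = 0" for v
    by (simp add: B_def even)
  have B_mid: "B (u + u') v + B (u - u') v = 2 * B u v" for u u' v
    using par[of "u + v" u'] par[of "u - v" u'] by (simp add: B_def algebra_simps)
  have B_add: "B (a + b) v = B a v + B b v" for a b v
  proof -
    have "B ((1/2) *\<^sub>R (a + b) + (1/2) *\<^sub>R (a - b)) v + B ((1/2) *\<^sub>R (a + b) - (1/2) *\<^sub>R (a - b)) v
        = 2 * B ((1/2) *\<^sub>R (a + b)) v"
      by (rule B_mid)
    moreover have "(1/2) *\<^sub>R (a + b) + (1/2) *\<^sub>R (a - b) = a" "(1/2) *\<^sub>R (a + b) - (1/2) *\<^sub>R (a - b) = b"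
      by (simp_all add: vec_eq_iff field_simps)
    moreover have "B (a + b) v = 2 * B ((1/2) *\<^sub>R (a + b)) v"
      using B_mid[of "(1/2) *\<^sub>R (a + b)" "(1/2) *\<^sub>R (a + b)" v] by (simp add: B0 flip: scaleR_add_left)
    ultimately show ?thesis
      by simp
  qed
  have B_scale: "B (t *\<^sub>R u) v = t * B u v" for t u v
  proof -
    have "\<bar>B (s *\<^sub>R u) v\<bar> \<le> \<bar>K\<bar> * (norm u + norm v)\<^sup>2" if "0 \<le> s" "s \<le> 1" for s
    proof -
      have "norm (s *\<^sub>R u) \<le> norm u"
        using that by (simp add: mult_left_le_one_le)
      then have "norm (s *\<^sub>R u + v) \<le> norm u + norm v" "norm (s *\<^sub>R u - v) \<le> norm u + norm v"
        using norm_triangle_ineq[of "s *\<^sub>R u" v] norm_triangle_ineq4[of "s *\<^sub>R u" v] by linarith+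
      then have "g (s *\<^sub>R u + v) \<le> \<bar>K\<bar> * (norm u + norm v)\<^sup>2" "g (s *\<^sub>R u - v) \<le> \<bar>K\<bar> * (norm u + norm v)\<^sup>2"
        by (auto intro!: order_trans[OF upper] mult_mono power_mono)
      then show ?thesis
        using nn[of "s *\<^sub>R u + v"] nn[of "s *\<^sub>R u - v"] by (simp add: B_def abs_le_iff)
    qed
    then show ?thesis
      using additive_locally_bounded_imp_linear[of "\<lambda>s. B (s *\<^sub>R u) v" "\<bar>K\<bar> * (norm u + norm v)\<^sup>2" t]
      by (simp add: scaleR_add_left B_add)
  qed
  have lin: "linear (\<lambda>u. B u v)" for v
    by (rule linearI) (simp_all add: B_add B_scale)
  \<comment> \<open>\<open>B h h\<close> equals \<open>4 * g h\<close>, so halving \<open>B\<close>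
    gives the matrix whose quadratic form is \<open>2 * g\<close>.\<close>
  define f where "f h = (\<chi> i. B (axis i 1) h / 2)" for h
  define A where "A = (\<chi> i j. B (axis i 1) (axis j 1) / 2)"
  have Av: "A *v h = f h" for h
  proof -
    have "(A *v h) $ i = f h $ i" for i
    proof -
      have "f h $ i = B h (axis i 1) / 2"
        by (simp add: f_def B_sym)
      also have "B h (axis i 1) = B (\<Sum>j\<in>UNIV. (h $ j) *\<^sub>R axis j 1) (axis i 1)"
        using basis_expansion[of h] by (simp add: scalar_mult_eq_scaleR)
      also have "\<dots> = (\<Sum>j\<in>UNIV. (h $ j) * B (axis j 1) (axis i 1))"
        by (subst linear_sum[OF lin]) (simp add: B_scale)
      finally show ?thesis
        by (simp add: A_def matrix_vector_mult_def B_sym[of _ "axis i 1"] sum_divide_distrib mult.commute)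
    qed
    then show ?thesis
      by (simp add: vec_eq_iff)
  qed
  have "transpose A = A"
    by (simp add: A_def transpose_def vec_eq_iff B_sym)
  moreover have "g h = h \<bullet> (A *v h) / 2" for h
  proof -
    have "B h h = B (\<Sum>i\<in>UNIV. (h $ i) *\<^sub>R axis i 1) h"
      using basis_expansion[of h] by (simp add: scalar_mult_eq_scaleR)
    also have "\<dots> = (\<Sum>i\<in>UNIV. (h $ i) * B (axis i 1) h)"
      by (subst linear_sum[OF lin]) (simp add: B_scale)
    also have "\<dots> = 2 * (h \<bullet> f h)"
      by (simp add: f_def inner_vec_def sum_distrib_left)
    finally have "B h h = 2 * (h \<bullet> f h)" .
    moreover have "B h h = 4 * g h"
      using par[of h h] by (simp add: B_def g0)
    ultimately show ?thesis
      by (simp add: Av)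
  qed
  ultimately show ?thesis
    by blast
qed


section \<open>Quadratic expansions at points where the Jensen gaps vanish\<close>

lemma continuous_on_of_lipschitz_on_balls:
  fixes g :: "'a::real_normed_vector \<Rightarrow> real"
  assumes lip: "\<And>\<rho> x y. 0 < \<rho> \<Longrightarrow> norm x \<le> \<rho> \<Longrightarrow> norm y \<le> \<rho> \<Longrightarrow> \<bar>g x - g y\<bar> \<le> L * \<rho> * norm (x - y)"
  shows "continuous_on UNIV g"
proof -
  have "isCont g x" for x
  proof -
    define \<rho> where "\<rho> = norm x + 1"
    have "norm y \<le> \<rho>" if "y \<in> ball x 1" for y
      using norm_triangle_sub[of y x] that by (simp add: \<rho>_def dist_norm norm_minus_commute)
    then have "\<forall>\<^sub>F y in at x. norm y \<le> \<rho>"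
      by (intro eventually_mono[OF eventually_at_ball[of 1 x UNIV]]) auto
    then have "\<forall>\<^sub>F y in at x. norm (g y - g x) \<le> L * \<rho> * norm (y - x)"
      by eventually_elim (use lip[of \<rho>] in \<open>auto simp: \<rho>_def add_nonneg_pos\<close>)
    moreover have "((\<lambda>y. L * \<rho> * norm (y - x)) \<longlongrightarrow> L * \<rho> * norm (x - x)) (at x)"
      by (intro tendsto_intros)
    then have "((\<lambda>y. L * \<rho> * norm (y - x)) \<longlongrightarrow> 0) (at x)"
      by simp
    ultimately have "((\<lambda>y. g y - g x) \<longlongrightarrow> 0) (at x)"
      by (rule Lim_null_comparison)
    then show ?thesis
      by (simp add: isCont_def LIM_zero_iff)
  qed
  then show ?thesis
    by (simp add: continuous_at_imp_continuous_on)
qed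

lemma second_diff_affine_scale:
  "second_diff (\<lambda>h. s * (c (x + h /\<^sub>R t) - a - p \<bullet> (h /\<^sub>R t))) b e = s * second_diff c (x + b /\<^sub>R t) (e /\<^sub>R t)"
  for c :: "'a::real_inner \<Rightarrow> real"
  by (simp add: second_diff_def algebra_simps inner_add_right)

lemma convex_on_affine_rescale:
  fixes c :: "'a::real_inner \<Rightarrow> real"
  assumes conv: "convex_on UNIV c" and "0 \<le> s"
  shows "convex_on UNIV (\<lambda>h. s * (c (x + h /\<^sub>R q) - a - p \<bullet> (h /\<^sub>R q)))"
proof (rule convex_onI)
  fix t :: real and u v :: 'a
  assume t: "0 < t" "t < 1"
  define u' v' where "u' = u /\<^sub>R q" and "v' = v /\<^sub>R q"
  have mix: "((1 - t) *\<^sub>R u + t *\<^sub>R v) /\<^sub>R q = (1 - t) *\<^sub>R u' + t *\<^sub>R v'"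
    by (simp add: u'_def v'_def scaleR_add_right mult.commute)
  have "x + ((1 - t) *\<^sub>R u' + t *\<^sub>R v') = (1 - t) *\<^sub>R (x + u') + t *\<^sub>R (x + v')"
    by (simp add: algebra_simps)
  then have "c (x + ((1 - t) *\<^sub>R u' + t *\<^sub>R v')) \<le> (1 - t) * c (x + u') + t * c (x + v')"
    using convex_onD[OF conv, of t "x + u'" "x + v'"] t by simp
  then have "s * (c (x + ((1 - t) *\<^sub>R u' + t *\<^sub>R v')) - a - p \<bullet> ((1 - t) *\<^sub>R u' + t *\<^sub>R v'))
      \<le> s * ((1 - t) * c (x + u') + t * c (x + v') - a - p \<bullet> ((1 - t) *\<^sub>R u' + t *\<^sub>R v'))"
    using \<open>0 \<le> s\<close> by (intro mult_left_mono) auto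
  also have "\<dots> = (1 - t) * (s * (c (x + u') - a - p \<bullet> u')) + t * (s * (c (x + v') - a - p \<bullet> v'))"
    by (simp add: inner_add_right algebra_simps)
  finally show "s * (c (x + ((1 - t) *\<^sub>R u + t *\<^sub>R v) /\<^sub>R q) - a - p \<bullet> (((1 - t) *\<^sub>R u + t *\<^sub>R v) /\<^sub>R q))
      \<le> (1 - t) * (s * (c (x + u /\<^sub>R q) - a - p \<bullet> (u /\<^sub>R q))) + t * (s * (c (x + v /\<^sub>R q) - a - p \<bullet> (v /\<^sub>R q)))"
    unfolding mix u'_def[symmetric] v'_def[symmetric] .
qed auto

lemma four_power: "(4::real) ^ n = (2 ^ n)\<^sup>2"
  by (simp add: power2_eq_square flip: power_mult_distrib)

text \<open>Parabolic rescaling preserves both quadratic bounds and turns the expressions in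
  \<open>gap\<close> into second differences of the rescaled functions. A limit thus has vanishing
  third differences, first on \<open>D\<close> and then everywhere by continuity. Since limits are
  taken along a subsequence, the expansion is obtained at some radius below \<open>r0\<close>, not
  at all small radii.\<close>

lemma quadratic_blow_up:
  fixes c :: "real^'n \<Rightarrow> real"
  assumes conv: "convex_on UNIV c"
    and lower: "\<And>h. c x + p \<bullet> h \<le> c (x + h)"
    and upper: "\<And>h. c (x + h) \<le> c x + p \<bullet> h + K * (norm h)\<^sup>2"
    and dense: "closure D = UNIV"
    and gap: "\<And>b e. b \<in> D \<Longrightarrow> e \<in> D \<Longrightarrow> (\<lambda>k. jensen_gap
      (4 ^ Suc k * second_diff c (x + b /\<^sub>R 2 ^ Suc k) (e /\<^sub>R 2 ^ Suc k))
      (4 ^ Suc k * second_diff c (x + b /\<^sub>R 2 ^ Suc k + e /\<^sub>R 2 ^ Suc k) (e /\<^sub>R 2 ^ Suc k))) \<longlonglongrightarrow> 0"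
    and "0 < \<delta>" "0 < r0"
  shows "\<exists>r A. 0 < r \<and> r < r0 \<and> transpose A = A \<and> (\<forall>h. 0 \<le> h \<bullet> (A *v h) \<and> h \<bullet> (A *v h) \<le> 2 * K * (norm h)\<^sup>2)
    \<and> (\<forall>h. norm h \<le> r \<longrightarrow> \<bar>c (x + h) - c x - p \<bullet> h - h \<bullet> (A *v h) / 2\<bar> \<le> \<delta> * r\<^sup>2)"
proof -
  define F where "F n h = 4 ^ Suc n * (c (x + h /\<^sub>R 2 ^ Suc n) - c x - p \<bullet> (h /\<^sub>R 2 ^ Suc n))" for n h
  have F_nn: "0 \<le> F n h" for n h
    using lower[of "h /\<^sub>R 2 ^ Suc n"] by (simp add: F_def)
  have F_upper: "F n h \<le> K * (norm h)\<^sup>2" for n h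
  proof -
    have "F n h \<le> 4 ^ Suc n * (K * (norm (h /\<^sub>R 2 ^ Suc n))\<^sup>2)"
      unfolding F_def using upper[of "h /\<^sub>R 2 ^ Suc n"] by (intro mult_left_mono) auto
    also have "\<dots> = K * (norm h)\<^sup>2"
      unfolding four_power by (simp add: power_mult_distrib power_divide field_simps)
    finally show ?thesis .
  qed
  have F_conv: "convex_on UNIV (F n)" for n
    unfolding F_def by (rule convex_on_affine_rescale[OF conv]) simp
  have F_lip: "\<bar>F n a - F n b\<bar> \<le> 4 * K * \<rho> * norm (a - b)" if "0 < \<rho>" "norm a \<le> \<rho>" "norm b \<le> \<rho>" for n a b \<rho>
    using convex_quadratic_bound_imp_lipschitz[OF F_conv F_nn F_upper that] .
  have F0: "F n 0 = 0" for n
    by (simp add: F_def)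
  have F_lip_ex: "\<exists>L. \<forall>n. \<forall>x\<in>cball 0 \<rho>. \<forall>y\<in>cball 0 \<rho>. \<bar>F n x - F n y\<bar> \<le> L * norm (x - y)" if "0 < \<rho>" for \<rho>
    using F_lip that by (intro exI[of _ "4 * K * \<rho>"]) auto
  obtain k g where k: "strict_mono (k :: nat \<Rightarrow> nat)"
    and unif: "\<And>\<rho>. uniform_limit (cball 0 \<rho>) (\<lambda>n. F (k n)) g sequentially"
    by (rule locally_equi_lipschitz_convergent_subsequence[OF F_lip_ex F0]) (assumption, rule that)
  have lim: "(\<lambda>n. F (k n) h) \<longlonglongrightarrow> g h" for h
    by (rule tendsto_uniform_limitI[OF unif[of "norm h"]]) simp
  have g_nn: "0 \<le> g h" and g_upper: "g h \<le> K * (norm h)\<^sup>2" for h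
    by (rule LIMSEQ_le_const[OF lim] LIMSEQ_le_const2[OF lim]; simp add: F_nn F_upper)+
  have g_lip: "\<bar>g a - g b\<bar> \<le> 4 * K * \<rho> * norm (a - b)" if "0 < \<rho>" "norm a \<le> \<rho>" "norm b \<le> \<rho>" for a b \<rho>
    by (rule LIMSEQ_le_const2[OF tendsto_rabs[OF tendsto_diff[OF lim lim]]]) (use F_lip that in auto)
  have g_cont: "continuous_on UNIV g"
    by (rule continuous_on_of_lipschitz_on_balls) (rule g_lip)
  have sd_nn: "0 \<le> second_diff (F n) b e" for n b e
  proof -
    have "(1 - 1/2) *\<^sub>R (b + 2 *\<^sub>R e) + (1/2) *\<^sub>R b = b + e"
      by (simp add: vec_eq_iff field_simps)
    then show ?thesis
      using convex_onD[OF F_conv[of n], of "1/2" "b + 2 *\<^sub>R e" b] by (simp add: second_diff_def)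
  qed
  have sd_lim: "(\<lambda>n. second_diff (F (k n)) b e) \<longlonglongrightarrow> second_diff g b e" for b e
    unfolding second_diff_def by (intro tendsto_intros lim)
  have on_D: "second_diff g b e = second_diff g (b + e) e" if "b \<in> D" "e \<in> D" for b e
  proof -
    let ?u = "second_diff g b e" and ?v = "second_diff g (b + e) e"
    have nn: "0 \<le> ?u" "0 \<le> ?v"
      by (rule LIMSEQ_le_const[OF sd_lim]; simp add: sd_nn)+
    have eq: "jensen_gap (second_diff (F n) b e) (second_diff (F n) (b + e) e) = jensen_gap
      (4 ^ Suc n * second_diff c (x + b /\<^sub>R 2 ^ Suc n) (e /\<^sub>R 2 ^ Suc n))
      (4 ^ Suc n * second_diff c (x + b /\<^sub>R 2 ^ Suc n + e /\<^sub>R 2 ^ Suc n) (e /\<^sub>R 2 ^ Suc n))" for n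
      unfolding F_def second_diff_affine_scale by (simp add: scaleR_add_right add.assoc)
    have "(\<lambda>n. jensen_gap (second_diff (F n) b e) (second_diff (F n) (b + e) e)) \<longlonglongrightarrow> 0"
      unfolding eq by (rule gap[OF that])
    then have "(\<lambda>n. jensen_gap (second_diff (F (k n)) b e) (second_diff (F (k n)) (b + e) e)) \<longlonglongrightarrow> 0"
      by (rule LIMSEQ_subseq_LIMSEQ[OF _ k, unfolded comp_def])
    moreover have "(\<lambda>n. jensen_gap (second_diff (F (k n)) b e) (second_diff (F (k n)) (b + e) e)) \<longlonglongrightarrow> jensen_gap ?u ?v"
      unfolding jensen_gap_def using nn by (intro tendsto_intros sd_lim) (auto simp: add_nonneg_eq_0_iff)
    ultimately have "jensen_gap ?u ?v = 0"
      using LIMSEQ_unique by blast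
    then show ?thesis
      using nn by (simp add: jensen_gap_eq)
  qed
  have third: "second_diff g b e = second_diff g (b + e) e" for b e
  proof -
    have "closed {z :: (real^'n) \<times> (real^'n). second_diff g (fst z) (snd z) = second_diff g (fst z + snd z) (snd z)}"
      unfolding second_diff_def
      by (intro closed_Collect_eq continuous_intros continuous_on_compose2[OF g_cont]) auto
    then have cl: "closure (D \<times> D) \<subseteq> {z. second_diff g (fst z) (snd z) = second_diff g (fst z + snd z) (snd z)}"
      using on_D by (intro closure_minimal) auto
    show ?thesis
      using subsetD[OF cl, of "(b, e)"] by (simp add: closure_Times dense)
  qed
  have par: "g (u + v) + g (u - v) = 2 * g u + 2 * g v" for u v
    by (rule third_difference_0_imp_parallelogram[OF g_nn g_upper g_lip third])
  then obtain A where A: "transpose A = A" "\<And>h. g h = h \<bullet> (A *v h) / 2"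
    using parallelogram_imp_quadratic_form[OF g_nn g_upper par] by blast
  have "\<forall>e>0. \<exists>N. \<forall>n\<ge>N. \<forall>x\<in>cball 0 1. dist (F (k n) x) (g x) < e"
    using unif[of 1] by (simp only: uniform_limit_sequentially_iff)
  then obtain N where "\<forall>n\<ge>N. \<forall>x\<in>cball 0 1. dist (F (k n) x) (g x) < \<delta>"
    using \<open>0 < \<delta>\<close> by (elim allE[of _ \<delta>] impE exE)
  then have N: "\<bar>F (k n) h - g h\<bar> < \<delta>" if "n \<ge> N" "norm h \<le> 1" for n h
    using that by (simp add: dist_real_def)
  obtain m where m: "(1/2 :: real) ^ m < r0"
    using real_arch_pow_inv[of r0 "1/2"] \<open>0 < r0\<close> by auto
  \<comment> \<open>Undoing the rescaling maps the unit ball to the ball of radius \<open>r\<close>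
    and the error \<open>\<delta>\<close> to \<open>\<delta> * r\<^sup>2\<close>. The index
    \<open>max N m\<close> is large enough both for the convergence and for
    \<open>r < r0\<close>.\<close>
  define n where "n = k (max N m)"
  define r :: real where "r = 1 / 2 ^ Suc n"
  have "m \<le> n"
    using seq_suble[OF k, of "max N m"] by (simp add: n_def)
  then have "(1/2 :: real) ^ Suc n \<le> (1/2) ^ m"
    by (intro power_decreasing) auto
  then have r: "0 < r" "r < r0"
    using m by (simp_all add: r_def power_one_over)
  have r2: "r\<^sup>2 * 4 ^ Suc n = 1"
    unfolding four_power by (simp add: r_def power_divide)
  have "\<bar>c (x + h) - c x - p \<bullet> h - h \<bullet> (A *v h) / 2\<bar> \<le> \<delta> * r\<^sup>2" if "norm h \<le> r" for h
  proof -
    define h' where "h' = h /\<^sub>R r"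
    have h: "h = r *\<^sub>R h'" "norm h' \<le> 1"
      using r that by (simp_all add: h'_def field_simps)
    have "h' /\<^sub>R 2 ^ Suc n = h"
      by (simp add: h(1) r_def inverse_eq_divide)
    then have "r\<^sup>2 * F n h' = (r\<^sup>2 * 4 ^ Suc n) * (c (x + h) - c x - p \<bullet> h)"
      by (simp add: F_def del: power_Suc)
    then have "r\<^sup>2 * F n h' = c (x + h) - c x - p \<bullet> h"
      by (simp only: r2 mult_1_left)
    moreover have "h \<bullet> (A *v h) / 2 = r\<^sup>2 * g h'"
      by (simp add: A h(1) matrix_vector_mult_scaleR power2_eq_square)
    ultimately have "c (x + h) - c x - p \<bullet> h - h \<bullet> (A *v h) / 2 = r\<^sup>2 * (F n h' - g h')"
      by (simp add: right_diff_distrib)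
    then have "\<bar>c (x + h) - c x - p \<bullet> h - h \<bullet> (A *v h) / 2\<bar> = r\<^sup>2 * \<bar>F n h' - g h'\<bar>"
      by (simp add: abs_mult)
    also have "\<dots> \<le> r\<^sup>2 * \<delta>"
      using N[of "max N m" h'] h(2) by (intro mult_left_mono) (auto simp: n_def)
    finally show ?thesis
      by (simp add: mult.commute)
  qed
  moreover have "0 \<le> h \<bullet> (A *v h)" "h \<bullet> (A *v h) \<le> 2 * K * (norm h)\<^sup>2" for h
    using g_nn[of h] g_upper[of h] by (simp_all add: A)
  ultimately show ?thesis
    using r A(1) by blast
qed

section \<open>Contact points\<close>

lemma subgradients_imp_convex_on:
  fixes c :: "'a::real_inner \<Rightarrow> real"
  assumes sub: "\<And>x. \<exists>p. \<forall>y. c x + p \<bullet> (y - x) \<le> c y"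
  shows "convex_on UNIV c"
proof (rule convex_onI)
  fix t :: real and u v :: 'a
  assume t: "0 < t" "t < 1"
  define z where "z = (1 - t) *\<^sub>R u + t *\<^sub>R v"
  obtain p where p: "\<And>y. c z + p \<bullet> (y - z) \<le> c y"
    using sub by blast
  have "(1 - t) * (c z + p \<bullet> (u - z)) + t * (c z + p \<bullet> (v - z)) \<le> (1 - t) * c u + t * c v"
    using t by (intro add_mono mult_left_mono p) auto
  moreover have "(1 - t) * (c z + p \<bullet> (u - z)) + t * (c z + p \<bullet> (v - z)) = c z"
    by (simp add: z_def inner_add_right inner_diff_right algebra_simps)
  ultimately show "c ((1 - t) *\<^sub>R u + t *\<^sub>R v) \<le> (1 - t) * c u + t * c v"
    by (simp add: z_def)
qed auto

lemma convex_on_second_diff_nonneg: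
  fixes c :: "'a::real_vector \<Rightarrow> real"
  assumes "convex_on UNIV c"
  shows "0 \<le> second_diff c x e"
proof -
  have "(1 - 1/2) *\<^sub>R (x + 2 *\<^sub>R e) + (1/2) *\<^sub>R x = (1/2 + 1/2) *\<^sub>R x + e"
    unfolding scaleR_add_left by (simp add: scaleR_add_right)
  then show ?thesis
    using convex_onD[OF assms, of "1/2" "x + 2 *\<^sub>R e" x] by (simp add: second_diff_def)
qed

lemma subgradient_eq_of_quadratic_upper_bound:
  fixes c :: "'a::real_inner \<Rightarrow> real"
  assumes lower: "\<And>h. c x + s \<bullet> h \<le> c (x + h)"
    and upper: "\<And>h. c (x + h) \<le> c x + p \<bullet> h + K * (norm h)\<^sup>2" and "0 < K"
  shows "s = p"
proof -
  \<comment> \<open>This \<open>h\<close> maximises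
    \<open>(s - p) \<bullet> h - K * (norm h)\<^sup>2\<close>, which the two bounds force to be
    nonpositive.\<close>
  define h where "h = (1 / (2 * K)) *\<^sub>R (s - p)"
  have "(s - p) \<bullet> h \<le> K * (norm h)\<^sup>2"
    using order_trans[OF lower upper, of h] by (simp add: inner_diff_left)
  also have "K * (norm h)\<^sup>2 = (norm (s - p))\<^sup>2 / (4 * K)"
    using \<open>0 < K\<close> by (simp add: h_def power_mult_distrib power_divide power2_eq_square)
  also have "(s - p) \<bullet> h = (norm (s - p))\<^sup>2 / (2 * K)"
    by (simp add: h_def power2_norm_eq_inner)
  finally have "(norm (s - p))\<^sup>2 \<le> 0"
    using \<open>0 < K\<close> by (simp add: field_simps)
  then show ?thesis
    by simp
qed

text \<open>From \<open>x'\<close> move in the direction \<open>P - P'\<close> by the distance of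
  the base points. There the plane at \<open>x\<close> lies below the paraboloid at
  \<open>x'\<close>, while the paraboloid at \<open>x\<close> controls \<open>C x'\<close>; each
  paraboloid contributes one \<open>K\<close>, hence the factor 2.\<close>

lemma contact_slope_lipschitz:
  fixes C :: "'a::real_inner \<Rightarrow> real"
  assumes lower: "\<And>h. C x + P \<bullet> h \<le> C (x + h)"
    and upper: "\<And>h. C (x + h) \<le> C x + P \<bullet> h + K * (norm h)\<^sup>2"
    and upper': "\<And>h. C (x' + h) \<le> C x' + P' \<bullet> h + K * (norm h)\<^sup>2"
  shows "norm (P - P') \<le> 2 * K * norm (x - x')"
proof (cases "x = x' \<or> P = P'")
  case False
  define h where "h = (norm (x' - x) / norm (P - P')) *\<^sub>R (P - P')"
  have "norm (P - P') > 0" "norm (x' - x) > 0"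
    using False by auto
  have nh: "norm h = norm (x' - x)"
    using False by (simp add: h_def)
  have "C x + P \<bullet> (x' - x + h) \<le> C (x' + h)"
    using lower[of "x' - x + h"] by simp
  also have "\<dots> \<le> C x' + P' \<bullet> h + K * (norm h)\<^sup>2"
    by (rule upper')
  also have "C x' \<le> C x + P \<bullet> (x' - x) + K * (norm (x' - x))\<^sup>2"
    using upper[of "x' - x"] by simp
  finally have "(P - P') \<bullet> h \<le> 2 * K * (norm (x' - x))\<^sup>2"
    by (simp add: nh inner_add_right inner_diff_left)
  also have "(P - P') \<bullet> h = norm (P - P') * norm (x' - x)"
    using False by (simp add: h_def dot_square_norm power2_eq_square)
  finally have "norm (P - P') * norm (x' - x) \<le> (2 * K * norm (x' - x)) * norm (x' - x)"
    by (simp add: power2_eq_square)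
  then show ?thesis
    using \<open>norm (x' - x) > 0\<close> by (simp add: norm_minus_commute)
next
  case True
  show ?thesis
  proof (cases "x = x'")
    case False
    have "0 \<le> K * (norm (x' - x))\<^sup>2"
      using order_trans[OF lower upper, of "x' - x"] by simp
    then have "0 \<le> K"
      using False by (simp add: zero_le_mult_iff)
    then show ?thesis
      using True False by simp
  next
    case True
    have "P = P'" if "P \<noteq> P'"
    proof -
      have "0 \<le> K * (norm (P - P'))\<^sup>2"
        using order_trans[OF lower upper, of "P - P'"] by simp
      then have "0 \<le> K"
        using that by (simp add: zero_le_mult_iff)
      have "P = P'"
      proof (rule subgradient_eq_of_quadratic_upper_bound[where K = "K + 1"])
        show "C x + P \<bullet> h \<le> C (x + h)" for h
          by (rule lower)
        show "C (x + h) \<le> C x + P' \<bullet> h + (K + 1) * (norm h)\<^sup>2" for h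
        proof -
          have "K * (norm h)\<^sup>2 \<le> (K + 1) * (norm h)\<^sup>2"
            by (simp add: distrib_right)
          then show ?thesis
            using upper'[of h] unfolding True by linarith
        qed
        show "0 < K + 1"
          using \<open>0 \<le> K\<close> by simp
      qed
      then show ?thesis .
    qed
    then show ?thesis
      using True by auto
  qed
qed

text \<open>Jensen's lemma: the map sending a contact point to its slope is Lipschitz and covers a
  ball, so the contact set is not negligible.\<close>

lemma exists_contact_point_outside_negligible:
  fixes C :: "'a::euclidean_space \<Rightarrow> real"
  assumes sub: "\<And>x. \<exists>p. \<forall>y. C x + p \<bullet> (y - x) \<le> C y" and cont: "continuous_on UNIV C"
    and "0 < K" "0 < \<eta>"
    and coercive: "\<And>y. R \<le> norm y \<Longrightarrow> C y - K * (norm y)\<^sup>2 + \<eta> * norm y < C x0 - K * (norm x0)\<^sup>2 - \<eta> * norm x0"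
    and "negligible N"
  shows "\<exists>x P. x \<notin> N \<and> norm x < R \<and> norm (P - (2 * K) *\<^sub>R x) \<le> \<eta>
    \<and> (\<forall>h. C x + P \<bullet> h \<le> C (x + h)) \<and> (\<forall>h. C (x + h) \<le> C x + P \<bullet> h + K * (norm h)\<^sup>2)"
proof (rule ccontr)
  assume contr: "\<not> ?thesis"
  define Q where "Q x P \<longleftrightarrow> norm x < R \<and> norm (P - (2 * K) *\<^sub>R x) \<le> \<eta>
    \<and> (\<forall>h. C x + P \<bullet> h \<le> C (x + h)) \<and> (\<forall>h. C (x + h) \<le> C x + P \<bullet> h + K * (norm h)\<^sup>2)" for x P
  define E where "E = {x. \<exists>P. Q x P}"
  have "E \<subseteq> N"
    using contr unfolding E_def Q_def by blast
  then have "negligible E"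
    using \<open>negligible N\<close> negligible_subset by blast
  have lip: "norm (P - P') \<le> 2 * K * norm (x - x')" if "Q x P" "Q x' P'" for x P x' P'
    using that unfolding Q_def by (intro contact_slope_lipschitz[of C]) auto
  \<comment> \<open>The choice by \<open>SOME\<close> is harmless, since \<open>lip\<close> with
    equal base points shows that a contact point has only one slope. Subtracting the gradient of
    \<open>K * (norm x)\<^sup>2\<close> leaves the tilt at which the contact occurs.\<close>
  define f where "f x = (SOME P. Q x P) - (2 * K) *\<^sub>R x" for x
  have f: "f x = P - (2 * K) *\<^sub>R x" if "Q x P" for x P
  proof -
    have "Q x (SOME P. Q x P)"
      using that by (rule someI)
    from lip[OF this that] show ?thesis
      by (simp add: f_def)
  qed
  have "negligible (f ` E)"
  proof (rule negligible_locally_Lipschitz_image[OF order_refl \<open>negligible E\<close>])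
    fix x assume "x \<in> E"
    then obtain P where P: "Q x P"
      by (auto simp: E_def)
    have "norm (f y - f x) \<le> (4 * K) * norm (y - x)" if "y \<in> E" for y
    proof -
      obtain P' where P': "Q y P'"
        using \<open>y \<in> E\<close> by (auto simp: E_def)
      have "f y - f x = (P' - P) - (2 * K) *\<^sub>R (y - x)"
        by (simp add: f[OF P] f[OF P'] algebra_simps)
      then have "norm (f y - f x) \<le> norm (P' - P) + norm ((2 * K) *\<^sub>R (y - x))"
        by (metis norm_triangle_ineq4)
      then show ?thesis
        using lip[OF P' P] \<open>0 < K\<close> by simp
    qed
    then show "\<exists>T B. open T \<and> x \<in> T \<and> (\<forall>y\<in>E \<inter> T. norm (f y - f x) \<le> B * norm (y - x))"
      by (intro exI[of _ UNIV] exI[of _ "4 * K"]) auto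
  qed
  \<comment> \<open>A tilt \<open>p\<close> changes the value at \<open>y\<close> by at most
    \<open>\<eta> * norm y\<close>, for which \<open>coercive\<close> makes allowance. So each
    tilted function has its maximum inside the ball, and a maximum point is a contact point with
    tilt \<open>p\<close>.\<close>
  moreover have "ball 0 \<eta> \<subseteq> f ` E"
  proof
    fix p :: 'a assume "p \<in> ball 0 \<eta>"
    then have p: "norm p \<le> \<eta>"
      by simp
    define w where "w y = C y - K * (norm y)\<^sup>2 - p \<bullet> y" for y
    have out: "w y < w x0" if "R \<le> norm y" for y
    proof -
      have "\<bar>p \<bullet> y\<bar> \<le> \<eta> * norm y" "\<bar>p \<bullet> x0\<bar> \<le> \<eta> * norm x0"
        by (rule order_trans[OF Cauchy_Schwarz_ineq2 mult_right_mono[OF p norm_ge_zero]])+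
      then show ?thesis
        using coercive[OF that] unfolding w_def by linarith
    qed
    then have "norm x0 < R"
      by (meson less_irrefl not_le)
    have "continuous_on (cball 0 R) w"
      unfolding w_def by (intro continuous_intros continuous_on_subset[OF cont]) auto
    moreover have "x0 \<in> cball 0 R"
      using \<open>norm x0 < R\<close> by simp
    ultimately obtain x where "x \<in> cball 0 R" and max_in: "\<And>y. y \<in> cball 0 R \<Longrightarrow> w y \<le> w x"
      using continuous_attains_sup[of "cball 0 R" w] by (metis compact_cball empty_iff)
    have max: "w y \<le> w x" for y
      using max_in[of y] max_in[of x0] out[of y] \<open>x0 \<in> cball 0 R\<close> by (cases "norm y \<le> R") auto
    have "norm x < R"
      using out[of x] max[of x0] by (meson not_le)
    define P where "P = p + (2 * K) *\<^sub>R x"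
    have upper: "C (x + h) \<le> C x + P \<bullet> h + K * (norm h)\<^sup>2" for h
      using max[of "x + h"] unfolding w_def P_def
      by (simp add: power2_norm_eq_inner inner_add_left inner_add_right inner_commute[of h x] algebra_simps)
    obtain s where s: "\<And>y. C x + s \<bullet> (y - x) \<le> C y"
      using sub by blast
    have s': "C x + s \<bullet> h \<le> C (x + h)" for h
      using s[of "x + h"] by simp
    have "s = P"
      by (rule subgradient_eq_of_quadratic_upper_bound[OF s' upper \<open>0 < K\<close>])
    then have "Q x P"
      using \<open>norm x < R\<close> p upper s' by (simp add: Q_def P_def)
    then have "f x = p" "x \<in> E"
      using f[of x P] by (auto simp: E_def P_def)
    then show "p \<in> f ` E"
      by blast
  qed
  ultimately have "negligible (ball (0::'a) \<eta>)"
    using negligible_subset by blast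
  then show False
    using open_not_negligible[of "ball (0::'a) \<eta>"] \<open>0 < \<eta>\<close> by simp
qed

lemma AE_lborel_imp_negligible:
  assumes "AE x in lborel. P x"
  shows "negligible {x. \<not> P x}"
proof -
  obtain N where "{x. \<not> P x} \<subseteq> N" "N \<in> null_sets lborel"
    using assms by (auto elim!: AE_E simp: null_sets_def)
  then show ?thesis
    by (meson negligible_iff_null_sets negligible_subset null_sets_completionI)
qed

text \<open>The inequality for \<open>c\<close> and the contact inequality for \<open>c + d\<close> bound \<open>d\<close> from above, so
  no second order expansion of \<open>d\<close> is needed.\<close>

lemma exists_quadratic_contact_point:
  fixes c d :: "real^'n \<Rightarrow> real"
  assumes sub_c: "\<And>x. \<exists>p. \<forall>y. c x + p \<bullet> (y - x) \<le> c y"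
    and sub_d: "\<And>x. \<exists>p. \<forall>y. d x + p \<bullet> (y - x) \<le> d y"
    and "0 < K" "0 < \<eta>" "0 < \<delta>" "0 < r0"
    and coercive: "\<And>y. R \<le> norm y \<Longrightarrow>
      c y + d y - K * (norm y)\<^sup>2 + \<eta> * norm y < c x0 + d x0 - K * (norm x0)\<^sup>2 - \<eta> * norm x0"
  shows "\<exists>x p q A r. norm x < R \<and> norm (p + q - (2 * K) *\<^sub>R x) \<le> \<eta> \<and> 0 < r \<and> r < r0
    \<and> transpose A = A \<and> (\<forall>h. 0 \<le> h \<bullet> (A *v h) \<and> h \<bullet> (A *v h) \<le> 2 * K * (norm h)\<^sup>2)
    \<and> (\<forall>h. norm h \<le> r \<longrightarrow> c (x + h) \<le> c x + p \<bullet> h + h \<bullet> (A *v h) / 2 + \<delta> * r\<^sup>2)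
    \<and> (\<forall>h. norm h \<le> r \<longrightarrow> d (x + h) \<le> d x + q \<bullet> h + K * (norm h)\<^sup>2 - h \<bullet> (A *v h) / 2 + \<delta> * r\<^sup>2)
    \<and> (\<forall>h. c (x + h) + d (x + h) \<le> c x + d x + (p + q) \<bullet> h + K * (norm h)\<^sup>2)"
proof -
  have conv: "convex_on UNIV c" "convex_on UNIV d"
    using sub_c sub_d by (auto intro: subgradients_imp_convex_on)
  then have cont: "continuous_on UNIV c" "continuous_on UNIV d"
    by (auto intro: convex_on_continuous[OF open_UNIV])
  \<comment> \<open>Countability keeps the union of the exceptional sets negligible; density
    suffices for the blow-up limits because they are continuous.\<close>
  obtain D :: "(real^'n) set" where "countable D" and "UNIV \<subseteq> closure D"
    using separable[of "UNIV :: (real^'n) set"] by auto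
  then have dense: "closure D = UNIV"
    by auto
  define good where "good x b e \<longleftrightarrow> (\<lambda>k. jensen_gap
      (4 ^ Suc k * second_diff c (x + b /\<^sub>R 2 ^ Suc k) (e /\<^sub>R 2 ^ Suc k))
      (4 ^ Suc k * second_diff c (x + b /\<^sub>R 2 ^ Suc k + e /\<^sub>R 2 ^ Suc k) (e /\<^sub>R 2 ^ Suc k))) \<longlonglongrightarrow> 0" for x b e
  have "AE x in lborel. \<forall>b\<in>D. \<forall>e\<in>D. good x b e"
    unfolding good_def using \<open>countable D\<close>
    by (intro AE_ball_countable' AE_jensen_gap_tendsto_0 cont(1) convex_on_second_diff_nonneg conv(1))
  then have "negligible {x. \<not> (\<forall>b\<in>D. \<forall>e\<in>D. good x b e)}"
    by (rule AE_lborel_imp_negligible)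
  moreover have "\<exists>p. \<forall>y. c x + d x + p \<bullet> (y - x) \<le> c y + d y" for x
  proof -
    obtain p q where "\<And>y. c x + p \<bullet> (y - x) \<le> c y" "\<And>y. d x + q \<bullet> (y - x) \<le> d y"
      using sub_c sub_d by metis
    then have "c x + d x + (p + q) \<bullet> (y - x) \<le> c y + d y" for y
      by (simp add: inner_add_left) (metis add.assoc add.left_commute add_mono)
    then show ?thesis
      by blast
  qed
  ultimately obtain x P where x: "\<forall>b\<in>D. \<forall>e\<in>D. good x b e" "norm x < R" "norm (P - (2 * K) *\<^sub>R x) \<le> \<eta>"
    and upper: "\<And>h. c (x + h) + d (x + h) \<le> c x + d x + P \<bullet> h + K * (norm h)\<^sup>2"
    using exists_contact_point_outside_negligible[of "\<lambda>x. c x + d x" K \<eta> R x0 "{x. \<not> (\<forall>b\<in>D. \<forall>e\<in>D. good x b e)}"]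
      \<open>0 < K\<close> \<open>0 < \<eta>\<close> coercive continuous_on_add[OF cont] by auto
  obtain p q where pq: "\<And>y. c x + p \<bullet> (y - x) \<le> c y" "\<And>y. d x + q \<bullet> (y - x) \<le> d y"
    using sub_c sub_d by metis
  have c_low: "c x + p \<bullet> h \<le> c (x + h)" and d_low: "d x + q \<bullet> h \<le> d (x + h)" for h
    using pq(1)[of "x + h"] pq(2)[of "x + h"] by simp_all
  have "c x + d x + (p + q) \<bullet> h \<le> c (x + h) + d (x + h)" for h
    using c_low[of h] d_low[of h] by (simp add: inner_add_left)
  then have P: "p + q = P"
    by (rule subgradient_eq_of_quadratic_upper_bound[of "\<lambda>x. c x + d x"]) (use upper \<open>0 < K\<close> in auto)
  \<comment> \<open>Subtracting the supporting plane of \<open>d\<close> from the bound for the sum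
    traps \<open>c\<close> alone between a plane and a paraboloid, as the blow-up requires.\<close>
  have c_upper: "c (x + h) \<le> c x + p \<bullet> h + K * (norm h)\<^sup>2" for h
    using upper[of h] d_low[of h] by (simp add: P[symmetric] inner_add_left)
  obtain r A where rA: "0 < r" "r < r0" "transpose A = A"
    "\<And>h. 0 \<le> h \<bullet> (A *v h) \<and> h \<bullet> (A *v h) \<le> 2 * K * (norm h)\<^sup>2"
    "\<And>h. norm h \<le> r \<Longrightarrow> \<bar>c (x + h) - c x - p \<bullet> h - h \<bullet> (A *v h) / 2\<bar> \<le> \<delta> * r\<^sup>2"
    using quadratic_blow_up[OF conv(1) c_low c_upper dense bspec[OF bspec[OF x(1)], unfolded good_def]
        \<open>0 < \<delta>\<close> \<open>0 < r0\<close>] by blast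
  have c_quad: "c (x + h) \<le> c x + p \<bullet> h + h \<bullet> (A *v h) / 2 + \<delta> * r\<^sup>2" if "norm h \<le> r" for h
    using rA(5)[OF that] by (simp add: abs_le_iff)
  have d_quad: "d (x + h) \<le> d x + q \<bullet> h + K * (norm h)\<^sup>2 - h \<bullet> (A *v h) / 2 + \<delta> * r\<^sup>2" if "norm h \<le> r" for h
    using rA(5)[OF that] upper[of h] by (simp add: abs_le_iff P[symmetric] inner_add_left)
  show ?thesis
    by (rule exI[of _ x], rule exI[of _ p], rule exI[of _ q], rule exI[of _ A], rule exI[of _ r])
       (use x rA c_quad d_quad upper P in auto)
qed

section \<open>Semicontinuous functions\<close>

lemma usc_onD:
  assumes "usc_on S f" "x \<in> S" "f x < a"
  shows "\<exists>T. open T \<and> x \<in> T \<and> (\<forall>y\<in>T \<inter> S. f y < a)"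
proof -
  obtain T where "open T" "x \<in> T" "\<forall>y\<in>T. y \<noteq> x \<longrightarrow> y \<in> S \<longrightarrow> f y < a"
    using assms unfolding usc_on_def eventually_at_topological by blast
  then show ?thesis
    using \<open>f x < a\<close> by (intro exI[of _ T]) auto
qed

lemma usc_on_eventually_less:
  assumes "usc_on S f" "x \<in> S" "f x < a" "s \<longlonglongrightarrow> x" "\<And>n. s n \<in> S"
  shows "\<forall>\<^sub>F n in sequentially. f (s n) < a"
proof -
  obtain T where T: "open T" "x \<in> T" "\<forall>y\<in>T \<inter> S. f y < a"
    using usc_onD[OF assms(1-3)] by blast
  then have "\<forall>\<^sub>F n in sequentially. s n \<in> T"
    using \<open>s \<longlonglongrightarrow> x\<close> topological_tendstoD by blast
  then show ?thesis
    by eventually_elim (use T assms(5) in auto)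
qed

lemma continuous_on_imp_usc_on:
  assumes "continuous_on S f"
  shows "usc_on S f"
  unfolding usc_on_def using assms by (auto simp: continuous_on_def intro: order_tendstoD(2))

lemma lsc_on_imp_usc_on_minus: "lsc_on S f \<Longrightarrow> usc_on S (\<lambda>x. - f x)"
  unfolding lsc_on_def usc_on_def
proof (intro ballI allI impI)
  fix x a
  assume lsc: "\<forall>x\<in>S. \<forall>a. a < f x \<longrightarrow> (\<forall>\<^sub>F y in at x within S. a < f y)" and "x \<in> S" "- f x < a"
  then have "\<forall>\<^sub>F y in at x within S. - a < f y"
    by auto
  then show "\<forall>\<^sub>F y in at x within S. - f y < a"
    by eventually_elim simp
qed

lemma usc_on_add:
  assumes "usc_on S f" "usc_on S g"
  shows "usc_on S (\<lambda>x. f x + g x)"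
  unfolding usc_on_def
proof (intro ballI allI impI)
  fix x a
  assume "x \<in> S" "f x + g x < a"
  define e where "e = (a - (f x + g x)) / 2"
  have "0 < e"
    using \<open>f x + g x < a\<close> by (simp add: e_def)
  then have "\<forall>\<^sub>F y in at x within S. f y < f x + e" "\<forall>\<^sub>F y in at x within S. g y < g x + e"
    using assms \<open>x \<in> S\<close> by (auto simp: usc_on_def)
  then show "\<forall>\<^sub>F y in at x within S. f y + g y < a"
    by eventually_elim (simp add: e_def field_simps)
qed

text \<open>Without a maximum the open sets \<open>U y\<close>, on whose part in \<open>C\<close>
  the function stays below \<open>f y\<close>, would cover \<open>C\<close>. In a finite subcover,
  the index with the largest value would lie in some \<open>U z\<close> and so have a smaller value
  than \<open>z\<close>.\<close>

lemma usc_on_attains_sup: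
  assumes "compact C" "C \<noteq> {}" "usc_on C f"
  shows "\<exists>x\<in>C. \<forall>y\<in>C. f y \<le> f x"
proof (rule ccontr)
  assume "\<not> ?thesis"
  then have no_max: "\<forall>x\<in>C. \<exists>y\<in>C. f x < f y"
    by (meson not_le)
  define U where "U y = \<Union>{T. open T \<and> (\<forall>z\<in>T \<inter> C. f z < f y)}" for y
  have "open (U y)" for y
    unfolding U_def by (rule open_Union) auto
  moreover have "C \<subseteq> (\<Union>y\<in>C. U y)"
  proof
    fix x assume "x \<in> C"
    then obtain y where "y \<in> C" "f x < f y"
      using no_max by blast
    moreover obtain T where "open T" "x \<in> T" "\<forall>z\<in>T \<inter> C. f z < f y"
      using usc_onD[OF assms(3) \<open>x \<in> C\<close> \<open>f x < f y\<close>] by blast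
    ultimately show "x \<in> (\<Union>y\<in>C. U y)"
      unfolding U_def by blast
  qed
  ultimately obtain C' where C': "C' \<subseteq> C" "finite C'" "C \<subseteq> (\<Union>y\<in>C'. U y)"
    using compactE_image[OF \<open>compact C\<close>, of C U] by blast
  then have "C' \<noteq> {}"
    using \<open>C \<noteq> {}\<close> by auto
  then have "Max (f ` C') \<in> f ` C'"
    using C'(2) by (intro Max_in) auto
  then obtain y where "y \<in> C'" "Max (f ` C') = f y"
    by blast
  then have y: "y \<in> C'" "\<forall>z\<in>C'. f z \<le> f y"
    using C'(2) by (auto simp flip: \<open>Max (f ` C') = f y\<close>)
  then obtain z where "z \<in> C'" "y \<in> U z"
    using C' by blast
  then have "f y < f z"
    using y C' unfolding U_def by blast
  then show False
    using y \<open>z \<in> C'\<close> by (meson not_le)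
qed

section \<open>Touching by quadratic functions\<close>

lemma symmetric_matrix_inner: "transpose X = X \<Longrightarrow> u \<bullet> (X *v w) = (X *v u) \<bullet> w"
  for X :: "real^'n^'n"
  by (metis dot_lmul_matrix vector_transpose_matrix)

lemma matrix_vector_affine_has_derivative:
  fixes M :: "real^'n^'n"
  shows "((\<lambda>z. M *v (z - z0)) has_derivative (\<lambda>h. M *v h)) (at x)"
proof -
  have "((\<lambda>z. z - z0) has_derivative (\<lambda>h. h)) (at x)"
    by (auto intro!: derivative_eq_intros)
  then show ?thesis
    by (rule bounded_linear.has_derivative[OF matrix_vector_mul_bounded_linear])
qed

lemma quadratic_form_has_derivative:
  fixes M :: "real^'n^'n"
  assumes "transpose M = M"
  shows "((\<lambda>z. a + l \<bullet> (z - z0) + (z - z0) \<bullet> (M *v (z - z0)) / 2) has_derivative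
    (\<lambda>h. (l + M *v (x - z0)) \<bullet> h)) (at x)"
proof -
  have id: "((\<lambda>z. z - z0) has_derivative (\<lambda>h. h)) (at x)"
    by (auto intro!: derivative_eq_intros)
  have "((\<lambda>z. (z - z0) \<bullet> (M *v (z - z0))) has_derivative
      (\<lambda>h. (x - z0) \<bullet> (M *v h) + h \<bullet> (M *v (x - z0)))) (at x)"
    by (rule has_derivative_inner[OF id matrix_vector_affine_has_derivative])
  then have "((\<lambda>z. (z - z0) \<bullet> (M *v (z - z0)) / 2) has_derivative
      (\<lambda>h. ((x - z0) \<bullet> (M *v h) + h \<bullet> (M *v (x - z0))) / 2)) (at x)"
    by (rule bounded_linear.has_derivative[OF bounded_linear_divide])
  moreover have "((\<lambda>z. a + l \<bullet> (z - z0)) has_derivative (\<lambda>h. l \<bullet> h)) (at x)"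
    by (auto intro!: derivative_eq_intros)
  ultimately have "((\<lambda>z. a + l \<bullet> (z - z0) + (z - z0) \<bullet> (M *v (z - z0)) / 2) has_derivative
      (\<lambda>h. l \<bullet> h + ((x - z0) \<bullet> (M *v h) + h \<bullet> (M *v (x - z0))) / 2)) (at x)"
    by (intro has_derivative_add)
  moreover have "l \<bullet> h + ((x - z0) \<bullet> (M *v h) + h \<bullet> (M *v (x - z0))) / 2 = (l + M *v (x - z0)) \<bullet> h" for h
    by (simp add: symmetric_matrix_inner[OF assms, of "x - z0" h] inner_commute[of h] inner_add_left)
  ultimately show ?thesis
    by simp
qed

lemma quadratic_form_C2:
  fixes M :: "real^'n^'n" and l z0 :: "real^'n" and a :: real
  assumes "transpose M = M"
  defines "\<phi> \<equiv> \<lambda>z. a + l \<bullet> (z - z0) + (z - z0) \<bullet> (M *v (z - z0)) / 2"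
  shows "C2_near \<phi> x" and "hessian \<phi> x = M"
proof -
  note der = quadratic_form_has_derivative[OF assms(1), of a l z0, folded \<phi>_def]
  have pd: "partial_deriv i \<phi> = (\<lambda>x. l $ i + (M *v (x - z0)) $ i)" for i
  proof
    fix x
    have "frechet_derivative \<phi> (at x) = (\<lambda>h. (l + M *v (x - z0)) \<bullet> h)"
      using frechet_derivative_at[OF der] by simp
    then show "partial_deriv i \<phi> x = l $ i + (M *v (x - z0)) $ i"
      by (simp add: partial_deriv_def inner_axis)
  qed
  have der2: "(partial_deriv i \<phi> has_derivative (\<lambda>h. (M *v h) $ i)) (at x)" for i x
  proof -
    have "((\<lambda>x. l $ i + (M *v (x - z0)) $ i) has_derivative (\<lambda>h. 0 + (M *v h) $ i)) (at x)"
      by (intro has_derivative_add has_derivative_const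
          bounded_linear.has_derivative[OF bounded_linear_vec_nth matrix_vector_affine_has_derivative])
    then show ?thesis
      unfolding pd by simp
  qed
  have pd2: "partial_deriv j (partial_deriv i \<phi>) x = M $ i $ j" for i j x
  proof -
    have "frechet_derivative (partial_deriv i \<phi>) (at x) = (\<lambda>h. (M *v h) $ i)"
      using frechet_derivative_at[OF der2] by simp
    then show ?thesis
      by (simp add: partial_deriv_def matrix_vector_mult_basis column_def)
  qed
  have "continuous_on UNIV (partial_deriv i (partial_deriv j \<phi>))" for i j
    by (simp add: pd2 cong: continuous_on_cong)
  then show "C2_near \<phi> x"
    unfolding C2_near_def differentiable_def using der der2 by (intro exI[of _ UNIV]) blast
  \<comment> \<open>\<open>hessian\<close> takes the derivatives in the order opposite to
    \<open>pd2\<close>, so the entries come out transposed and the symmetry of \<open>M\<close>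
    enters.\<close>
  have "M $ j $ i = M $ i $ j" for i j
    using assms(1) by (metis transpose_def vec_lambda_beta)
  then show "hessian \<phi> x = M"
    by (simp add: hessian_def pd2 vec_eq_iff)
qed

lemma viscosity_subsolutionD:
  assumes "viscosity_subsolution F \<Omega> v" "z \<in> \<Omega>" "transpose M = M"
    and "\<forall>\<^sub>F m in nhds 0. v (z + m) \<le> v z + l \<bullet> m + m \<bullet> (M *v m) / 2"
  shows "0 \<le> F M z"
proof -
  define \<phi> where "\<phi> = (\<lambda>x. v z + l \<bullet> (x - z) + (x - z) \<bullet> (M *v (x - z)) / 2)"
  have "\<forall>\<^sub>F x in nhds z. v x \<le> \<phi> x"
    using assms(4) unfolding eventually_nhds_metric \<phi>_def dist_norm
    by (metis add_diff_cancel_left' diff_add_cancel add.commute diff_zero)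
  moreover have "C2_near \<phi> z" "hessian \<phi> z = M"
    unfolding \<phi>_def by (rule quadratic_form_C2[OF assms(3)])+
  moreover have "\<phi> z = v z"
    by (simp add: \<phi>_def)
  ultimately show ?thesis
    using assms(1,2) unfolding viscosity_subsolution_def by metis
qed

lemma viscosity_supersolutionD:
  assumes "viscosity_supersolution F \<Omega> u" "z \<in> \<Omega>" "transpose M = M"
    and "\<forall>\<^sub>F m in nhds 0. u z + l \<bullet> m + m \<bullet> (M *v m) / 2 \<le> u (z + m)"
  shows "F M z \<le> 0"
proof -
  define \<phi> where "\<phi> = (\<lambda>x. u z + l \<bullet> (x - z) + (x - z) \<bullet> (M *v (x - z)) / 2)"
  have "\<forall>\<^sub>F x in nhds z. \<phi> x \<le> u x"
    using assms(4) unfolding eventually_nhds_metric \<phi>_def dist_norm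
    by (metis add_diff_cancel_left' diff_add_cancel add.commute diff_zero)
  moreover have "C2_near \<phi> z" "hessian \<phi> z = M"
    unfolding \<phi>_def by (rule quadratic_form_C2[OF assms(3)])+
  moreover have "\<phi> z = u z"
    by (simp add: \<phi>_def)
  ultimately show ?thesis
    using assms(1,2) unfolding viscosity_supersolution_def by metis
qed

text \<open>Polarisation takes the place of diagonalisation. For \<open>w\<close> parallel to
  \<open>X *v h\<close> and as long as \<open>h\<close>, the product
  \<open>w \<bullet> (X *v h)\<close> is a quarter of the difference of the quadratic form at
  \<open>h + w\<close> and \<open>h - w\<close>; the parallelogram law adds up the two
  bounds.\<close>

lemma norm_symmetric_matrix_vector_le:
  fixes X :: "real^'n^'n"
  assumes sym: "transpose X = X" and bound: "\<And>h. \<bar>h \<bullet> (X *v h)\<bar> \<le> K * (norm h)\<^sup>2"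
  shows "norm (X *v h) \<le> K * norm h"
proof (cases "X *v h = 0 \<or> h = 0")
  case True
  have "0 \<le> K * (norm h)\<^sup>2"
    using bound[of h] by (simp add: order_trans[OF abs_ge_zero])
  then have "0 \<le> K * norm h"
    by (cases "h = 0") (auto simp: zero_le_mult_iff)
  then show ?thesis
    using True by auto
next
  case False
  have sym': "u \<bullet> (X *v w) = w \<bullet> (X *v u)" for u w
    using sym by (metis dot_lmul_matrix vector_transpose_matrix inner_commute)
  define w where "w = (norm h / norm (X *v h)) *\<^sub>R (X *v h)"
  have nw: "norm w = norm h"
    using False by (simp add: w_def)
  have "4 * (w \<bullet> (X *v h)) = (h + w) \<bullet> (X *v (h + w)) - (h - w) \<bullet> (X *v (h - w))"
    by (simp add: matrix_vector_right_distrib matrix_vector_mult_diff_distrib inner_add_left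
        inner_add_right inner_diff_left inner_diff_right sym'[of h w])
  also have "\<dots> \<le> K * (norm (h + w))\<^sup>2 + K * (norm (h - w))\<^sup>2"
    using bound[of "h + w"] bound[of "h - w"] by (simp add: abs_le_iff)
  also have "\<dots> = K * (2 * (norm h)\<^sup>2 + 2 * (norm w)\<^sup>2)"
    by (simp add: power2_norm_eq_inner inner_add_left inner_add_right inner_diff_left inner_diff_right algebra_simps)
  finally have "w \<bullet> (X *v h) \<le> K * (norm h)\<^sup>2"
    by (simp add: nw)
  moreover have "w \<bullet> (X *v h) = norm h * norm (X *v h)"
    using False by (simp add: w_def dot_square_norm power2_eq_square)
  ultimately have "norm h * norm (X *v h) \<le> norm h * (K * norm h)"
    by (simp add: power2_eq_square algebra_simps)
  then show ?thesis
    using False by simp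
qed

lemma mat_mult_vector: "mat c *v h = c *\<^sub>R h" for h :: "real^'n"
  by (simp add: mat_def matrix_vector_mult_def vec_eq_iff if_distrib[of "\<lambda>x. x * _"] cong: if_cong)

lemma touching_from_single_scale:
  fixes f :: "real^'n \<Rightarrow> real"
  assumes cont: "continuous_on UNIV f" and "0 < r" "0 < \<delta>" and sym: "transpose X = X"
    and scale: "\<And>h. norm h \<le> r \<Longrightarrow> f (x + h) \<le> f x + p \<bullet> h + h \<bullet> (X *v h) / 2 + \<delta> * r\<^sup>2"
  shows "\<exists>h0 l. norm h0 < r \<and>
    (\<forall>\<^sub>F h in nhds 0. f (x + h0 + h) \<le> f (x + h0) + l \<bullet> h + h \<bullet> ((X + mat (4 * \<delta>)) *v h) / 2)"
proof -
  have sym': "u \<bullet> (X *v w) = w \<bullet> (X *v u)" for u w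
    using sym by (metis dot_lmul_matrix vector_transpose_matrix inner_commute)
  define \<psi> where "\<psi> h = f (x + h) - p \<bullet> h - h \<bullet> (X *v h) / 2 - 2 * \<delta> * (h \<bullet> h)" for h
  have "continuous_on (cball 0 r) \<psi>"
    unfolding \<psi>_def by (intro continuous_intros continuous_on_compose2[OF cont]) auto
  then obtain h0 where h0: "h0 \<in> cball 0 r" "\<And>h. h \<in> cball 0 r \<Longrightarrow> \<psi> h \<le> \<psi> h0"
    using continuous_attains_sup[of "cball 0 r" \<psi>] \<open>0 < r\<close> by (metis compact_cball cball_eq_empty not_less_iff_gr_or_eq)
  have "norm h0 < r"
  proof (rule ccontr)
    assume "\<not> norm h0 < r"
    then have "h0 \<bullet> h0 = r\<^sup>2"
      using h0(1) by (simp add: dot_square_norm)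
    then have "\<psi> h0 \<le> f x - \<delta> * r\<^sup>2"
      using scale[of h0] h0(1) by (simp add: \<psi>_def)
    moreover have "f x \<le> \<psi> h0"
      using h0(2)[of 0] \<open>0 < r\<close> by (simp add: \<psi>_def)
    moreover have "0 < \<delta> * r\<^sup>2"
      using \<open>0 < r\<close> \<open>0 < \<delta>\<close> by simp
    ultimately show False
      by linarith
  qed
  define l where "l = p + X *v h0 + (4 * \<delta>) *\<^sub>R h0"
  have "\<forall>\<^sub>F h in nhds 0. h \<in> ball 0 (r - norm h0)"
    using \<open>norm h0 < r\<close> by (intro eventually_nhds_in_open) auto
  then have "\<forall>\<^sub>F h in nhds 0. f (x + h0 + h) \<le> f (x + h0) + l \<bullet> h + h \<bullet> ((X + mat (4 * \<delta>)) *v h) / 2"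
  proof eventually_elim
    case (elim h)
    then have "h0 + h \<in> cball 0 r"
      using norm_triangle_ineq[of h0 h] by simp
    then have le: "\<psi> (h0 + h) \<le> \<psi> h0"
      by (rule h0(2))
    have e1: "(h0 + h) \<bullet> (X *v (h0 + h)) = h0 \<bullet> (X *v h0) + 2 * (h \<bullet> (X *v h0)) + h \<bullet> (X *v h)"
      by (simp add: inner_add_left inner_add_right matrix_vector_right_distrib sym'[of h0 h])
    have e2: "(h0 + h) \<bullet> (h0 + h) = h0 \<bullet> h0 + 2 * (h \<bullet> h0) + h \<bullet> h"
      by (simp add: inner_add_left inner_add_right inner_commute[of h0 h])
    have e3: "l \<bullet> h = p \<bullet> h + h \<bullet> (X *v h0) + 4 * \<delta> * (h \<bullet> h0)"
      by (simp add: l_def inner_add_right inner_commute[of _ h])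
    have e4: "h \<bullet> ((X + mat (4 * \<delta>)) *v h) = h \<bullet> (X *v h) + 4 * \<delta> * (h \<bullet> h)"
      by (simp add: matrix_vector_mult_add_rdistrib mat_mult_vector inner_add_right)
    show ?case
      using le unfolding \<psi>_def e1 e2 e3 e4 inner_add_right[of p]
      by (simp add: add.assoc distrib_left add_divide_distrib)
  qed
  then show ?thesis
    using \<open>norm h0 < r\<close> by blast
qed

section \<open>Sup-convolutions and doubling of variables\<close>

text \<open>\<open>c\<close> is the sup-convolution plus \<open>K / 2 * (norm x)\<^sup>2\<close>.
  Expanding the square makes it a maximum of functions affine in \<open>x\<close>, so a maximising
  \<open>z\<close> gives the subgradient \<open>K *\<^sub>R z\<close>.\<close>

lemma sup_convolution_exists:
  fixes v :: "'a::real_inner \<Rightarrow> real"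
  assumes "compact C" "C \<noteq> {}" "usc_on C v"
  shows "\<exists>c. (\<forall>x. \<exists>z\<in>C. c x = v z - K / 2 * (norm z)\<^sup>2 + K * (x \<bullet> z))
    \<and> (\<forall>x. \<forall>z\<in>C. v z - K / 2 * (norm z)\<^sup>2 + K * (x \<bullet> z) \<le> c x)"
proof -
  have "\<exists>z\<in>C. \<forall>y\<in>C. v y + (K * (x \<bullet> y) - K / 2 * (norm y)\<^sup>2) \<le> v z + (K * (x \<bullet> z) - K / 2 * (norm z)\<^sup>2)" for x
    by (intro usc_on_attains_sup assms usc_on_add continuous_on_imp_usc_on continuous_intros)
  then obtain Z where Z: "\<And>x. Z x \<in> C"
    "\<And>x y. y \<in> C \<Longrightarrow> v y + (K * (x \<bullet> y) - K / 2 * (norm y)\<^sup>2) \<le> v (Z x) + (K * (x \<bullet> Z x) - K / 2 * (norm (Z x))\<^sup>2)"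
    by metis
  show ?thesis
  proof (intro exI[of _ "\<lambda>x. v (Z x) - K / 2 * (norm (Z x))\<^sup>2 + K * (x \<bullet> Z x)"] conjI allI ballI)
    show "\<exists>z\<in>C. v (Z x) - K / 2 * (norm (Z x))\<^sup>2 + K * (x \<bullet> Z x) = v z - K / 2 * (norm z)\<^sup>2 + K * (x \<bullet> z)" for x
      using Z(1) by blast
    show "v z - K / 2 * (norm z)\<^sup>2 + K * (x \<bullet> z) \<le> v (Z x) - K / 2 * (norm (Z x))\<^sup>2 + K * (x \<bullet> Z x)"
      if "z \<in> C" for x z
      using Z(2)[OF that, of x] by simp
  qed
qed

text \<open>Evaluating the sup-convolution \<open>f\<close> at \<open>x1 + B m\<close> rather than at \<open>x1 + m\<close> improves the
  second order bound for \<open>v\<close>.\<close>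

lemma sup_convolution_touching:
  fixes v f :: "real^'n \<Rightarrow> real"
  assumes upper: "\<And>z y. z \<in> C \<Longrightarrow> v z \<le> f y + K / 2 * (norm (y - z))\<^sup>2"
    and eq: "v z1 = f x1 + K / 2 * (norm (x1 - z1))\<^sup>2"
    and touch: "\<forall>\<^sub>F h in nhds 0. f (x1 + h) \<le> f x1 + l \<bullet> h + h \<bullet> (X *v h) / 2"
    and B: "transpose B = B"
    and quad: "\<And>m. (B *v m) \<bullet> (X *v (B *v m)) + K * (norm (m - B *v m))\<^sup>2 \<le> m \<bullet> (Y *v m)"
  shows "\<exists>l'. \<forall>\<^sub>F m in nhds 0. z1 + m \<in> C \<longrightarrow> v (z1 + m) \<le> v z1 + l' \<bullet> m + m \<bullet> (Y *v m) / 2"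
proof -
  define e where "e = x1 - z1"
  \<comment> \<open>The first order terms: \<open>l\<close> pulled back along the symmetric matrix
    \<open>B\<close>, and the mixed term of the expanded square.\<close>
  define l' where "l' = B *v l - K *\<^sub>R (e - B *v e)"
  have "isCont ((*v) B) 0"
    by (rule matrix_vector_mult_linear_continuous_at)
  then have "((*v) B \<longlongrightarrow> B *v 0) (nhds 0)"
    by (simp only: isCont_def tendsto_at_iff_tendsto_nhds)
  then have "filterlim ((*v) B) (nhds 0) (nhds 0)"
    by simp
  then have "\<forall>\<^sub>F m in nhds 0. f (x1 + B *v m) \<le> f x1 + l \<bullet> (B *v m) + (B *v m) \<bullet> (X *v (B *v m)) / 2"
    using touch by (rule eventually_compose_filterlim[rotated])
  then have "\<forall>\<^sub>F m in nhds 0. z1 + m \<in> C \<longrightarrow> v (z1 + m) \<le> v z1 + l' \<bullet> m + m \<bullet> (Y *v m) / 2"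
  proof (eventually_elim, intro impI)
    fix m
    assume t: "f (x1 + B *v m) \<le> f x1 + l \<bullet> (B *v m) + (B *v m) \<bullet> (X *v (B *v m)) / 2" and "z1 + m \<in> C"
    define n where "n = m - B *v m"
    have "v (z1 + m) \<le> f (x1 + B *v m) + K / 2 * (norm (x1 + B *v m - (z1 + m)))\<^sup>2"
      by (rule upper) fact
    also have "x1 + B *v m - (z1 + m) = e - n"
      by (simp add: e_def n_def)
    also have "(norm (e - n))\<^sup>2 = (norm e)\<^sup>2 - 2 * (e \<bullet> n) + (norm n)\<^sup>2"
      by (simp add: power2_norm_eq_inner inner_diff_left inner_diff_right inner_commute)
    finally have "v (z1 + m) \<le> f x1 + l \<bullet> (B *v m) + (B *v m) \<bullet> (X *v (B *v m)) / 2
        + K / 2 * ((norm e)\<^sup>2 - 2 * (e \<bullet> n) + (norm n)\<^sup>2)"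
      using t by linarith
    moreover have "l' \<bullet> m = l \<bullet> (B *v m) - K * (e \<bullet> n)"
      by (simp add: l'_def n_def symmetric_matrix_inner[OF B] inner_diff_left inner_diff_right algebra_simps)
    moreover have "v z1 = f x1 + K / 2 * (norm e)\<^sup>2"
      using eq by (simp add: e_def)
    moreover have "(B *v m) \<bullet> (X *v (B *v m)) + K * (norm n)\<^sup>2 \<le> m \<bullet> (Y *v m)"
      using quad[of m] by (simp add: n_def)
    ultimately show "v (z1 + m) \<le> v z1 + l' \<bullet> m + m \<bullet> (Y *v m) / 2"
      by (simp add: distrib_left right_diff_distrib)
  qed
  then show ?thesis
    by blast
qed

text \<open>For \<open>B = 1 - s X\<close> the form on the left, apart from \<open>\<delta>\<close>,
  belongs to \<open>X - (2 s - K s^2) X^2 + s^2 X^3\<close>, and \<open>X^3 \<le> K X^2\<close>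
  bounds it by \<open>X - (2 s - 2 K s^2) X^2\<close>. The choice \<open>s = 1 / (2 K)\<close>
  maximises this gain. As \<open>B\<close> enlarges norms at most by the factor 3/2, the error
  \<open>4 * \<delta>\<close> becomes \<open>9 * \<delta>\<close>.\<close>

lemma damped_quadratic_form_le:
  fixes X :: "real^'n^'n"
  assumes sym: "transpose X = X" and bound: "\<And>h. \<bar>h \<bullet> (X *v h)\<bar> \<le> K * (norm h)\<^sup>2" and "0 < K" "0 < \<delta>"
  defines "B \<equiv> mat 1 - (1 / (2 * K)) *\<^sub>R X"
  shows "(B *v m) \<bullet> ((X + mat (4 * \<delta>)) *v (B *v m)) + K * (norm (m - B *v m))\<^sup>2
    \<le> m \<bullet> ((X - (1 / (2 * K)) *\<^sub>R (X ** X) + mat (9 * \<delta>)) *v m)"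
proof -
  define y where "y = X *v m"
  define s where "s = 1 / (2 * K)"
  have s: "K * s = 1 / 2" "0 < s"
    using \<open>0 < K\<close> by (simp_all add: s_def)
  have Bm: "B *v m = m - s *\<^sub>R y"
    by (simp add: B_def s_def y_def matrix_vector_mult_diff_rdistrib scaleR_matrix_vector_assoc[symmetric])
  have "norm y \<le> K * norm m"
    unfolding y_def by (rule norm_symmetric_matrix_vector_le[OF sym bound])
  have "norm (s *\<^sub>R y) \<le> norm m / 2"
    using mult_left_mono[OF \<open>norm y \<le> _\<close>, of s] s \<open>0 < K\<close> by (simp add: s_def)
  then have "norm (B *v m) \<le> 3 / 2 * norm m"
    using norm_triangle_ineq4[of m "s *\<^sub>R y"] by (simp add: Bm)
  then have "(norm (B *v m))\<^sup>2 \<le> (3 / 2 * norm m)\<^sup>2"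
    by (rule power_mono) simp
  then have B2: "4 * \<delta> * (norm (B *v m))\<^sup>2 \<le> 9 * \<delta> * (norm m)\<^sup>2"
    using mult_left_mono[of "(norm (B *v m))\<^sup>2" "(3 / 2 * norm m)\<^sup>2" "4 * \<delta>"] \<open>0 < \<delta>\<close>
    by (simp add: power_mult_distrib power_divide)
  have "y \<bullet> (X *v y) \<le> K * (norm y)\<^sup>2"
    using bound[of y] by (simp add: abs_le_iff)
  then have "s\<^sup>2 * (y \<bullet> (X *v y)) \<le> s\<^sup>2 * (K * (norm y)\<^sup>2)"
    by (intro mult_left_mono) auto
  also have "\<dots> = s * (K * s) * (norm y)\<^sup>2"
    by (simp add: power2_eq_square)
  finally have yXy: "s\<^sup>2 * (y \<bullet> (X *v y)) \<le> s / 2 * (norm y)\<^sup>2"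
    by (simp add: s)
  have mXy: "m \<bullet> (X *v y) = (norm y)\<^sup>2"
    by (simp add: symmetric_matrix_inner[OF sym] y_def power2_norm_eq_inner)
  have "(B *v m) \<bullet> (X *v (B *v m)) = m \<bullet> y - 2 * s * (norm y)\<^sup>2 + s\<^sup>2 * (y \<bullet> (X *v y))"
    unfolding Bm
    by (simp add: matrix_vector_mult_diff_distrib matrix_vector_mult_scaleR inner_diff_left inner_diff_right
        mXy power2_eq_square algebra_simps flip: y_def) (simp add: power2_norm_eq_inner power2_eq_square[symmetric])
  moreover have "K * (norm (m - B *v m))\<^sup>2 = s / 2 * (norm y)\<^sup>2"
    using s by (simp add: Bm power_mult_distrib power2_eq_square mult.assoc[symmetric])
  moreover have "(B *v m) \<bullet> ((X + mat (4 * \<delta>)) *v (B *v m)) = (B *v m) \<bullet> (X *v (B *v m)) + 4 * \<delta> * (norm (B *v m))\<^sup>2"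
    by (simp add: matrix_vector_mult_add_rdistrib mat_mult_vector inner_add_right power2_norm_eq_inner)
  moreover have "m \<bullet> ((X - (1 / (2 * K)) *\<^sub>R (X ** X) + mat (9 * \<delta>)) *v m)
      = m \<bullet> y - s * (norm y)\<^sup>2 + 9 * \<delta> * (norm m)\<^sup>2"
    unfolding s_def[symmetric]
    by (simp add: matrix_vector_mult_add_rdistrib matrix_vector_mult_diff_rdistrib mat_mult_vector
        scaleR_matrix_vector_assoc[symmetric] matrix_vector_mul_assoc[symmetric] inner_add_right inner_diff_right
        mXy power2_norm_eq_inner[of m] flip: y_def)
  ultimately show ?thesis
    using B2 yXy by linarith
qed

text \<open>\<open>w\<close> stands for the negative of a supersolution, so both convolutions are
  sup-convolutions; \<open>z1\<close> and \<open>z2\<close> are points where they are attained. The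
  damping matrix is used for \<open>v\<close> and the identity for \<open>w\<close>, so that the sum
  of the two Hessians keeps the term \<open>- X^2 / (2 K)\<close>.\<close>

lemma doubling_penalized:
  fixes v w :: "real^'n \<Rightarrow> real"
  assumes C: "compact C" "usc_on C v" "usc_on C w" and "xh \<in> C" and "0 < K" "0 < \<delta>" "0 < \<sigma>"
  shows "\<exists>z1\<in>C. \<exists>z2\<in>C. \<exists>X x1 y1. transpose X = X \<and> (\<forall>h. \<bar>h \<bullet> (X *v h)\<bar> \<le> K * (norm h)\<^sup>2)
    \<and> norm (x1 - y1) \<le> \<sigma>
    \<and> v xh + w xh - \<sigma> \<le> v z1 + w z2 - K / 2 * ((norm (x1 - z1))\<^sup>2 + (norm (y1 - z2))\<^sup>2)
    \<and> (\<exists>l. \<forall>\<^sub>F m in nhds 0. z1 + m \<in> C \<longrightarrow>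
        v (z1 + m) \<le> v z1 + l \<bullet> m + m \<bullet> ((X - (1 / (2 * K)) *\<^sub>R (X ** X) + mat (9 * \<delta>)) *v m) / 2)
    \<and> (\<exists>l. \<forall>\<^sub>F m in nhds 0. z2 + m \<in> C \<longrightarrow>
        w (z2 + m) \<le> w z2 + l \<bullet> m + m \<bullet> ((mat (4 * \<delta>) - X) *v m) / 2)"
proof -
  have "C \<noteq> {}"
    using \<open>xh \<in> C\<close> by auto
  obtain R0 where R0: "\<And>z. z \<in> C \<Longrightarrow> norm z \<le> R0"
    using compact_imp_bounded[OF C(1)] unfolding bounded_iff by blast
  then have "0 \<le> R0"
    using \<open>xh \<in> C\<close> norm_ge_zero order_trans by blast
  obtain V where V: "\<And>z. z \<in> C \<Longrightarrow> v z \<le> V"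
    using usc_on_attains_sup[OF C(1) \<open>C \<noteq> {}\<close> C(2)] by blast
  obtain W where W: "\<And>z. z \<in> C \<Longrightarrow> w z \<le> W"
    using usc_on_attains_sup[OF C(1) \<open>C \<noteq> {}\<close> C(3)] by blast
  have square: "a - K / 2 * (norm z)\<^sup>2 + K * (x \<bullet> z) - K / 2 * (norm x)\<^sup>2 = a - K / 2 * (norm (x - z))\<^sup>2"
    for a x and z :: "real^'n"
    by (simp add: power2_norm_eq_inner inner_diff_left inner_diff_right inner_commute[of z x] algebra_simps)
  obtain c where c: "\<And>x. \<exists>z\<in>C. c x = v z - K / 2 * (norm z)\<^sup>2 + K * (x \<bullet> z)"
    "\<And>x z. z \<in> C \<Longrightarrow> v z - K / 2 * (norm z)\<^sup>2 + K * (x \<bullet> z) \<le> c x"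
    using sup_convolution_exists[OF C(1) \<open>C \<noteq> {}\<close> C(2)] by metis
  obtain d where d: "\<And>x. \<exists>z\<in>C. d x = w z - K / 2 * (norm z)\<^sup>2 + K * (x \<bullet> z)"
    "\<And>x z. z \<in> C \<Longrightarrow> w z - K / 2 * (norm z)\<^sup>2 + K * (x \<bullet> z) \<le> d x"
    using sup_convolution_exists[OF C(1) \<open>C \<noteq> {}\<close> C(3)] by metis
  have sub: "\<exists>p. \<forall>y. b x + p \<bullet> (y - x) \<le> b y"
    if b: "\<And>x. \<exists>z\<in>C. b x = a z - K / 2 * (norm z)\<^sup>2 + K * (x \<bullet> z)"
      "\<And>x z. z \<in> C \<Longrightarrow> a z - K / 2 * (norm z)\<^sup>2 + K * (x \<bullet> z) \<le> b x" for a b x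
  proof -
    obtain z where z: "z \<in> C" "b x = a z - K / 2 * (norm z)\<^sup>2 + K * (x \<bullet> z)"
      using b(1) by blast
    have "b x + (K *\<^sub>R z) \<bullet> (y - x) \<le> b y" for y
      using b(2)[OF z(1), of y] z(2) by (simp add: inner_diff_right inner_commute[of z] right_diff_distrib)
    then show ?thesis
      by blast
  qed
  have sub_c: "\<exists>p. \<forall>y. c x + p \<bullet> (y - x) \<le> c y" and sub_d: "\<exists>p. \<forall>y. d x + p \<bullet> (y - x) \<le> d y" for x
    by (rule sub[OF c], assumption) (rule sub[OF d], assumption)
  have cont: "continuous_on UNIV c" "continuous_on UNIV d"
    using sub_c sub_d by (auto intro!: convex_on_continuous[OF open_UNIV] subgradients_imp_convex_on)
  define f where "f x = c x - K / 2 * (norm x)\<^sup>2" for x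
  define g where "g x = d x - K / 2 * (norm x)\<^sup>2" for x
  have f_cont: "continuous_on UNIV f" and g_cont: "continuous_on UNIV g"
    unfolding f_def g_def by (intro continuous_intros cont)+
  have f_ge: "v z \<le> f x + K / 2 * (norm (x - z))\<^sup>2" and g_ge: "w z \<le> g x + K / 2 * (norm (x - z))\<^sup>2"
    if "z \<in> C" for x z
    using c(2)[OF that, of x] d(2)[OF that, of x] square[of "v z" z x] square[of "w z" z x]
    unfolding f_def g_def by linarith+
  have f_att: "\<exists>z\<in>C. v z = f x + K / 2 * (norm (x - z))\<^sup>2" for x
  proof -
    obtain z where "z \<in> C" "c x = v z - K / 2 * (norm z)\<^sup>2 + K * (x \<bullet> z)"
      using c(1) by blast
    then show ?thesis
      using square[of "v z" z x] by (intro bexI[of _ z]) (auto simp: f_def)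
  qed
  have g_att: "\<exists>z\<in>C. w z = g x + K / 2 * (norm (x - z))\<^sup>2" for x
  proof -
    obtain z where "z \<in> C" "d x = w z - K / 2 * (norm z)\<^sup>2 + K * (x \<bullet> z)"
      using d(1) by blast
    then show ?thesis
      using square[of "w z" z x] by (intro bexI[of _ z]) (auto simp: g_def)
  qed
  \<comment> \<open>Every point of \<open>C\<close> is at least \<open>norm y - R0\<close> away from
    \<open>y\<close>, and each convolution pays \<open>K / 2\<close> times the square of that
    distance.\<close>
  have far: "f y + g y \<le> V + W - K * (norm y - R0)\<^sup>2" if "R0 \<le> norm y" for y
  proof -
    have dist: "(norm y - R0)\<^sup>2 \<le> (norm (y - z))\<^sup>2" if "z \<in> C" for z
      using R0[OF that] \<open>R0 \<le> norm y\<close> norm_triangle_ineq2[of y z] by (intro power_mono) auto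
    obtain z z' where z: "z \<in> C" "v z = f y + K / 2 * (norm (y - z))\<^sup>2" "z' \<in> C" "w z' = g y + K / 2 * (norm (y - z'))\<^sup>2"
      using f_att[of y] g_att[of y] by blast
    have "K / 2 * (norm y - R0)\<^sup>2 \<le> K / 2 * (norm (y - z))\<^sup>2" "K / 2 * (norm y - R0)\<^sup>2 \<le> K / 2 * (norm (y - z'))\<^sup>2"
      using \<open>0 < K\<close> dist z by (auto intro!: mult_left_mono)
    then show ?thesis
      using V[OF z(1)] W[OF z(3)] z(2,4) by linarith
  qed
  define M where "M = f xh + g xh"
  define a where "a = V + W - M + norm xh"
  \<comment> \<open>Beyond this radius the quadratic loss in \<open>far\<close> exceeds
    \<open>a\<close> plus the tilt at \<open>y\<close>. The constant \<open>a\<close> already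
    contains the tilt at \<open>xh\<close>, estimated with \<open>\<eta> \<le> 1\<close>.\<close>
  define R where "R = R0 + (2 + \<bar>a\<bar> + R0) / K + 1"
  have "0 < R"
    using \<open>0 \<le> R0\<close> \<open>0 < K\<close> by (simp add: R_def add_nonneg_pos)
  \<comment> \<open>The tilt affects the comparison of \<open>xh\<close> with the contact point by
    at most \<open>\<eta> * (R + norm xh)\<close>. It may use half of \<open>\<sigma>\<close>; the
    other half pays for moving \<open>f\<close> and \<open>g\<close> to the perturbed
    points.\<close>
  define \<eta> where "\<eta> = min 1 (\<sigma> / (2 * (R + norm xh)))"
  have "0 < \<eta>" "\<eta> \<le> 1"
    using \<open>0 < \<sigma>\<close> \<open>0 < R\<close> by (auto simp: \<eta>_def add_pos_nonneg)
  have \<eta>R: "\<eta> * (R + norm xh) \<le> \<sigma> / 2"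
  proof -
    have "\<eta> * (R + norm xh) \<le> \<sigma> / (2 * (R + norm xh)) * (R + norm xh)"
      using \<open>0 < R\<close> by (intro mult_right_mono) (auto simp: \<eta>_def)
    also have "\<dots> = \<sigma> / 2"
    proof -
      have "R + norm xh \<noteq> 0"
        using \<open>0 < R\<close> norm_ge_zero[of xh] by linarith
      then show ?thesis
        by (simp del: distrib_left_numeral)
    qed
    finally show ?thesis .
  qed
  have cd: "c y + d y - K * (norm y)\<^sup>2 = f y + g y" for y
    by (simp add: f_def g_def)
  have coercive: "c y + d y - K * (norm y)\<^sup>2 + \<eta> * norm y < c xh + d xh - K * (norm xh)\<^sup>2 - \<eta> * norm xh"
    if "R \<le> norm y" for y
  proof -
    define s where "s = norm y - R0"
    have s: "(2 + \<bar>a\<bar> + R0) / K + 1 \<le> s"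
      using that by (simp add: s_def R_def)
    moreover have "0 \<le> (2 + \<bar>a\<bar> + R0) / K"
      using \<open>0 \<le> R0\<close> \<open>0 < K\<close> by simp
    ultimately have "1 \<le> s"
      by linarith
    have "2 + \<bar>a\<bar> + R0 + K \<le> K * s"
    proof -
      have "K * ((2 + \<bar>a\<bar> + R0) / K + 1) = 2 + \<bar>a\<bar> + R0 + K"
        using \<open>0 < K\<close> by (simp add: field_simps)
      then show ?thesis
        using mult_left_mono[OF s, of K] \<open>0 < K\<close> by simp
    qed
    then have Ks: "1 + \<bar>a\<bar> + R0 \<le> K * s - 1"
      using \<open>0 < K\<close> by linarith
    also have "\<dots> \<le> (K * s - 1) * s"
      using mult_left_mono[OF \<open>1 \<le> s\<close>, of "K * s - 1"] Ks \<open>0 \<le> R0\<close> by simp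
    finally have "a + s + R0 < K * s\<^sup>2"
      by (simp add: power2_eq_square algebra_simps)
    moreover have "f y + g y \<le> V + W - K * s\<^sup>2"
      unfolding s_def using \<open>1 \<le> s\<close> by (intro far) (simp add: s_def)
    moreover have "\<eta> * norm y \<le> s + R0" "\<eta> * norm xh \<le> norm xh"
      using mult_right_mono[OF \<open>\<eta> \<le> 1\<close>, of "norm y"] mult_right_mono[OF \<open>\<eta> \<le> 1\<close>, of "norm xh"] by (simp_all add: s_def)
    ultimately show ?thesis
      unfolding cd a_def M_def by linarith
  qed
  obtain e where e: "0 < e" "\<And>x y. x \<in> cball 0 (R + 1) \<Longrightarrow> y \<in> cball 0 (R + 1) \<Longrightarrow> dist x y < e \<Longrightarrow> \<bar>f x - f y\<bar> < \<sigma> / 4"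
  proof -
    have "uniformly_continuous_on (cball 0 (R + 1)) f"
      by (intro compact_uniformly_continuous continuous_on_subset[OF f_cont]) auto
    then show ?thesis
      using that \<open>0 < \<sigma>\<close> unfolding uniformly_continuous_on_def dist_real_def
      by (metis abs_minus_commute dist_commute zero_less_divide_iff zero_less_numeral)
  qed
  obtain e' where e': "0 < e'" "\<And>x y. x \<in> cball 0 (R + 1) \<Longrightarrow> y \<in> cball 0 (R + 1) \<Longrightarrow> dist x y < e' \<Longrightarrow> \<bar>g x - g y\<bar> < \<sigma> / 4"
  proof -
    have "uniformly_continuous_on (cball 0 (R + 1)) g"
      by (intro compact_uniformly_continuous continuous_on_subset[OF g_cont]) auto
    then show ?thesis
      using that \<open>0 < \<sigma>\<close> unfolding uniformly_continuous_on_def dist_real_def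
      by (metis abs_minus_commute dist_commute zero_less_divide_iff zero_less_numeral)
  qed
  define r0 where "r0 = Min {1, \<sigma> / 2, e, e'}"
  have r0: "0 < r0" "r0 \<le> 1" "r0 \<le> \<sigma> / 2" "r0 \<le> e" "r0 \<le> e'"
    using \<open>0 < \<sigma>\<close> e(1) e'(1) by (auto simp: r0_def)
  obtain x p q A r where x: "norm x < R" "norm (p + q - (2 * K) *\<^sub>R x) \<le> \<eta>" "0 < r" "r < r0" "transpose A = A"
    and A: "\<And>h. 0 \<le> h \<bullet> (A *v h) \<and> h \<bullet> (A *v h) \<le> 2 * K * (norm h)\<^sup>2"
    and c_quad: "\<And>h. norm h \<le> r \<Longrightarrow> c (x + h) \<le> c x + p \<bullet> h + h \<bullet> (A *v h) / 2 + \<delta> * r\<^sup>2"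
    and d_quad: "\<And>h. norm h \<le> r \<Longrightarrow> d (x + h) \<le> d x + q \<bullet> h + K * (norm h)\<^sup>2 - h \<bullet> (A *v h) / 2 + \<delta> * r\<^sup>2"
    and cd_upper: "\<And>h. c (x + h) + d (x + h) \<le> c x + d x + (p + q) \<bullet> h + K * (norm h)\<^sup>2"
    using exists_quadratic_contact_point[OF sub_c sub_d \<open>0 < K\<close> \<open>0 < \<eta>\<close> \<open>0 < \<delta>\<close> r0(1) coercive] by blast
  \<comment> \<open>\<open>c\<close> and \<open>d\<close> exceed \<open>f\<close> and
    \<open>g\<close> by \<open>K / 2 * (norm x)\<^sup>2\<close>, so removing \<open>K\<close> from
    the Hessians \<open>A\<close> and \<open>2 K - A\<close> leaves \<open>X\<close> and
    \<open>- X\<close>, and \<open>0 \<le> A \<le> 2 K\<close> becomes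
    \<open>- K \<le> X \<le> K\<close>.\<close>
  define X where "X = A - mat K"
  have X: "transpose X = X"
    using x(5) by (simp add: X_def transpose_def mat_def vec_eq_iff)
  have Xh: "h \<bullet> (X *v h) = h \<bullet> (A *v h) - K * (norm h)\<^sup>2" for h
    by (simp add: X_def matrix_vector_mult_diff_rdistrib mat_mult_vector inner_diff_right power2_norm_eq_inner)
  have X_bound: "\<bar>h \<bullet> (X *v h)\<bar> \<le> K * (norm h)\<^sup>2" for h
    using A[of h] by (auto simp: Xh abs_le_iff)
  have expand: "K / 2 * (norm (x + h))\<^sup>2 = K / 2 * (norm x)\<^sup>2 + (K *\<^sub>R x) \<bullet> h + K / 2 * (norm h)\<^sup>2" for h
    by (simp add: power2_norm_eq_inner inner_add_left inner_add_right inner_commute[of h x] algebra_simps)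
  have f_quad: "f (x + h) \<le> f x + (p - K *\<^sub>R x) \<bullet> h + h \<bullet> (X *v h) / 2 + \<delta> * r\<^sup>2" if "norm h \<le> r" for h
    using c_quad[OF that] expand[of h]
    by (simp add: f_def Xh inner_diff_left add_divide_distrib diff_divide_distrib)
  have g_quad: "g (x + h) \<le> g x + (q - K *\<^sub>R x) \<bullet> h + h \<bullet> ((- X) *v h) / 2 + \<delta> * r\<^sup>2" if "norm h \<le> r" for h
  proof -
    have "h \<bullet> ((- X) *v h) = K * (norm h)\<^sup>2 - h \<bullet> (A *v h)"
      using Xh[of h] matrix_vector_mult_diff_rdistrib[of 0 X h] by simp
    then show ?thesis
      using d_quad[OF that] expand[of h] 
      by (simp add: g_def inner_diff_left add_divide_distrib diff_divide_distrib)
  qed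
  have mX: "transpose (- X) = - X"
    using X by (simp add: transpose_def vec_eq_iff)
  obtain h1 l1 where h1: "norm h1 < r"
    "\<forall>\<^sub>F h in nhds 0. f (x + h1 + h) \<le> f (x + h1) + l1 \<bullet> h + h \<bullet> ((X + mat (4 * \<delta>)) *v h) / 2"
    using touching_from_single_scale[OF f_cont x(3) \<open>0 < \<delta>\<close> X f_quad] by blast
  obtain h2 l2 where h2: "norm h2 < r"
    "\<forall>\<^sub>F h in nhds 0. g (x + h2 + h) \<le> g (x + h2) + l2 \<bullet> h + h \<bullet> ((- X + mat (4 * \<delta>)) *v h) / 2"
    using touching_from_single_scale[OF g_cont x(3) \<open>0 < \<delta>\<close> mX g_quad] by blast
  obtain z1 where z1: "z1 \<in> C" "v z1 = f (x + h1) + K / 2 * (norm (x + h1 - z1))\<^sup>2"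
    using f_att by blast
  obtain z2 where z2: "z2 \<in> C" "w z2 = g (x + h2) + K / 2 * (norm (x + h2 - z2))\<^sup>2"
    using g_att by blast
  have B: "transpose (mat 1 - (1 / (2 * K)) *\<^sub>R X) = mat 1 - (1 / (2 * K)) *\<^sub>R X"
    using X by (simp add: transpose_def mat_def vec_eq_iff)
  have "\<exists>l. \<forall>\<^sub>F m in nhds 0. z1 + m \<in> C \<longrightarrow>
      v (z1 + m) \<le> v z1 + l \<bullet> m + m \<bullet> ((X - (1 / (2 * K)) *\<^sub>R (X ** X) + mat (9 * \<delta>)) *v m) / 2"
    by (rule sup_convolution_touching[where C = C and v = v and f = f and K = K, OF _ z1(2) h1(2) B])
       (rule f_ge, assumption, rule damped_quadratic_form_le[OF X X_bound \<open>0 < K\<close> \<open>0 < \<delta>\<close>])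
  moreover have "\<exists>l. \<forall>\<^sub>F m in nhds 0. z2 + m \<in> C \<longrightarrow>
      w (z2 + m) \<le> w z2 + l \<bullet> m + m \<bullet> ((mat (4 * \<delta>) - X) *v m) / 2"
    by (rule sup_convolution_touching[where C = C and v = w and f = g and K = K, OF _ z2(2) h2(2) transpose_mat[of 1]])
       (rule g_ge, assumption, simp)
  moreover have "norm ((x + h1) - (x + h2)) \<le> \<sigma>"
    using h1(1) h2(1) x(4) r0(3) norm_triangle_ineq4[of h1 h2] by simp
  moreover have "v xh + w xh - \<sigma> \<le> v z1 + w z2 - K / 2 * ((norm (x + h1 - z1))\<^sup>2 + (norm (x + h2 - z2))\<^sup>2)"
  proof -
    have near: "x + h \<in> cball 0 (R + 1)" "dist x (x + h) < e" "dist x (x + h) < e'" if "norm h < r" for h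
      using that x(1,4) r0 norm_triangle_ineq[of x h] unfolding mem_cball_0 by (auto simp: dist_norm)
    have "x \<in> cball 0 (R + 1)"
      using x(1) by simp
    then have "f x - f (x + h1) < \<sigma> / 4" "g x - g (x + h2) < \<sigma> / 4"
      using e(2)[OF _ near(1,2)[OF h1(1)]] e'(2)[OF _ near(1,3)[OF h2(1)]] abs_less_iff by blast+
    then have "f x + g x - \<sigma> / 2 \<le> f (x + h1) + g (x + h2)"
      by linarith
    moreover have "f xh + g xh \<le> f x + g x + \<sigma> / 2"
    proof -
      define k where "k = xh - x"
      have "c (x + k) + d (x + k) \<le> c x + d x + (p + q) \<bullet> k + K * (norm k)\<^sup>2"
        by (rule cd_upper)
      then have "f (x + k) + g (x + k) \<le> f x + g x + (p + q - (2 * K) *\<^sub>R x) \<bullet> k"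
        using expand[of k]
        by (simp add: f_def g_def inner_diff_left[of "p + q"] add_divide_distrib diff_divide_distrib)
      also have "(p + q - (2 * K) *\<^sub>R x) \<bullet> k \<le> norm (p + q - (2 * K) *\<^sub>R x) * norm k"
        by (rule norm_cauchy_schwarz)
      also have "\<dots> \<le> \<eta> * (R + norm xh)"
        using x(1,2) norm_triangle_ineq4[of xh x] \<open>0 < \<eta>\<close> by (intro mult_mono) (auto simp: k_def)
      finally show ?thesis
        using \<eta>R by (simp add: k_def)
    qed
    moreover have "v xh + w xh \<le> f xh + g xh"
      using f_ge[OF \<open>xh \<in> C\<close>, of xh] g_ge[OF \<open>xh \<in> C\<close>, of xh] by simp
    ultimately show ?thesis
      using z1(2) z2(2) by (simp add: distrib_left)
  qed
  ultimately show ?thesis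
    using z1(1) z2(1) X X_bound by blast
qed


text \<open>The point \<open>z0\<close> is fixed before \<open>\<epsilon>\<close> because the ball,
  the ellipticity bound and the modulus used later depend on it. By semicontinuity and the
  maximality at \<open>xh\<close>, the values at \<open>z1\<close> and \<open>z2\<close> cannot
  exceed the maximum in the limit; this leaves no room for the penalty, which therefore tends to 0
  and does not merely stay bounded.\<close>

lemma doubling_limit_point:
  fixes v w :: "real^'n \<Rightarrow> real"
  assumes C: "compact C" "usc_on C v" "usc_on C w" and "xh \<in> C"
    and max: "\<And>z. z \<in> C \<Longrightarrow> v z + w z \<le> v xh + w xh" and "0 < \<delta>"
  shows "\<exists>z0\<in>C. v xh + w xh \<le> v z0 + w z0 \<and> (\<forall>\<epsilon>>0. \<exists>K\<ge>1. \<exists>z1\<in>C. \<exists>z2\<in>C. \<exists>X.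
    transpose X = X \<and> (\<forall>h. \<bar>h \<bullet> (X *v h)\<bar> \<le> K * (norm h)\<^sup>2)
    \<and> norm (z1 - z0) < \<epsilon> \<and> norm (z2 - z0) < \<epsilon> \<and> K * (norm (z1 - z2))\<^sup>2 < \<epsilon>
    \<and> (\<exists>l. \<forall>\<^sub>F m in nhds 0. z1 + m \<in> C \<longrightarrow>
        v (z1 + m) \<le> v z1 + l \<bullet> m + m \<bullet> ((X - (1 / (2 * K)) *\<^sub>R (X ** X) + mat (9 * \<delta>)) *v m) / 2)
    \<and> (\<exists>l. \<forall>\<^sub>F m in nhds 0. z2 + m \<in> C \<longrightarrow>
        w (z2 + m) \<le> w z2 + l \<bullet> m + m \<bullet> ((mat (4 * \<delta>) - X) *v m) / 2))"
proof -
  define \<sigma> where "\<sigma> j = 1 / real (Suc j)" for j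
  \<comment> \<open>With \<open>Kj j * \<sigma> j = 1\<close> the contribution
    \<open>Kj j * (\<sigma> j)\<^sup>2\<close> of the perturbed points equals
    \<open>\<sigma> j\<close> and disappears in the limit.\<close>
  define Kj where "Kj j = real (Suc j)" for j
  define touch where "touch K z1 z2 X \<longleftrightarrow> transpose X = X \<and> (\<forall>h. \<bar>h \<bullet> (X *v h)\<bar> \<le> K * (norm h)\<^sup>2)
    \<and> (\<exists>l. \<forall>\<^sub>F m in nhds 0. z1 + m \<in> C \<longrightarrow>
        v (z1 + m) \<le> v z1 + l \<bullet> m + m \<bullet> ((X - (1 / (2 * K)) *\<^sub>R (X ** X) + mat (9 * \<delta>)) *v m) / 2)
    \<and> (\<exists>l. \<forall>\<^sub>F m in nhds 0. z2 + m \<in> C \<longrightarrow>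
        w (z2 + m) \<le> w z2 + l \<bullet> m + m \<bullet> ((mat (4 * \<delta>) - X) *v m) / 2)"
    for K z1 z2 and X :: "real^'n^'n"
  define M where "M = v xh + w xh"
  have "\<exists>z1 z2 X x1 y1. z1 \<in> C \<and> z2 \<in> C \<and> touch (Kj j) z1 z2 X \<and> norm (x1 - y1) \<le> \<sigma> j
    \<and> M - \<sigma> j \<le> v z1 + w z2 - Kj j / 2 * ((norm (x1 - z1))\<^sup>2 + (norm (y1 - z2))\<^sup>2)" for j
    using doubling_penalized[OF C \<open>xh \<in> C\<close>, of "Kj j" \<delta> "\<sigma> j"] \<open>0 < \<delta>\<close>
    unfolding touch_def M_def by (simp add: Kj_def \<sigma>_def) blast
  then obtain z1 z2 X x1 y1 where z: "\<And>j. z1 j \<in> C" "\<And>j. z2 j \<in> C" and touch: "\<And>j. touch (Kj j) (z1 j) (z2 j) (X j)"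
    and xy: "\<And>j. norm (x1 j - y1 j) \<le> \<sigma> j"
    and pen: "\<And>j. M - \<sigma> j \<le> v (z1 j) + w (z2 j) - Kj j / 2 * ((norm (x1 j - z1 j))\<^sup>2 + (norm (y1 j - z2 j))\<^sup>2)"
    by metis
  define S where "S j = (norm (x1 j - z1 j))\<^sup>2 + (norm (y1 j - z2 j))\<^sup>2" for j
  have K: "1 \<le> Kj j" "0 < Kj j" "Kj j * \<sigma> j = 1" "0 < \<sigma> j" "\<sigma> j \<le> 1" for j
    by (simp_all add: Kj_def \<sigma>_def)
  have S_nn: "0 \<le> S j" for j
    by (simp add: S_def)
  have dist_le: "(norm (z1 j - z2 j))\<^sup>2 \<le> 3 * S j + 3 * (\<sigma> j)\<^sup>2" for j
  proof -
    define a b c where "a = norm (x1 j - z1 j)" and "b = norm (x1 j - y1 j)" and "c = norm (y1 j - z2 j)"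
    have "norm (z1 j - z2 j) = norm ((y1 j - z2 j) + (x1 j - y1 j) - (x1 j - z1 j))"
      by simp
    then have "norm (z1 j - z2 j) \<le> a + b + c"
      unfolding a_def b_def c_def
      using norm_triangle_ineq4[of "(y1 j - z2 j) + (x1 j - y1 j)" "x1 j - z1 j"]
        norm_triangle_ineq[of "y1 j - z2 j" "x1 j - y1 j"] by linarith
    then have "(norm (z1 j - z2 j))\<^sup>2 \<le> (a + b + c)\<^sup>2"
      by (rule power_mono) simp
    also have "\<dots> \<le> 3 * (a\<^sup>2 + b\<^sup>2 + c\<^sup>2)"
      using sum_squares_ge_zero[of "a - b" "b - c"] zero_le_square[of "a - c"]
      by (simp add: power2_eq_square algebra_simps)
    also have "b\<^sup>2 \<le> (\<sigma> j)\<^sup>2"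
      unfolding b_def by (rule power_mono[OF xy]) simp
    finally show ?thesis
      by (simp add: S_def a_def c_def)
  qed
  have "seq_compact C"
    using C(1) by (rule compact_imp_seq_compact)
  then obtain z0 r where z0: "z0 \<in> C" "strict_mono (r :: nat \<Rightarrow> nat)" "(z1 \<circ> r) \<longlonglongrightarrow> z0"
    using z(1) unfolding seq_compact_def by metis
  obtain V where V: "\<And>z. z \<in> C \<Longrightarrow> v z \<le> V"
    using usc_on_attains_sup[OF C(1) _ C(2)] \<open>xh \<in> C\<close> by blast
  obtain W where W: "\<And>z. z \<in> C \<Longrightarrow> w z \<le> W"
    using usc_on_attains_sup[OF C(1) _ C(3)] \<open>xh \<in> C\<close> by blast
  have \<sigma>_lim: "\<sigma> \<longlonglongrightarrow> 0"
    unfolding \<sigma>_def by (rule LIMSEQ_Suc[OF lim_1_over_n])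
  \<comment> \<open>A first, crude estimate: the penalty is bounded because \<open>v\<close> and
    \<open>w\<close> are bounded above. It gives \<open>z1\<close> and \<open>z2\<close> a common
    limit, which semicontinuity needs before the sharp estimate is possible.\<close>
  have dist_lim: "(\<lambda>j. norm (z1 j - z2 j)) \<longlonglongrightarrow> 0"
  proof -
    define A where "A = 6 * \<bar>V + W - M + 1\<bar> + 3"
    have bound: "(norm (z1 j - z2 j))\<^sup>2 \<le> A * \<sigma> j" for j
    proof -
      have "Kj j * S j / 2 \<le> V + W - M + 1"
        using pen[of j] V[OF z(1)[of j]] W[OF z(2)[of j]] K(5)[of j] by (simp add: S_def[symmetric])
      then have "\<sigma> j * (Kj j * S j / 2) \<le> \<sigma> j * (V + W - M + 1)"
        using K(4)[of j] by (intro mult_left_mono) auto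
      moreover have "\<sigma> j * (Kj j * S j / 2) = (Kj j * \<sigma> j) * (S j / 2)"
        by simp
      then have "\<sigma> j * (Kj j * S j / 2) = S j / 2"
        unfolding K(3) by simp
      moreover have "\<sigma> j * (V + W - M + 1) \<le> \<sigma> j * \<bar>V + W - M + 1\<bar>"
        using K(4)[of j] by (intro mult_left_mono) auto
      ultimately have "S j / 2 \<le> \<sigma> j * \<bar>V + W - M + 1\<bar>"
        by linarith
      then have "S j \<le> 2 * \<bar>V + W - M + 1\<bar> * \<sigma> j"
        by (simp add: mult.commute)
      moreover have "(\<sigma> j)\<^sup>2 \<le> \<sigma> j"
        using K(4,5)[of j] by (simp add: power2_eq_square mult_left_le)
      ultimately show ?thesis
        using dist_le[of j] by (simp add: A_def distrib_right)
    qed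
    have "(\<lambda>j. (norm (z1 j - z2 j))\<^sup>2) \<longlonglongrightarrow> 0"
    proof (rule tendsto_sandwich[OF _ _ tendsto_const])
      show "(\<lambda>j. A * \<sigma> j) \<longlonglongrightarrow> 0"
        using tendsto_mult[OF tendsto_const[of A] \<sigma>_lim] by simp
    qed (use bound in auto)
    then have "(\<lambda>j. sqrt ((norm (z1 j - z2 j))\<^sup>2)) \<longlonglongrightarrow> sqrt 0"
      by (rule tendsto_real_sqrt)
    then show ?thesis
      by simp
  qed
  have lim1: "(\<lambda>j. z1 (r j)) \<longlonglongrightarrow> z0"
    using z0(3) by (simp add: comp_def)
  have "(\<lambda>j. norm (z1 (r j) - z2 (r j))) \<longlonglongrightarrow> 0"
    using LIMSEQ_subseq_LIMSEQ[OF dist_lim z0(2)] by (simp add: comp_def)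
  then have "(\<lambda>j. z1 (r j) - z2 (r j)) \<longlonglongrightarrow> 0"
    by (rule tendsto_norm_zero_cancel)
  from tendsto_diff[OF lim1 this] have lim2: "(\<lambda>j. z2 (r j)) \<longlonglongrightarrow> z0"
    by simp
  have \<sigma>r: "(\<lambda>j. \<sigma> (r j)) \<longlonglongrightarrow> 0"
    using LIMSEQ_subseq_LIMSEQ[OF \<sigma>_lim z0(2)] by (simp add: comp_def)
  have ev: "\<forall>\<^sub>F j in sequentially. v (z1 (r j)) < v z0 + e \<and> w (z2 (r j)) < w z0 + e
      \<and> norm (z1 (r j) - z0) < e \<and> norm (z2 (r j) - z0) < e \<and> \<sigma> (r j) < e" if "0 < e" for e
  proof -
    have "\<forall>\<^sub>F j in sequentially. v (z1 (r j)) < v z0 + e" "\<forall>\<^sub>F j in sequentially. w (z2 (r j)) < w z0 + e"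
      by (rule usc_on_eventually_less[OF C(2) z0(1) _ lim1 z(1)] usc_on_eventually_less[OF C(3) z0(1) _ lim2 z(2)],
          simp add: that)+
    moreover have "\<forall>\<^sub>F j in sequentially. norm (z1 (r j) - z0) < e" "\<forall>\<^sub>F j in sequentially. norm (z2 (r j) - z0) < e"
      using tendstoD[OF lim1 that] tendstoD[OF lim2 that] by (simp_all add: dist_norm)
    moreover have "\<forall>\<^sub>F j in sequentially. \<sigma> (r j) < e"
      using order_tendstoD(2)[OF \<sigma>r that] .
    ultimately show ?thesis
      by eventually_elim simp
  qed
  have M_le: "M \<le> v z0 + w z0"
  proof (rule field_le_epsilon)
    fix e :: real assume "0 < e"
    then obtain j where j: "v (z1 (r j)) < v z0 + e / 3" "w (z2 (r j)) < w z0 + e / 3" "\<sigma> (r j) < e / 3"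
      using eventually_happens[OF ev[of "e / 3"]] by auto
    have "0 \<le> Kj (r j) / 2 * S (r j)"
      using K(2) S_nn by (simp add: less_imp_le)
    then show "M \<le> v z0 + w z0 + e"
      using pen[of "r j"] j by (simp add: S_def[symmetric])
  qed
  have "\<exists>K\<ge>1. \<exists>z1\<in>C. \<exists>z2\<in>C. \<exists>X. touch K z1 z2 X \<and> norm (z1 - z0) < \<epsilon> \<and> norm (z2 - z0) < \<epsilon> \<and> K * (norm (z1 - z2))\<^sup>2 < \<epsilon>"
    if "0 < \<epsilon>" for \<epsilon>
  proof -
    \<comment> \<open>The penalty \<open>Kj j / 2 * S j\<close> will be below \<open>3 * e\<close>
      and enters with the factor 6, and \<open>\<sigma> j < e\<close> enters with the factor 3; the
      total is below \<open>21 * e\<close>.\<close>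
    define e where "e = \<epsilon> / 24"
    have "0 < e"
      using that by (simp add: e_def)
    then obtain j' where j': "v (z1 (r j')) < v z0 + e" "w (z2 (r j')) < w z0 + e" "\<sigma> (r j') < e"
      "norm (z1 (r j') - z0) < e" "norm (z2 (r j') - z0) < e"
      using eventually_happens[OF ev[of e]] by auto
    define j where "j = r j'"
    have "Kj j / 2 * S j < 3 * e"
      using pen[of j] j' max[OF z0(1)] unfolding j_def[symmetric] M_def[symmetric] S_def[symmetric] by linarith
    moreover have "Kj j * (norm (z1 j - z2 j))\<^sup>2 \<le> Kj j * (3 * S j + 3 * (\<sigma> j)\<^sup>2)"
      using dist_le[of j] K(2)[of j] by (intro mult_left_mono) auto
    moreover have "Kj j * (3 * S j + 3 * (\<sigma> j)\<^sup>2) = 6 * (Kj j / 2 * S j) + 3 * (Kj j * \<sigma> j) * \<sigma> j"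
      by (simp add: power2_eq_square algebra_simps)
    ultimately have "Kj j * (norm (z1 j - z2 j))\<^sup>2 < \<epsilon>"
      using j'(3) that unfolding K(3) j_def[symmetric] by (simp add: e_def)
    moreover have "norm (z1 j - z0) < \<epsilon>" "norm (z2 j - z0) < \<epsilon>"
      using j'(4,5) that unfolding j_def[symmetric] by (simp_all add: e_def)
    ultimately show ?thesis
      using K(1) z touch by blast
  qed
  note near = this
  show ?thesis
  proof (intro bexI[of _ z0] conjI allI impI)
    show "v xh + w xh \<le> v z0 + w z0"
      using M_le by (simp add: M_def)
    fix \<epsilon> :: real assume "0 < \<epsilon>"
    from near[OF this] obtain K' z1' z2' X' where "1 \<le> K'" "z1' \<in> C" "z2' \<in> C" "touch K' z1' z2' X'"
      "norm (z1' - z0) < \<epsilon>" "norm (z2' - z0) < \<epsilon>" "K' * (norm (z1' - z2'))\<^sup>2 < \<epsilon>"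
      by blast
    then show "\<exists>K\<ge>1. \<exists>z1\<in>C. \<exists>z2\<in>C. \<exists>X.
      transpose X = X \<and> (\<forall>h. \<bar>h \<bullet> (X *v h)\<bar> \<le> K * (norm h)\<^sup>2)
      \<and> norm (z1 - z0) < \<epsilon> \<and> norm (z2 - z0) < \<epsilon> \<and> K * (norm (z1 - z2))\<^sup>2 < \<epsilon>
      \<and> (\<exists>l. \<forall>\<^sub>F m in nhds 0. z1 + m \<in> C \<longrightarrow>
          v (z1 + m) \<le> v z1 + l \<bullet> m + m \<bullet> ((X - (1 / (2 * K)) *\<^sub>R (X ** X) + mat (9 * \<delta>)) *v m) / 2)
      \<and> (\<exists>l. \<forall>\<^sub>F m in nhds 0. z2 + m \<in> C \<longrightarrow>
          w (z2 + m) \<le> w z2 + l \<bullet> m + m \<bullet> ((mat (4 * \<delta>) - X) *v m) / 2)"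
      unfolding touch_def
      by (elim conjE, intro exI[of _ K'] bexI[of _ z1'] bexI[of _ z2'] exI[of _ X'] conjI) assumption+
  qed (rule z0(1))
qed

section \<open>The comparison principle\<close>

lemma symmetric_matrix_diff: "transpose X = X \<Longrightarrow> transpose Y = Y \<Longrightarrow> transpose (X - Y) = X - Y"
  for X Y :: "real^'n^'n"
  by (simp add: transpose_def vec_eq_iff)

lemma symmetric_matrix_scaleR: "transpose X = X \<Longrightarrow> transpose (a *\<^sub>R X) = a *\<^sub>R X"
  for X :: "real^'n^'n"
  by (simp add: transpose_scalar)

lemma symmetric_matrix_square: "transpose X = X \<Longrightarrow> transpose (X ** X) = X ** X"
  for X :: "real^'n^'n"
  by (simp add: matrix_transpose_mul)

lemma trace_square_symmetric:
  fixes X :: "real^'n^'n"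
  assumes "transpose X = X"
  shows "trace (X ** X) = (norm X)\<^sup>2"
proof -
  have "X $ k $ i = X $ i $ k" for i k
    using assms by (metis transpose_def vec_lambda_beta)
  then show ?thesis
    by (simp add: trace_def matrix_matrix_mult_def power2_norm_eq_inner inner_vec_def)
qed

lemma sym_norm_eq_norm: "transpose X = X \<Longrightarrow> sym_norm X = norm X" for X :: "real^'n^'n"
  by (simp add: sym_norm_def trace_square_symmetric)

lemma trace_mat: "trace (mat a :: real^'n^'n) = real CARD('n) * a"
  by (simp add: trace_def mat_def)

lemma trace_scaleR: "trace (a *\<^sub>R X) = a * trace X" for X :: "real^'n^'n"
  by (simp add: trace_def sum_distrib_left)

text \<open>The rows of \<open>X ** X\<close> are the images of the rows of \<open>X\<close> under
  \<open>X\<close>, so the bound for vectors applies row by row.\<close>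

lemma norm_matrix_square_le:
  fixes X :: "real^'n^'n"
  assumes sym: "transpose X = X" and bound: "\<And>h. \<bar>h \<bullet> (X *v h)\<bar> \<le> K * (norm h)\<^sup>2" and "0 \<le> K"
  shows "norm (X ** X) \<le> K * norm X"
proof -
  have "X $ k $ j = X $ j $ k" for j k
    using sym by (metis transpose_def vec_lambda_beta)
  then have row: "(X ** X) $ i = X *v (X $ i)" for i
    by (simp add: vec_eq_iff matrix_matrix_mult_def matrix_vector_mult_def mult.commute)
  have "norm (X ** X) \<le> L2_set (\<lambda>i. K * norm (X $ i)) UNIV"
    unfolding norm_vec_def[of "X ** X"] row by (intro L2_set_mono norm_symmetric_matrix_vector_le[OF sym bound]) auto
  also have "\<dots> = K * norm X"
    unfolding norm_vec_def[of X] using \<open>0 \<le> K\<close> by (simp add: L2_set_right_distrib)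
  finally show ?thesis .
qed

lemma psd_mat: "0 \<le> a \<Longrightarrow> psd (mat a)"
  by (simp add: psd_def sym_matrices_def mat_mult_vector)

lemma psd_scaled_square:
  fixes X :: "real^'n^'n"
  assumes "transpose X = X" "0 \<le> a"
  shows "psd (a *\<^sub>R (X ** X))"
proof -
  have "z \<bullet> ((a *\<^sub>R (X ** X)) *v z) = a * ((X *v z) \<bullet> (X *v z))" for z
    using symmetric_matrix_inner[OF assms(1), of z "X *v z"]
    by (simp add: scaleR_matrix_vector_assoc[symmetric] matrix_vector_mul_assoc[symmetric])
  then show ?thesis
    using assms by (simp add: psd_def sym_matrices_def symmetric_matrix_scaleR symmetric_matrix_square)
qed

text \<open>On a convex set the modulus may be taken to grow at most linearly.\<close>

lemma modulus_subdivide: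
  fixes G :: "'a::real_normed_vector \<Rightarrow> real"
  assumes "convex S" "x \<in> S" "y \<in> S" "0 < N"
    and bound: "\<And>x y. x \<in> S \<Longrightarrow> y \<in> S \<Longrightarrow> \<bar>G x - G y\<bar> \<le> \<omega> (s * norm (x - y))"
  shows "\<bar>G x - G y\<bar> \<le> real N * \<omega> (s * norm (x - y) / real N)"
proof -
  define p where "p i = x + (real i / real N) *\<^sub>R (y - x)" for i
  have p: "p i \<in> S" if "i \<le> N" for i
  proof -
    have "p i = (1 - real i / real N) *\<^sub>R x + (real i / real N) *\<^sub>R y"
      by (simp add: p_def algebra_simps)
    then show ?thesis
      using assms(1-4) that by (auto intro!: convexD simp: divide_simps)
  qed
  have step: "\<bar>G (p i) - G (p (Suc i))\<bar> \<le> \<omega> (s * norm (x - y) / real N)" if "i < N" for i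
  proof -
    have "p i - p (Suc i) = (1 / real N) *\<^sub>R (x - y)"
      by (simp add: p_def add_divide_distrib algebra_simps)
    then have "norm (p i - p (Suc i)) = norm (x - y) / real N"
      by simp
    then show ?thesis
      using bound[OF p p, of i "Suc i"] that by simp
  qed
  have "\<bar>G (p 0) - G (p k)\<bar> \<le> real k * \<omega> (s * norm (x - y) / real N)" if "k \<le> N" for k
    using that
  proof (induction k)
    case (Suc k)
    then have "\<bar>G (p 0) - G (p k)\<bar> \<le> real k * \<omega> (s * norm (x - y) / real N)"
      by simp
    moreover have "\<bar>G (p k) - G (p (Suc k))\<bar> \<le> \<omega> (s * norm (x - y) / real N)"
      using step Suc.prems by simp
    ultimately show ?case
      by (simp add: distrib_right abs_le_iff)
  qed simp
  from this[of N] show ?thesis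
    using \<open>0 < N\<close> by (simp add: p_def)
qed

text \<open>The arithmetic behind the contradiction: \<open>t\<close> is the distance of the two contact points and
  \<open>m\<close> the norm of the common Hessian; the gain \<open>lam0 m\<^sup>2 / (2 K)\<close> absorbs the term linear in \<open>m\<close>.\<close>

lemma modulus_absorbed:
  fixes lam0 \<theta> \<delta>1 c K m t s :: real
  assumes \<omega>: "modulus_of_continuity \<omega>" "\<omega> \<delta>1 \<le> \<theta> / 4"
    and pos: "0 < lam0" "0 < \<theta>" "0 < \<delta>1" "0 \<le> c" "0 < K" "0 \<le> m" "0 \<le> t" "0 \<le> s" "s \<le> 2 * m + c"
    and small: "(c + 1) * t * (\<theta> / (4 * \<delta>1)) \<le> \<theta> / 8" "2 * (K * t\<^sup>2) * (\<theta> / (4 * \<delta>1))\<^sup>2 / lam0 \<le> \<theta> / 8"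
  shows "\<exists>N>0. real N * \<omega> ((s + 1) * t / real N) < \<theta> + lam0 * m\<^sup>2 / (2 * K)"
proof -
  define a where "a = \<theta> / (4 * \<delta>1)"
  define r where "r = (s + 1) * t / \<delta>1"
  \<comment> \<open>At least \<open>r\<close> pieces bring the argument of the modulus below
    \<open>\<delta>1\<close>; at most \<open>r + 2\<close> pieces keep the total linear in
    \<open>s\<close>.\<close>
  define N where "N = Suc (nat \<lceil>r\<rceil>)"
  have "0 \<le> r"
    using pos by (simp add: r_def)
  then have N: "r \<le> real N" "real N \<le> r + 2"
    unfolding N_def by linarith+
  have "0 < N"
    by (simp add: N_def)
  have "(s + 1) * t / real N \<le> \<delta>1"
    using N(1) \<open>0 < N\<close> \<open>0 < \<delta>1\<close> by (simp add: r_def field_simps)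
  moreover have "0 \<le> (s + 1) * t / real N"
    using pos by simp
  ultimately have "\<omega> ((s + 1) * t / real N) \<le> \<omega> \<delta>1"
    using \<omega>(1) \<open>0 < \<delta>1\<close> unfolding modulus_of_continuity_def mono_on_def by simp
  then have "real N * \<omega> ((s + 1) * t / real N) \<le> real N * (\<theta> / 4)"
    using \<omega>(2) by (intro mult_left_mono) auto
  also have "\<dots> \<le> (r + 2) * (\<theta> / 4)"
    using N(2) pos by (intro mult_right_mono) auto
  also have "\<dots> = (s + 1) * t * a + \<theta> / 2"
    using \<open>0 < \<delta>1\<close> by (simp add: r_def a_def field_simps)
  also have "\<dots> \<le> (2 * m + (c + 1)) * t * a + \<theta> / 2"
    using pos by (intro add_right_mono mult_right_mono) (auto simp: a_def)
  also have "\<dots> = 2 * m * t * a + (c + 1) * t * a + \<theta> / 2"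
    by (simp add: algebra_simps)
  \<comment> \<open>Young's inequality, weighted so that the whole gain is spent; the remainder
    contains \<open>K * t\<^sup>2\<close>, the quantity that the doubling makes small.\<close>
  also have "2 * m * t * a \<le> lam0 * m\<^sup>2 / (2 * K) + 2 * (K * t\<^sup>2) * a\<^sup>2 / lam0"
  proof -
    have "0 \<le> (lam0 * m - 2 * K * t * a)\<^sup>2 / (2 * K * lam0)"
      using pos by simp
    also have "\<dots> = lam0 * m\<^sup>2 / (2 * K) + 2 * (K * t\<^sup>2) * a\<^sup>2 / lam0 - 2 * m * t * a"
      using pos by (simp add: power2_eq_square field_simps)
    finally show ?thesis
      by simp
  qed
  also have "lam0 * m\<^sup>2 / (2 * K) + 2 * (K * t\<^sup>2) * a\<^sup>2 / lam0 + (c + 1) * t * a + \<theta> / 2 < \<theta> + lam0 * m\<^sup>2 / (2 * K)"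
    using small \<open>0 < \<theta>\<close> unfolding a_def[symmetric] by linarith
  finally show ?thesis
    using \<open>0 < N\<close> by auto
qed

text \<open>Both equations are compared with the same matrix \<open>X1\<close>. At \<open>z1\<close>
  the Hessian touching \<open>v\<close> lies \<open>\<kappa> / 2\<close> below \<open>X1\<close>, at
  \<open>z2\<close> the one touching \<open>u\<close> lies \<open>X^2 / (2 K)\<close> above it, and
  ellipticity turns these differences into the two terms on the left. The denominator 26 lets the
  touching errors, 9 and 4 parts, use up exactly half of \<open>\<kappa>\<close>.\<close>

lemma doubling_contradiction:
  fixes \<Omega> :: "(real^'n) set" and F :: "real^'n^'n \<Rightarrow> real^'n \<Rightarrow> real"
  assumes "open \<Omega>"
    and elliptic: "\<And>x X Y. x \<in> \<Omega> \<Longrightarrow> X \<in> sym_matrices \<Longrightarrow> Y \<in> sym_matrices \<Longrightarrow> sym_le X Y \<Longrightarrow>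
      lam x * trace (Y - X) \<le> F Y x - F X x"
    and sub: "viscosity_subsolution F \<Omega> v" and super: "viscosity_supersolution F \<Omega> u"
    and z: "z1 \<in> \<Omega>" "z2 \<in> \<Omega>" "lam0 \<le> lam z1" "lam0 \<le> lam z2" "0 < lam0"
    and X: "transpose X = X" and "0 < K" "0 < \<kappa>"
    and v: "\<forall>\<^sub>F m in nhds 0. z1 + m \<in> closure \<Omega> \<longrightarrow>
        v (z1 + m) + \<kappa> / 2 * ((norm (z1 + m))\<^sup>2 - b) \<le> v z1 + \<kappa> / 2 * ((norm z1)\<^sup>2 - b) + l \<bullet> m
          + m \<bullet> ((X - (1 / (2 * K)) *\<^sub>R (X ** X) + mat (9 * (\<kappa> / 26))) *v m) / 2"
    and u: "\<forall>\<^sub>F m in nhds 0. z2 + m \<in> closure \<Omega> \<longrightarrow>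
        - u (z2 + m) \<le> - u z2 + l' \<bullet> m + m \<bullet> ((mat (4 * (\<kappa> / 26)) - X) *v m) / 2"
  defines "X1 \<equiv> X - (1 / (2 * K)) *\<^sub>R (X ** X) - mat (4 * (\<kappa> / 26))"
  shows "lam0 * (real CARD('n) * (\<kappa> / 2)) + lam0 * (norm X)\<^sup>2 / (2 * K) \<le> F X1 z1 - F X1 z2"
proof -
  have X1: "transpose X1 = X1"
    unfolding X1_def
    by (intro symmetric_matrix_diff symmetric_matrix_scaleR symmetric_matrix_square X transpose_mat)
  have near: "\<forall>\<^sub>F m in nhds 0. z + m \<in> closure \<Omega>" if "z \<in> \<Omega>" for z
  proof -
    have "open ((\<lambda>m. z + m) -` \<Omega>)"
      using \<open>open \<Omega>\<close> by (intro open_vimage) (auto intro!: continuous_intros)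
    then have "\<forall>\<^sub>F m in nhds 0. m \<in> (\<lambda>m. z + m) -` \<Omega>"
      using that by (intro eventually_nhds_in_open) auto
    then show ?thesis
      by eventually_elim (use closure_subset in auto)
  qed
  let ?M = "X1 - mat (\<kappa> / 2)"
  have M: "transpose ?M = ?M"
    by (intro symmetric_matrix_diff X1 transpose_mat)
  have "0 \<le> F ?M z1"
  proof (rule viscosity_subsolutionD[OF sub z(1) M])
    show "\<forall>\<^sub>F m in nhds 0. v (z1 + m) \<le> v z1 + (l - \<kappa> *\<^sub>R z1) \<bullet> m + m \<bullet> (?M *v m) / 2"
      using v near[OF z(1)]
    proof eventually_elim
      case (elim m)
      have "m \<bullet> (?M *v m)
          = m \<bullet> ((X - (1 / (2 * K)) *\<^sub>R (X ** X) + mat (9 * (\<kappa> / 26))) *v m) - \<kappa> * (norm m)\<^sup>2"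
        by (simp add: X1_def matrix_vector_mult_add_rdistrib matrix_vector_mult_diff_rdistrib mat_mult_vector
            inner_add_right inner_diff_right power2_norm_eq_inner)
      moreover have "(norm (z1 + m))\<^sup>2 = (norm z1)\<^sup>2 + 2 * (z1 \<bullet> m) + (norm m)\<^sup>2"
        by (simp add: power2_norm_eq_inner inner_add_left inner_add_right inner_commute[of m z1])
      ultimately show ?case
        using elim by (simp add: inner_diff_left distrib_left right_diff_distrib diff_divide_distrib)
    qed
  qed
  moreover have "lam z1 * trace (X1 - ?M) \<le> F X1 z1 - F ?M z1"
    using X1 M psd_mat[of "\<kappa> / 2"] \<open>0 < \<kappa>\<close>
    by (intro elliptic z) (auto simp: sym_matrices_def sym_le_def)
  moreover have "lam0 * (real CARD('n) * (\<kappa> / 2)) \<le> lam z1 * trace (X1 - ?M)"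
    using z(3) \<open>0 < \<kappa>\<close> by (simp add: trace_mat mult_right_mono)
  moreover have "F (X - mat (4 * (\<kappa> / 26))) z2 \<le> 0"
  proof (rule viscosity_supersolutionD[OF super z(2)])
    show "transpose (X - mat (4 * (\<kappa> / 26))) = X - mat (4 * (\<kappa> / 26))"
      by (intro symmetric_matrix_diff X transpose_mat)
    show "\<forall>\<^sub>F m in nhds 0. u z2 + (- l') \<bullet> m + m \<bullet> ((X - mat (4 * (\<kappa> / 26))) *v m) / 2 \<le> u (z2 + m)"
      using u near[OF z(2)]
    proof eventually_elim
      case (elim m)
      have "m \<bullet> ((X - mat (4 * (\<kappa> / 26))) *v m) = - (m \<bullet> ((mat (4 * (\<kappa> / 26)) - X) *v m))"
        by (simp add: matrix_vector_mult_diff_rdistrib inner_diff_right)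
      then show ?case
        using elim by simp
    qed
  qed
  moreover have "lam z2 * trace ((X - mat (4 * (\<kappa> / 26))) - X1) \<le> F (X - mat (4 * (\<kappa> / 26))) z2 - F X1 z2"
  proof -
    have "(X - mat (4 * (\<kappa> / 26))) - X1 = (1 / (2 * K)) *\<^sub>R (X ** X)"
      by (simp add: X1_def)
    then have "sym_le X1 (X - mat (4 * (\<kappa> / 26)))"
      using psd_scaled_square[OF X, of "1 / (2 * K)"] \<open>0 < K\<close> by (simp add: sym_le_def)
    moreover have "X - mat (4 * (\<kappa> / 26)) \<in> sym_matrices" "X1 \<in> sym_matrices"
      using X X1 by (simp_all add: sym_matrices_def symmetric_matrix_diff)
    ultimately show ?thesis
      using elliptic z(2) by blast
  qed
  moreover have "lam0 * (norm X)\<^sup>2 / (2 * K) \<le> lam z2 * trace ((X - mat (4 * (\<kappa> / 26))) - X1)"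
  proof -
    have "(X - mat (4 * (\<kappa> / 26))) - X1 = (1 / (2 * K)) *\<^sub>R (X ** X)"
      by (simp add: X1_def)
    then have "trace ((X - mat (4 * (\<kappa> / 26))) - X1) = (norm X)\<^sup>2 / (2 * K)"
      by (simp only: trace_scaleR trace_square_symmetric[OF X]) simp
    then show ?thesis
      using mult_right_mono[OF z(4), of "(norm X)\<^sup>2 / (2 * K)"] \<open>0 < K\<close> by simp
  qed
  ultimately show ?thesis
    by linarith
qed

theorem proposition2p2:
  fixes \<Omega> :: "(real^'n) set"
    and F :: "real^'n^'n \<Rightarrow> real^'n \<Rightarrow> real"
  assumes "open \<Omega>" and "bounded \<Omega>"
    and "\<exists>lam. lsc_on \<Omega> lam \<and> (\<forall>x\<in>\<Omega>. 0 < lam x) \<and>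
           (\<forall>x\<in>\<Omega>. \<forall>X\<in>sym_matrices. \<forall>Y\<in>sym_matrices. sym_le X Y \<longrightarrow>
              F Y x - F X x \<ge> lam x * trace (Y - X))"
    and "\<And>K. compact K \<Longrightarrow> K \<subseteq> \<Omega> \<Longrightarrow>
           \<exists>\<omega>. modulus_of_continuity \<omega> \<and>
             (\<forall>X\<in>sym_matrices. \<forall>x\<in>K. \<forall>y\<in>K.
                \<bar>F X x - F X y\<bar> \<le> \<omega> ((sym_norm X + 1) * norm (x - y)))"
  shows "comparison_principle F \<Omega>"
proof -
  obtain lam where lam: "lsc_on \<Omega> lam" "\<And>x. x \<in> \<Omega> \<Longrightarrow> 0 < lam x"
    and elliptic: "\<And>x X Y. x \<in> \<Omega> \<Longrightarrow> X \<in> sym_matrices \<Longrightarrow> Y \<in> sym_matrices \<Longrightarrow> sym_le X Y \<Longrightarrow>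
      lam x * trace (Y - X) \<le> F Y x - F X x"
    using assms(3) by blast
  have False if sub: "viscosity_subsolution F \<Omega> v" and super: "viscosity_supersolution F \<Omega> u"
    and boundary: "\<forall>x\<in>frontier \<Omega>. v x \<le> u x" and "xb \<in> \<Omega>" "u xb < v xb" for v u xb
  proof -
    define C where "C = closure \<Omega>"
    have "compact C"
      using \<open>bounded \<Omega>\<close> by (simp add: C_def compact_eq_bounded_closed bounded_closure)
    have "\<Omega> \<subseteq> C"
      by (simp add: C_def closure_subset)
    then have "xb \<in> C"
      using \<open>xb \<in> \<Omega>\<close> by blast
    obtain R where "0 < R" and R: "\<And>z. z \<in> C \<Longrightarrow> norm z \<le> R"
      using compact_imp_bounded[OF \<open>compact C\<close>] unfolding bounded_pos by blast
    \<comment> \<open>Subtracting \<open>R\<^sup>2\<close> makes the added term nonpositive on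
      \<open>C\<close>, which preserves the boundary inequality. This \<open>\<kappa>\<close> costs
      at most half of the gap at \<open>xb\<close>, so the maximum stays positive.\<close>
    define \<kappa> where "\<kappa> = (v xb - u xb) / R\<^sup>2"
    have "0 < \<kappa>"
      using \<open>u xb < v xb\<close> \<open>0 < R\<close> by (simp add: \<kappa>_def)
    define v' where "v' z = v z + \<kappa> / 2 * ((norm z)\<^sup>2 - R\<^sup>2)" for z
    define w where "w z = - u z" for z
    have v'_usc: "usc_on C v'"
      unfolding v'_def
    proof (rule usc_on_add)
      show "usc_on C v"
        using sub by (simp add: viscosity_subsolution_def C_def)
    qed (intro continuous_on_imp_usc_on continuous_intros)
    have w_usc: "usc_on C w"
      unfolding w_def using super
      by (intro lsc_on_imp_usc_on_minus) (simp add: viscosity_supersolution_def C_def)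
    have "C \<noteq> {}"
      using \<open>xb \<in> C\<close> by blast
    from usc_on_attains_sup[OF \<open>compact C\<close> this usc_on_add[OF v'_usc w_usc]]
    obtain xh where "xh \<in> C" and max: "\<And>z. z \<in> C \<Longrightarrow> v' z + w z \<le> v' xh + w xh"
      by blast
    have "0 < v' xb + w xb"
    proof -
      have "\<kappa> / 2 * R\<^sup>2 = (v xb - u xb) / 2"
        using \<open>0 < R\<close> by (simp add: \<kappa>_def)
      moreover have "0 \<le> \<kappa> / 2 * (norm xb)\<^sup>2"
        using \<open>0 < \<kappa>\<close> by simp
      ultimately show ?thesis
        using \<open>u xb < v xb\<close> by (simp add: v'_def w_def right_diff_distrib field_simps)
    qed
    then have max_pos: "0 < v' xh + w xh"
      using max[OF \<open>xb \<in> C\<close>] by simp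
    have "0 < \<kappa> / 26"
      using \<open>0 < \<kappa>\<close> by simp
    from doubling_limit_point[OF \<open>compact C\<close> v'_usc w_usc \<open>xh \<in> C\<close> max this]
    obtain z0 where "z0 \<in> C" and z0_max: "v' xh + w xh \<le> v' z0 + w z0"
      and contact: "\<And>\<epsilon>. 0 < \<epsilon> \<Longrightarrow> \<exists>K\<ge>1. \<exists>z1\<in>C. \<exists>z2\<in>C. \<exists>X.
        transpose X = X \<and> (\<forall>h. \<bar>h \<bullet> (X *v h)\<bar> \<le> K * (norm h)\<^sup>2)
        \<and> norm (z1 - z0) < \<epsilon> \<and> norm (z2 - z0) < \<epsilon> \<and> K * (norm (z1 - z2))\<^sup>2 < \<epsilon>
        \<and> (\<exists>l. \<forall>\<^sub>F m in nhds 0. z1 + m \<in> C \<longrightarrow>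
            v' (z1 + m) \<le> v' z1 + l \<bullet> m + m \<bullet> ((X - (1 / (2 * K)) *\<^sub>R (X ** X) + mat (9 * (\<kappa> / 26))) *v m) / 2)
        \<and> (\<exists>l. \<forall>\<^sub>F m in nhds 0. z2 + m \<in> C \<longrightarrow>
            w (z2 + m) \<le> w z2 + l \<bullet> m + m \<bullet> ((mat (4 * (\<kappa> / 26)) - X) *v m) / 2)"
      by blast
    have "z0 \<in> \<Omega>"
    proof (rule ccontr)
      assume "z0 \<notin> \<Omega>"
      then have "z0 \<in> frontier \<Omega>"
        using \<open>z0 \<in> C\<close> \<open>open \<Omega>\<close> by (simp add: C_def frontier_def interior_open)
      then have "v z0 \<le> u z0"
        using boundary by blast
      moreover have "(norm z0)\<^sup>2 \<le> R\<^sup>2"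
        by (intro power_mono R \<open>z0 \<in> C\<close>) simp
      then have "\<kappa> / 2 * ((norm z0)\<^sup>2 - R\<^sup>2) \<le> 0"
        using \<open>0 < \<kappa>\<close> by (intro mult_nonneg_nonpos) auto
      ultimately show False
        using z0_max max_pos by (simp add: v'_def w_def)
    qed
    define lam0 where "lam0 = lam z0 / 2"
    have "0 < lam0" "lam0 < lam z0"
      using lam(2)[OF \<open>z0 \<in> \<Omega>\<close>] by (simp_all add: lam0_def)
    obtain \<rho> where "0 < \<rho>" and \<rho>: "cball z0 \<rho> \<subseteq> \<Omega>" "\<And>z. z \<in> cball z0 \<rho> \<Longrightarrow> lam0 \<le> lam z"
    proof -
      obtain T where T: "open T" "z0 \<in> T" "\<forall>y\<in>T \<inter> \<Omega>. - lam y < - lam0"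
        using usc_onD[OF lsc_on_imp_usc_on_minus[OF lam(1)] \<open>z0 \<in> \<Omega>\<close>, of "- lam0"] \<open>lam0 < lam z0\<close> by auto
      then obtain \<rho> where "0 < \<rho>" "cball z0 \<rho> \<subseteq> T \<inter> \<Omega>"
        using \<open>open \<Omega>\<close> \<open>z0 \<in> \<Omega>\<close> open_contains_cball[of "T \<inter> \<Omega>"] by blast
      then show ?thesis
        using T(3) by (intro that[of \<rho>]) force+
    qed
    \<comment> \<open>The closed ball is compact, as the hypothesis on \<open>F\<close> requires,
      and convex, as the subdivision of segments requires.\<close>
    obtain \<omega> where \<omega>: "modulus_of_continuity \<omega>"
      and F_mod: "\<And>X x y. X \<in> sym_matrices \<Longrightarrow> x \<in> cball z0 \<rho> \<Longrightarrow> y \<in> cball z0 \<rho> \<Longrightarrow>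
        \<bar>F X x - F X y\<bar> \<le> \<omega> ((sym_norm X + 1) * norm (x - y))"
      using assms(4)[OF compact_cball \<rho>(1)] by blast
    define \<theta> where "\<theta> = lam0 * (real CARD('n) * (\<kappa> / 2))"
    have "0 < \<theta>"
      using \<open>0 < lam0\<close> \<open>0 < \<kappa>\<close> by (simp add: \<theta>_def)
    obtain \<delta>1 where "0 < \<delta>1" "\<omega> \<delta>1 \<le> \<theta> / 4"
    proof -
      have "\<forall>\<^sub>F r in at_right 0. \<omega> r < \<theta> / 4"
        using \<omega> \<open>0 < \<theta>\<close> order_tendstoD(2)[of \<omega> 0 "at_right 0" "\<theta> / 4"]
        unfolding modulus_of_continuity_def by simp
      then obtain b where "0 < b" "\<And>r. 0 < r \<Longrightarrow> r < b \<Longrightarrow> \<omega> r < \<theta> / 4"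
        unfolding eventually_at_right_field by blast
      from this(1) this(2)[of "b / 2"] show ?thesis
        by (intro that[of "b / 2"]) auto
    qed
    define a where "a = \<theta> / (4 * \<delta>1)"
    define c where "c = norm (mat (4 * (\<kappa> / 26)) :: real^'n^'n)"
    have "0 < a" "0 \<le> c"
      using \<open>0 < \<theta>\<close> \<open>0 < \<delta>1\<close> by (simp_all add: a_def c_def)
    \<comment> \<open>The first entry keeps \<open>z1\<close> and \<open>z2\<close> in the ball. The
      second, by \<open>t \<le> 2 * \<epsilon>\<close>, and the third, by
      \<open>K * t\<^sup>2 < \<epsilon>\<close>, bound the two error terms of
      \<open>modulus_absorbed\<close> by \<open>\<theta> / 8\<close> each.\<close>
    define \<epsilon> where "\<epsilon> = Min {\<rho>, \<theta> / (16 * ((c + 1) * a)), lam0 * \<theta> / (16 * a\<^sup>2)}"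
    have "0 < \<epsilon>"
      using \<open>0 < \<rho>\<close> \<open>0 < \<theta>\<close> \<open>0 < a\<close> \<open>0 \<le> c\<close> \<open>0 < lam0\<close> by (simp add: \<epsilon>_def)
    have \<epsilon>: "\<epsilon> \<le> \<rho>" "\<epsilon> \<le> \<theta> / (16 * ((c + 1) * a))" "\<epsilon> \<le> lam0 * \<theta> / (16 * a\<^sup>2)"
      by (simp_all add: \<epsilon>_def)
    from contact[OF \<open>0 < \<epsilon>\<close>] obtain K z1 z2 X l l' where "1 \<le> K" "z1 \<in> C" "z2 \<in> C" and X: "transpose X = X"
      and "\<forall>h. \<bar>h \<bullet> (X *v h)\<bar> \<le> K * (norm h)\<^sup>2"
      and near: "norm (z1 - z0) < \<epsilon>" "norm (z2 - z0) < \<epsilon>" "K * (norm (z1 - z2))\<^sup>2 < \<epsilon>"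
      and v_touch: "\<forall>\<^sub>F m in nhds 0. z1 + m \<in> C \<longrightarrow>
        v' (z1 + m) \<le> v' z1 + l \<bullet> m + m \<bullet> ((X - (1 / (2 * K)) *\<^sub>R (X ** X) + mat (9 * (\<kappa> / 26))) *v m) / 2"
      and u_touch: "\<forall>\<^sub>F m in nhds 0. z2 + m \<in> C \<longrightarrow>
        w (z2 + m) \<le> w z2 + l' \<bullet> m + m \<bullet> ((mat (4 * (\<kappa> / 26)) - X) *v m) / 2"
      by (elim exE bexE conjE) (rule that)
    then have X_bound: "\<bar>h \<bullet> (X *v h)\<bar> \<le> K * (norm h)\<^sup>2" for h
      by blast
    have "0 < K"
      using \<open>1 \<le> K\<close> by simp
    have z: "z1 \<in> cball z0 \<rho>" "z2 \<in> cball z0 \<rho>"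
      using near(1,2) \<epsilon>(1) by (auto simp: dist_norm norm_minus_commute)
    define X1 where "X1 = X - (1 / (2 * K)) *\<^sub>R (X ** X) - mat (4 * (\<kappa> / 26))"
    have X1: "transpose X1 = X1"
      unfolding X1_def
      by (intro symmetric_matrix_diff symmetric_matrix_scaleR symmetric_matrix_square X transpose_mat)
    have gain: "\<theta> + lam0 * (norm X)\<^sup>2 / (2 * K) \<le> F X1 z1 - F X1 z2"
      unfolding \<theta>_def X1_def
      by (rule doubling_contradiction[OF \<open>open \<Omega>\<close> elliptic sub super _ _ \<rho>(2)[OF z(1)] \<rho>(2)[OF z(2)] \<open>0 < lam0\<close> X
            \<open>0 < K\<close> \<open>0 < \<kappa>\<close> v_touch[unfolded v'_def C_def] u_touch[unfolded w_def C_def]])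
         (use z \<rho>(1) in auto)
    define t where "t = norm (z1 - z2)"
    have "0 \<le> t"
      by (simp add: t_def)
    have "t \<le> 2 * \<epsilon>"
      using near(1,2) norm_triangle_ineq4[of "z1 - z0" "z2 - z0"] by (simp add: t_def)
    \<comment> \<open>The square of \<open>X\<close> is at most \<open>K * norm X\<close>, so
      dividing by \<open>2 * K\<close> makes the quadratic correction linear in
      \<open>norm X\<close>, uniformly in \<open>K\<close>.\<close>
    have "norm X1 \<le> 2 * norm X + c"
    proof -
      have "norm (X ** X) \<le> K * norm X"
        using \<open>0 < K\<close> by (intro norm_matrix_square_le[OF X X_bound]) simp
      also have "\<dots> \<le> 2 * K * norm X"
        using \<open>0 < K\<close> by (intro mult_right_mono) auto
      finally have "norm ((1 / (2 * K)) *\<^sub>R (X ** X)) \<le> norm X"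
        using \<open>0 < K\<close> by (simp add: divide_le_eq mult.commute)
      then show ?thesis
        unfolding X1_def c_def
        using norm_triangle_ineq4[of "X - (1 / (2 * K)) *\<^sub>R (X ** X)" "mat (4 * (\<kappa> / 26))"]
          norm_triangle_ineq4[of X "(1 / (2 * K)) *\<^sub>R (X ** X)"] by linarith
    qed
    moreover have "(c + 1) * t * (\<theta> / (4 * \<delta>1)) \<le> \<theta> / 8"
    proof -
      have "t \<le> 2 * (\<theta> / (16 * ((c + 1) * a)))"
        using \<open>t \<le> 2 * \<epsilon>\<close> \<epsilon>(2) by linarith
      then have le: "(c + 1) * a * t \<le> (c + 1) * a * (2 * (\<theta> / (16 * ((c + 1) * a))))"
        by (rule mult_left_mono) (use \<open>0 < a\<close> \<open>0 \<le> c\<close> in simp)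
      have "q * (2 * (\<theta> / (16 * q))) = \<theta> / 8" if "q \<noteq> 0" for q
        using that by simp
      then have "(c + 1) * a * (2 * (\<theta> / (16 * ((c + 1) * a)))) = \<theta> / 8"
        using \<open>0 < a\<close> \<open>0 \<le> c\<close> by auto
      moreover have "(c + 1) * t * a = (c + 1) * a * t"
        by simp
      ultimately show ?thesis
        using le unfolding a_def[symmetric] by linarith
    qed
    moreover have "2 * (K * t\<^sup>2) * (\<theta> / (4 * \<delta>1))\<^sup>2 / lam0 \<le> \<theta> / 8"
    proof -
      have "K * t\<^sup>2 \<le> lam0 * \<theta> / (16 * a\<^sup>2)"
        using near(3) \<epsilon>(3) by (simp add: t_def)
      then have "2 * (K * t\<^sup>2) * a\<^sup>2 / lam0 \<le> 2 * (lam0 * \<theta> / (16 * a\<^sup>2)) * a\<^sup>2 / lam0"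
        using \<open>0 < lam0\<close> by (intro divide_right_mono mult_right_mono mult_left_mono) auto
      also have "\<dots> = \<theta> / 8"
        using \<open>0 < a\<close> \<open>0 < lam0\<close> by simp
      finally show ?thesis
        by (simp add: a_def)
    qed
    ultimately obtain N where N: "0 < N"
      "real N * \<omega> ((norm X1 + 1) * t / real N) < \<theta> + lam0 * (norm X)\<^sup>2 / (2 * K)"
      using modulus_absorbed[OF \<omega> \<open>\<omega> \<delta>1 \<le> \<theta> / 4\<close> \<open>0 < lam0\<close> \<open>0 < \<theta>\<close> \<open>0 < \<delta>1\<close> \<open>0 \<le> c\<close> \<open>0 < K\<close>
          norm_ge_zero[of X] \<open>0 \<le> t\<close> norm_ge_zero[of X1]] by blast
    have "\<bar>F X1 z1 - F X1 z2\<bar> \<le> real N * \<omega> ((norm X1 + 1) * norm (z1 - z2) / real N)"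
      using F_mod[of X1] X1
      by (intro modulus_subdivide[OF convex_cball z N(1)]) (simp add: sym_matrices_def sym_norm_eq_norm)
    then show False
      using gain N(2) by (simp add: t_def)
  qed
  then show ?thesis
    unfolding comparison_principle_def by (meson not_le)
qed

end
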